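(* Let $F$ be a non-abelian free group and let $H_1, \ldots, H_k$ be finitely generated subgroups of $F$, each of infinite index in $F$. Then there exists a surjective homomorphism $f: F \to A_m$ onto some alternating group $A_m$ such that for all $i,j$: whenever $H_i$ is not conjugate into $H_j$, then $f(H_i)$ is not conjugate into $f(H_j)$. Moreover, there exists a surjective homomorphism $f': F \to S_{m'}$ onto some symmetric group $S_{m'}$ with the same property (whenever $H_i$ is not conjugate into $H_j$, $f'(H_i)$ is not conjugate into $f'(H_j)$).
   Context: A subgroup $A$ of a group $X$ is conjugate into a subgroup $B$ of $X$ if there is $x \in X$ with $xAx^{-1} \leq B$. For the images, conjugacy is taken in the target group ($A_m$, resp. $S_{m'}$). *)

theory Defs
  imports "HOL-Algebra.Algebra"
begin

definition letter_val :: "('a, 'b) monoid_scheme \<Rightarrow> 'a \<times> bool \<Rightarrow> 'a" where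
  "letter_val G l = (if snd l then fst l else inv\<^bsub>G\<^esub> (fst l))"

definition word_val :: "('a, 'b) monoid_scheme \<Rightarrow> ('a \<times> bool) list \<Rightarrow> 'a" where
  "word_val G w = foldr (\<lambda>l acc. letter_val G l \<otimes>\<^bsub>G\<^esub> acc) w \<one>\<^bsub>G\<^esub>"

definition reduced_word :: "('a \<times> bool) list \<Rightarrow> bool" where
  "reduced_word w \<longleftrightarrow>
     (\<forall>i. Suc i < length w \<longrightarrow> \<not> (fst (w ! i) = fst (w ! Suc i) \<and> snd (w ! i) \<noteq> snd (w ! Suc i)))"

definition free_basis :: "('a, 'b) monoid_scheme \<Rightarrow> 'a set \<Rightarrow> bool" where
  "free_basis G B \<longleftrightarrow> group G \<and> B \<subseteq> carrier G \<and> generate G B = carrier G \<and>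
     (\<forall>w. set (map fst w) \<subseteq> B \<and> reduced_word w \<and> w \<noteq> [] \<longrightarrow> word_val G w \<noteq> one G)"

definition free_group :: "('a, 'b) monoid_scheme \<Rightarrow> bool" where
  "free_group G \<longleftrightarrow> (\<exists>B. free_basis G B)"

definition fin_gen_subgroup :: "('a, 'b) monoid_scheme \<Rightarrow> 'a set \<Rightarrow> bool" where
  "fin_gen_subgroup G H \<longleftrightarrow> subgroup H G \<and> (\<exists>S. finite S \<and> S \<subseteq> carrier G \<and> generate G S = H)"

definition conj_into :: "('a, 'b) monoid_scheme \<Rightarrow> 'a set \<Rightarrow> 'a set \<Rightarrow> bool" where
  "conj_into G A B \<longleftrightarrow> (\<exists>x\<in>carrier G. (\<lambda>h. x \<otimes>\<^bsub>G\<^esub> h \<otimes>\<^bsub>G\<^esub> inv\<^bsub>G\<^esub> x) ` A \<subseteq> B)"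

end

theory Submission
  imports Defs
begin

text \<open>The images of \<open>H\<^sub>i\<close> and \<open>H\<^sub>j\<close> are told apart by an invariant of permutation groups: the existence
  of a point \<open>v\<close> such that \<open>x ^ q\<^sub>j\<close> fixes \<open>v\<close> for all elements \<open>x\<close> of the subgroup, where \<open>q\<^sub>j\<close> is a power of
  a prime \<open>p\<^sub>j\<close>. To give \<open>H\<^sub>j\<close> such a point, a finite piece of \<open>F/H\<^sub>j \<times> Q\<^sub>j\<close> is built into the permutation
  representation, where \<open>Q\<^sub>j\<close> is a finite quotient of \<open>F\<close> of exponent \<open>q\<^sub>j\<close> in which every nontrivial \<open>H\<^sub>i\<close>
  survives. The primes are distinct and exceed the lengths of the relevant finite cycles in \<open>F/H\<^sub>j\<close>, so
  that \<open>H\<^sub>i\<close> has no such point on these pieces unless it is conjugate into \<open>H\<^sub>j\<close>.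

  The pieces are completed to a finite set as follows. Infinite index provides missing edges, through which the
  pieces are joined to a bouquet of long cycles, one for each letter; all new edges are then subdivided by copies
  of a finite Cayley graph of large girth. Short closed paths therefore stay inside the pieces. Suitable
  powers of the letters move only the cycles of the bouquet, their commutators are 3-cycles, and connectedness
  makes the image contain the alternating group. Swapping two new edges adjusts the parity of a letter.\<close>

text \<open>The factor \<open>Q_j\<close> guards against foreign pieces. \<open>H_i\<close> may fix
  a coset of some \<open>H_l\<close> with \<open>l \<noteq> j\<close>; but a suitable nontrivial
  element of it acts on \<open>Q_l\<close> without fixed points and with order a power of
  \<open>p_l\<close>, so its \<open>q_j\<close>-th power still moves every point of that piece. The
  price is that \<open>H_j\<close> itself need not fix a point of its own piece any more; its
  \<open>q_j\<close>-th powers do, which explains the form of the invariant.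

  The obstacle is finiteness. The test words are \<open>q_j\<close>-th powers, so their maximal
  length \<open>L\<close> is known only once all primes and quotients are fixed, and completing the
  pieces must not create closed paths of length up to this \<open>L\<close>. A second difficulty
  lies outside the pieces: a reduced word \<open>g u g^-1\<close> can return to its starting point
  there by running into a piece, around a closed path and back. Hence the elements tested outside
  the pieces are conjugated to cyclically reduced ones.

  A trivial \<open>H_i\<close> is conjugate into every \<open>H_j\<close>, so only nontrivial ones
  require a test.\<close>

section \<open>Words in letters and inverse letters, free and cyclic reduction\<close>

definition linv :: "'a \<times> bool \<Rightarrow> 'a \<times> bool" where
  "linv l = (fst l, \<not> snd l)"

lemma linv_simps [simp]: "linv (linv l) = l" "linv (x, b) = (x, \<not> b)" "fst (linv l) = fst l"
  "linv l \<noteq> l" "l \<noteq> linv l"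
  by (auto simp: linv_def prod_eq_iff)

definition winv :: "('a \<times> bool) list \<Rightarrow> ('a \<times> bool) list" where
  "winv w = rev (map linv w)"

lemma winv_simps [simp]: "winv [] = []" "winv (l # w) = winv w @ [linv l]"
  "winv (u @ v) = winv v @ winv u" "winv (winv w) = w" "fst ` set (winv w) = fst ` set w"
  "length (winv w) = length w"
  by (force simp: winv_def rev_map comp_def image_iff)+

lemma reduced_word_conv: "reduced_word w \<longleftrightarrow> successively (\<lambda>a b. b \<noteq> linv a) w"
  by (auto simp: reduced_word_def successively_conv_nth linv_def prod_eq_iff)

lemma reduced_word_Nil [simp]: "reduced_word []"
  and reduced_word_single [simp]: "reduced_word [l]"
  and reduced_word_Cons: "reduced_word (l # w) \<longleftrightarrow> w = [] \<or> hd w \<noteq> linv l \<and> reduced_word w"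
  and reduced_word_append: "reduced_word (u @ v) \<longleftrightarrow>
    reduced_word u \<and> reduced_word v \<and> (u = [] \<or> v = [] \<or> hd v \<noteq> linv (last u))"
  by (auto simp: reduced_word_conv successively_Cons successively_append_iff)

lemma reduced_word_infix: "reduced_word (u @ v @ w) \<Longrightarrow> reduced_word v"
  by (auto simp: reduced_word_append)

definition cyc_reduced :: "('a \<times> bool) list \<Rightarrow> bool" where
  "cyc_reduced w \<longleftrightarrow> reduced_word (w @ w)"

definition wpow :: "('a \<times> bool) list \<Rightarrow> nat \<Rightarrow> ('a \<times> bool) list" where
  "wpow w n = concat (replicate n w)"

lemma wpow_simps [simp]: "wpow w 0 = []" "wpow w (Suc n) = w @ wpow w n"
  by (auto simp: wpow_def)

lemma wpow_add: "wpow w (m + n) = wpow w m @ wpow w n"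
  by (induction m) auto

lemma set_wpow: "set (wpow w n) \<subseteq> set w"
  by (induction n) auto

lemma wpow_eq_Nil [simp]: "wpow w n = [] \<longleftrightarrow> w = [] \<or> n = 0"
  by (cases n) (auto simp: wpow_def)

lemma hd_wpow: "w \<noteq> [] \<Longrightarrow> n > 0 \<Longrightarrow> hd (wpow w n) = hd w"
  by (cases n) auto

lemma reduced_wpow:
  assumes "cyc_reduced w" shows "reduced_word (wpow w n)"
proof (induction n)
  case (Suc n)
  show ?case
  proof (cases "w = [] \<or> n = 0")
    case True
    then show ?thesis using assms by (cases "w = []") (auto simp: cyc_reduced_def reduced_word_append wpow_def)
  next
    case False
    then show ?thesis using assms Suc by (auto simp: cyc_reduced_def reduced_word_append hd_wpow)
  qed
qed auto

lemma cyc_reduced_wpow: "cyc_reduced w \<Longrightarrow> cyc_reduced (wpow w n)"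
  unfolding cyc_reduced_def[of "wpow w n"] wpow_add[symmetric] by (rule reduced_wpow)

text \<open>Matching outer letters are stripped pair by pair; since \<open>[l, linv l]\<close> is
  not reduced, the middle never becomes empty. Cyclically reduced cores are wanted because their
  powers are again reduced.\<close>

lemma cyclic_reduction:
  assumes "reduced_word w" "w \<noteq> []"
  shows "\<exists>g u. w = g @ u @ winv g \<and> u \<noteq> [] \<and> cyc_reduced u"
  using assms
proof (induction "length w" arbitrary: w rule: less_induct)
  case less
  show ?case
  proof (cases "cyc_reduced w")
    case True
    then show ?thesis using less.prems by (intro exI[of _ "[]"] exI[of _ w]) auto
  next
    case False
    then have h: "hd w = linv (last w)" using less.prems
      by (auto simp: cyc_reduced_def reduced_word_append)
    then obtain l v where w: "w = l # v @ [linv l]"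
      using less.prems by (cases w; cases "tl w" rule: rev_cases) auto
    have "v \<noteq> []" using less.prems by (auto simp: w reduced_word_Cons)
    moreover have "reduced_word v"
      using less.prems reduced_word_infix[of "[l]" v "[linv l]"] by (simp add: w)
    ultimately obtain g u where "v = g @ u @ winv g" "u \<noteq> []" "cyc_reduced u"
      using less.hyps[of v] by (auto simp: w)
    then show ?thesis by (intro exI[of _ "l # g"] exI[of _ u]) (auto simp: w)
  qed
qed

definition red_cons :: "'a \<times> bool \<Rightarrow> ('a \<times> bool) list \<Rightarrow> ('a \<times> bool) list" where
  "red_cons l w = (if w \<noteq> [] \<and> hd w = linv l then tl w else l # w)"

text \<open>A right fold cancelling against the head performs the free reduction. What matters later
  is that the result is reduced and acts like \<open>w\<close> under every letter action.\<close>

definition nf :: "('a \<times> bool) list \<Rightarrow> ('a \<times> bool) list" where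
  "nf w = foldr red_cons w []"

lemma nf_simps: "nf [] = []" "nf (l # w) = red_cons l (nf w)"
  by (auto simp: nf_def)

lemma reduced_nf: "reduced_word (nf w)"
  by (induction w) (auto simp: nf_simps red_cons_def reduced_word_Cons neq_Nil_conv)

lemma set_nf: "set (nf w) \<subseteq> set w"
proof (induction w)
  case (Cons l w)
  then show ?case by (cases "nf w") (auto simp: nf_simps red_cons_def)
qed (auto simp: nf_simps)

lemma fst_nf: "fst ` set w \<subseteq> A \<Longrightarrow> fst ` set (nf w) \<subseteq> A"
  using set_nf by fastforce

section \<open>Actions of words on sets\<close>

text \<open>A family of letter maps \<open>\<rho>\<close> acts on a set \<open>S\<close>; the word \<open>w\<close> acts by \<open>foldr \<rho> w\<close>, last letter first.\<close>
definition letter_action :: "('a \<times> bool \<Rightarrow> 'x \<Rightarrow> 'x) \<Rightarrow> 'a set \<Rightarrow> 'x set \<Rightarrow> bool" where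
  "letter_action \<rho> A S \<longleftrightarrow> (\<forall>l. fst l \<in> A \<longrightarrow> (\<forall>v\<in>S. \<rho> l v \<in> S \<and> \<rho> (linv l) (\<rho> l v) = v))"

lemma letter_actionD:
  assumes "letter_action \<rho> A S" "fst l \<in> A" "v \<in> S"
  shows "\<rho> l v \<in> S" "\<rho> (linv l) (\<rho> l v) = v" "\<rho> l (\<rho> (linv l) v) = v"
proof -
  show "\<rho> l v \<in> S" "\<rho> (linv l) (\<rho> l v) = v" using assms unfolding letter_action_def by blast+
  have "fst (linv l) \<in> A" using assms by simp
  then have "\<rho> (linv (linv l)) (\<rho> (linv l) v) = v" using assms unfolding letter_action_def by blast
  then show "\<rho> l (\<rho> (linv l) v) = v" by simp
qed

lemma letter_action_mono: "letter_action \<rho> A S \<Longrightarrow> A' \<subseteq> A \<Longrightarrow> letter_action \<rho> A' S"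
  by (auto simp: letter_action_def)

lemma word_closed:
  assumes "letter_action \<rho> A S" "fst ` set w \<subseteq> A" "v \<in> S"
  shows "foldr \<rho> w v \<in> S"
  using assms(2) by (induction w) (auto intro: letter_actionD(1)[OF assms(1)] simp: assms)

lemma word_winv:
  assumes "letter_action \<rho> A S" "fst ` set w \<subseteq> A" "v \<in> S"
  shows "foldr \<rho> (winv w) (foldr \<rho> w v) = v"
  using assms(2)
proof (induction w)
  case (Cons l w)
  then show ?case using word_closed[OF assms(1) _ assms(3), of w]
    by (simp add: letter_actionD[OF assms(1)])
qed auto

lemma word_nf:
  assumes "letter_action \<rho> A S" "fst ` set w \<subseteq> A" "v \<in> S"
  shows "foldr \<rho> (nf w) v = foldr \<rho> w v"
  using assms(2)
proof (induction w)
  case (Cons l w)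
  have c: "fst ` set (nf w) \<subseteq> A" using Cons.prems by (intro fst_nf) auto
  show ?case
  proof (cases "nf w \<noteq> [] \<and> hd (nf w) = linv l")
    case True
    then obtain u where u: "nf w = linv l # u" by (cases "nf w") auto
    have "foldr \<rho> u v \<in> S" using c u by (intro word_closed[OF assms(1)] assms) auto
    moreover have "foldr \<rho> w v = \<rho> (linv l) (foldr \<rho> u v)" using Cons u by simp
    ultimately show ?thesis using Cons.prems u
      by (simp add: nf_simps red_cons_def letter_actionD(3)[OF assms(1)])
  qed (use Cons in \<open>auto simp: nf_simps red_cons_def\<close>)
qed (auto simp: nf_simps)

lemma word_inj:
  assumes "letter_action \<rho> A S" "fst ` set w \<subseteq> A" "v \<in> S" "v' \<in> S" "foldr \<rho> w v = foldr \<rho> w v'"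
  shows "v = v'"
  using word_winv[OF assms(1,2,3)] word_winv[OF assms(1,2,4)] assms(5) by metis

lemma word_wpow: "foldr \<rho> (wpow w n) = (foldr \<rho> w ^^ n)"
  by (induction n) auto

text \<open>Two powers agree at \<open>v\<close> by pigeonhole; the smaller one is the action of
  \<open>wpow w i\<close>, hence injective, and cancels.\<close>

lemma word_periodic:
  assumes "letter_action \<rho> A S" "finite S" "fst ` set w \<subseteq> A" "v \<in> S"
  shows "\<exists>t>0. (foldr \<rho> w ^^ t) v = v"
proof -
  have cl: "(foldr \<rho> w ^^ t) v \<in> S" for t
    by (induction t) (auto simp: assms(4) intro: word_closed[OF assms(1,3)])
  then have "range (\<lambda>t. (foldr \<rho> w ^^ t) v) \<subseteq> S" by blast
  then have "finite (range (\<lambda>t. (foldr \<rho> w ^^ t) v))" using assms(2) finite_subset by blast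
  then have "\<not> inj (\<lambda>t. (foldr \<rho> w ^^ t) v)" using finite_imageD infinite_UNIV_nat by blast
  then obtain i j where "i \<noteq> j" "(foldr \<rho> w ^^ i) v = (foldr \<rho> w ^^ j) v" unfolding inj_def by blast
  then obtain i j where ij: "i < j" "(foldr \<rho> w ^^ i) v = (foldr \<rho> w ^^ j) v"
    by (cases i j rule: linorder_cases) metis+
  have "(foldr \<rho> w ^^ j) v = (foldr \<rho> w ^^ i) ((foldr \<rho> w ^^ (j - i)) v)"
    using ij(1) by (metis funpow_add le_add_diff_inverse less_imp_le o_apply)
  then have "foldr \<rho> (wpow w i) v = foldr \<rho> (wpow w i) ((foldr \<rho> w ^^ (j - i)) v)"
    using ij(2) by (simp add: word_wpow)
  then have "v = (foldr \<rho> w ^^ (j - i)) v"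
  proof (rule word_inj[OF assms(1), rotated 3])
    show "fst ` set (wpow w i) \<subseteq> A" using set_wpow assms(3) by fastforce
  qed (use cl assms in auto)
  then show ?thesis using ij(1) by (metis zero_less_diff)
qed

subsection \<open>Words in groups\<close>

lemma word_val_simps: "word_val G [] = \<one>\<^bsub>G\<^esub>" "word_val G (l # w) = letter_val G l \<otimes>\<^bsub>G\<^esub> word_val G w"
  by (auto simp: word_val_def)

context group
begin

lemma letter_val_closed: "fst l \<in> carrier G \<Longrightarrow> letter_val G l \<in> carrier G"
  by (auto simp: letter_val_def)

lemma letter_val_linv: "fst l \<in> carrier G \<Longrightarrow> letter_val G (linv l) = inv letter_val G l"
  by (auto simp: letter_val_def linv_def)

lemma word_val_closed: "fst ` set w \<subseteq> carrier G \<Longrightarrow> word_val G w \<in> carrier G"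
  by (induction w) (auto simp: word_val_simps letter_val_closed)

lemma word_val_append:
  "fst ` set u \<subseteq> carrier G \<Longrightarrow> fst ` set v \<subseteq> carrier G \<Longrightarrow> word_val G (u @ v) = word_val G u \<otimes> word_val G v"
  by (induction u) (auto simp: word_val_simps letter_val_closed word_val_closed m_assoc)

lemma word_val_winv: "fst ` set w \<subseteq> carrier G \<Longrightarrow> word_val G (winv w) = inv word_val G w"
  by (induction w)
    (auto simp: word_val_simps word_val_append letter_val_closed word_val_closed letter_val_linv inv_mult_group)

lemma left_mult_action: "letter_action (\<lambda>l x. letter_val G l \<otimes> x) (carrier G) (carrier G)"
  by (auto simp: letter_action_def letter_val_closed letter_val_linv simp flip: m_assoc)

lemma word_val_nf: "fst ` set w \<subseteq> carrier G \<Longrightarrow> word_val G (nf w) = word_val G w"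
  using word_nf[OF left_mult_action, of w \<one>] by (simp add: word_val_def)

lemma generate_word:
  assumes "x \<in> generate G S" "S \<subseteq> carrier G"
  shows "\<exists>w. fst ` set w \<subseteq> S \<and> word_val G w = x"
  using assms(1)
proof (induction rule: generate.induct)
  case one
  show ?case by (rule exI[of _ "[]"]) (auto simp: word_val_simps)
next
  case (incl h)
  then show ?case using assms(2)
    by (intro exI[of _ "[(h, True)]"]) (auto simp: word_val_simps letter_val_def)
next
  case (inv h)
  then show ?case using assms(2)
    by (intro exI[of _ "[(h, False)]"]) (auto simp: word_val_simps letter_val_def)
next
  case (eng h1 h2)
  then obtain u v where "fst ` set u \<subseteq> S" "word_val G u = h1" "fst ` set v \<subseteq> S" "word_val G v = h2"
    by auto
  then show ?case using assms(2)
    by (intro exI[of _ "u @ v"]) (auto simp: word_val_append)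
qed

lemma word_generate: "fst ` set w \<subseteq> S \<Longrightarrow> word_val G w \<in> generate G S"
proof (induction w)
  case (Cons l w)
  then show ?case
    by (auto simp: word_val_simps letter_val_def intro!: generate.eng intro: generate.incl generate.inv)
qed (auto simp: word_val_simps generate.one)

end

lemma free_basisD:
  assumes "free_basis G B"
  shows "group G" "B \<subseteq> carrier G" "\<And>g. g \<in> carrier G \<Longrightarrow> \<exists>w. fst ` set w \<subseteq> B \<and> word_val G w = g"
    "\<And>w. fst ` set w \<subseteq> B \<Longrightarrow> reduced_word w \<Longrightarrow> word_val G w = \<one>\<^bsub>G\<^esub> \<Longrightarrow> w = []"
proof -
  show fb: "group G" "B \<subseteq> carrier G" using assms by (auto simp: free_basis_def)
  show "\<exists>w. fst ` set w \<subseteq> B \<and> word_val G w = g" if "g \<in> carrier G" for g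
    using assms that group.generate_word[OF fb(1) _ fb(2), of g] by (auto simp: free_basis_def)
  show "w = []" if "fst ` set w \<subseteq> B" "reduced_word w" "word_val G w = \<one>\<^bsub>G\<^esub>" for w
  proof -
    have "set (map fst w) \<subseteq> B" using that by simp
    then show ?thesis using assms that unfolding free_basis_def by blast
  qed
qed

text \<open>Freeness enters here: the reduction of \<open>winv w' @ w\<close> has value one, so it
  is empty and acts trivially. Every letter action on the basis thus becomes an action of the
  group.\<close>

lemma free_word_eq:
  assumes "free_basis G B" "letter_action \<rho> B S" "v \<in> S"
    and "fst ` set w \<subseteq> B" "fst ` set w' \<subseteq> B" "word_val G w = word_val G w'"
  shows "foldr \<rho> w v = foldr \<rho> w' v"
proof -
  note fb = free_basisD[OF assms(1)]
  interpret group G by (rule fb)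
  let ?u = "winv w' @ w"
  have u: "fst ` set ?u \<subseteq> B" using assms by (simp add: image_Un)
  have cw: "fst ` set w \<subseteq> carrier G" "fst ` set w' \<subseteq> carrier G" "fst ` set ?u \<subseteq> carrier G"
    using assms u fb(2) by blast+
  have "word_val G (nf ?u) = \<one>\<^bsub>G\<^esub>"
    using cw assms(6) by (simp add: word_val_nf word_val_append word_val_winv word_val_closed)
  then have "nf ?u = []" using fb(4) fst_nf[OF u] reduced_nf by blast
  then have "foldr \<rho> (winv w') (foldr \<rho> w v) = v" using word_nf[OF assms(2) u assms(3)] by simp
  then have "foldr \<rho> (winv w') (foldr \<rho> w v) = foldr \<rho> (winv w') (foldr \<rho> w' v)"
    using word_winv[OF assms(2,5,3)] by simp
  then show ?thesis
    by (rule word_inj[OF assms(2), rotated 3]) (use assms in \<open>auto intro: word_closed[OF assms(2)]\<close>)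
qed

text \<open>The homomorphism is read off from words acting on \<open>K\<close> by left
  multiplication, evaluated at the unit; by \<open>free_word_eq\<close> the choice of the word
  \<open>W g\<close> for \<open>g\<close> does not matter.\<close>

lemma free_universal:
  assumes "free_basis G B" "group K" "\<phi> ` B \<subseteq> carrier K"
  shows "\<exists>f\<in>hom G K. \<forall>w. fst ` set w \<subseteq> B \<longrightarrow> f (word_val G w) = word_val K (map (apfst \<phi>) w)"
proof -
  note fb = free_basisD[OF assms(1)]
  interpret G: group G by (rule fb)
  interpret K: group K by fact
  let ?\<rho> = "\<lambda>l x. letter_val K (apfst \<phi> l) \<otimes>\<^bsub>K\<^esub> x"
  have act: "letter_action ?\<rho> B (carrier K)"
    using assms(3) K.letter_val_linv[of "apfst \<phi> _"]
    by (auto simp: letter_action_def letter_val_def linv_def K.m_assoc[symmetric] image_subset_iff)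
  have val: "foldr ?\<rho> w \<one>\<^bsub>K\<^esub> = word_val K (map (apfst \<phi>) w)" for w
    by (induction w) (auto simp: word_val_simps)
  obtain W where W: "\<And>g. g \<in> carrier G \<Longrightarrow> fst ` set (W g) \<subseteq> B \<and> word_val G (W g) = g"
    using fb(3) by metis
  define f where "f g = foldr ?\<rho> (W g) \<one>\<^bsub>K\<^esub>" for g
  have f: "f (word_val G w) = word_val K (map (apfst \<phi>) w)" if "fst ` set w \<subseteq> B" for w
  proof -
    have "word_val G w \<in> carrier G" using that fb(2) by (intro G.word_val_closed) blast
    then show ?thesis unfolding f_def
      using free_word_eq[OF assms(1) act K.one_closed _ that, of "W (word_val G w)"] W by (simp add: val)
  qed
  have cl: "fst ` set (map (apfst \<phi>) w) \<subseteq> carrier K" if "fst ` set w \<subseteq> B" for w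
    using that assms(3) by (auto simp: image_subset_iff)
  have "f \<in> hom G K"
  proof (rule homI)
    fix x assume "x \<in> carrier G"
    then show "f x \<in> carrier K" using f[of "W x"] W[of x] K.word_val_closed[OF cl, of "W x"] by auto
  next
    fix x y assume xy: "x \<in> carrier G" "y \<in> carrier G"
    have "x \<otimes>\<^bsub>G\<^esub> y = word_val G (W x @ W y)"
      using W xy fb(2) by (subst G.word_val_append) (auto simp: subset_iff)
    moreover have "fst ` set (W x @ W y) \<subseteq> B" using W xy by (auto simp: subset_iff)
    ultimately have "f (x \<otimes>\<^bsub>G\<^esub> y) = word_val K (map (apfst \<phi>) (W x @ W y))" using f by metis
    then show "f (x \<otimes>\<^bsub>G\<^esub> y) = f x \<otimes>\<^bsub>K\<^esub> f y"
      using W xy cl[of "W x"] cl[of "W y"] f[of "W x"] f[of "W y"] by (simp add: K.word_val_append)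
  qed
  then show ?thesis using f by blast
qed

subsection \<open>Finite p-quotients\<close>

text \<open>The letter \<open>(b, s)\<close> acts on vectors modulo \<open>p\<close> as the unipotent matrix \<open>1 \<plusminus> N\<close>, where \<open>N\<close> adds
  coordinate \<open>i - 1\<close> to coordinate \<open>i\<close> whenever the list \<open>bs\<close> carries the label \<open>b\<close> at position \<open>i\<close>.
  As \<open>b\<close> never labels two adjacent positions, \<open>N\<^sup>2 = 0\<close> and \<open>1 - N\<close> is the inverse of \<open>1 + N\<close>.\<close>
definition transvection :: "nat \<Rightarrow> 'b option list \<Rightarrow> 'b \<times> bool \<Rightarrow> (nat \<Rightarrow> int) \<Rightarrow> nat \<Rightarrow> int" where
  "transvection p bs e c = (\<lambda>i. if 0 < i \<and> i < length bs \<and> bs ! i = Some (fst e)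
     then (c i + (if snd e then 1 else -1) * c (i - 1)) mod int p else c i)"

text \<open>Functions normalised to representatives below \<open>p\<close> and to zero from
  \<open>n\<close> on, so that equal vectors are equal functions and the set is finite.\<close>

definition vectors :: "nat \<Rightarrow> nat \<Rightarrow> (nat \<Rightarrow> int) set" where
  "vectors p n = {c. \<forall>i. (i \<in> {..<n} \<longrightarrow> c i \<in> {0..<int p}) \<and> (i \<notin> {..<n} \<longrightarrow> c i = 0)}"

definition no_repeats :: "'b option list \<Rightarrow> bool" where
  "no_repeats bs \<longleftrightarrow> successively (\<lambda>a b. a = None \<or> b \<noteq> a) bs"

lemma finite_vectors: "finite (vectors p n)"
  unfolding vectors_def by (rule finite_set_of_finite_funs) auto

lemma vectors_mod: "c \<in> vectors p n \<Longrightarrow> 0 < p \<Longrightarrow> c i mod int p = c i"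
  by (cases "i < n") (auto simp: vectors_def)

lemma transvection_closed: "0 < p \<Longrightarrow> c \<in> vectors p (length bs) \<Longrightarrow> transvection p bs e c \<in> vectors p (length bs)"
  by (auto simp: vectors_def transvection_def)

lemma transvection_inverse:
  assumes "no_repeats bs" "0 < p" "c \<in> vectors p (length bs)"
  shows "transvection p bs (linv e) (transvection p bs e c) = c"
proof
  fix i
  let ?c = "transvection p bs e c"
  show "transvection p bs (linv e) ?c i = c i"
  proof (cases "0 < i \<and> i < length bs \<and> bs ! i = Some (fst e)")
    case True
    then have "bs ! (i - 1) \<noteq> Some (fst e)"
      using successively_nth[OF assms(1)[unfolded no_repeats_def], of "i - 1"] by auto
    then have "?c (i - 1) = c (i - 1)" by (auto simp: transvection_def)
    moreover have "?c i = (c i + (if snd e then 1 else -1) * c (i - 1)) mod int p"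
      using True by (auto simp: transvection_def)
    moreover have "transvection p bs (linv e) d i = (d i + (if snd e then -1 else 1) * d (i - 1)) mod int p" for d
      using True by (auto simp: transvection_def linv_def)
    ultimately have "transvection p bs (linv e) ?c i = c i mod int p"
      by (simp only:) (cases "snd e", auto simp: mod_simps)
    then show ?thesis using vectors_mod assms by simp
  next
    case False
    then have "transvection p bs d c' i = c' i" if "fst d = fst e" for d c'
      using that unfolding transvection_def by presburger
    then show ?thesis by simp
  qed
qed

lemma transvection_action:
  "no_repeats bs \<Longrightarrow> 0 < p \<Longrightarrow> letter_action (transvection p bs) UNIV (vectors p (length bs))"
  unfolding letter_action_def using transvection_closed transvection_inverse by blast

text \<open>Each letter pushes the last nonzero coordinate one place further, up to sign; all its
  other effects stay below that place. The labels of \<open>E\<close> are reversed in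
  \<open>bs\<close> because \<open>foldr\<close> applies the last letter first.\<close>

lemma transvections_detect:
  assumes p: "2 \<le> p" and bs: "bs = pre @ None # map (Some \<circ> fst) (rev E) @ post" and "E = E1 @ E2"
  shows "let c = foldr (transvection p bs) E2 (\<lambda>i. if i = length pre then 1 else 0) in
    c (length pre + length E2) \<in> {1, int p - 1} \<and> (\<forall>j > length pre + length E2. c j = 0)"
  using assms(3)
proof (induction E2 arbitrary: E1)
  case (Cons e E2)
  define c where "c = foldr (transvection p bs) E2 (\<lambda>i. if i = length pre then 1 else 0)"
  have IH: "c (length pre + length E2) \<in> {1, int p - 1}" "\<And>j. j > length pre + length E2 \<Longrightarrow> c j = 0"
    using Cons.IH[of "E1 @ [e]"] Cons.prems by (auto simp: c_def Let_def)
  let ?i = "Suc (length pre + length E2)"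
  have bi: "bs ! ?i = Some (fst e)" "?i < length bs"
    by (auto simp: bs Cons.prems nth_append nth_Cons' rev_nth)
  have "transvection p bs e c ?i \<in> {1, int p - 1}"
    using IH(1) IH(2)[of ?i] p bi by (cases "snd e") (auto simp: transvection_def zmod_minus1 mod_diff_left_eq intro: mod_pos_pos_trivial)
  moreover have "transvection p bs e c j = 0" if "j > ?i" for j
    using that IH(2)[of j] IH(2)[of "j - 1"] by (auto simp: transvection_def)
  ultimately show ?case by (auto simp: Let_def c_def)
qed (use p in auto)

text \<open>Unipotent triangular maps without reference to linearity: modulo \<open>p\<close>,
  \<open>f c i\<close> is \<open>c i\<close> plus a quantity determined by the coordinates below
  \<open>i\<close>.\<close>

definition triangular :: "nat \<Rightarrow> nat \<Rightarrow> ((nat \<Rightarrow> int) \<Rightarrow> nat \<Rightarrow> int) \<Rightarrow> bool" where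
  "triangular p n f \<longleftrightarrow> (\<forall>c\<in>vectors p n. f c \<in> vectors p n) \<and>
    (\<forall>c\<in>vectors p n. \<forall>c'\<in>vectors p n. \<forall>i. (\<forall>j<i. c j = c' j) \<longrightarrow>
       f c i mod int p = (f c' i + (c i - c' i)) mod int p)"

lemma triangularD:
  assumes "triangular p n f" "c \<in> vectors p n"
  shows "f c \<in> vectors p n"
    and "c' \<in> vectors p n \<Longrightarrow> (\<And>j. j < i \<Longrightarrow> c j = c' j) \<Longrightarrow> f c i mod int p = (f c' i + (c i - c' i)) mod int p"
  using assms by (auto simp: triangular_def)

lemma triangular_id: "triangular p n (\<lambda>c. c)"
  by (auto simp: triangular_def)

lemma triangular_agree:
  assumes "triangular p n f" "0 < p" "c \<in> vectors p n" "c' \<in> vectors p n" "\<And>j. j < i \<Longrightarrow> c j = c' j" "j < i"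
  shows "f c j = f c' j"
proof -
  have "f c j mod int p = (f c' j + (c j - c' j)) mod int p"
    using assms by (intro triangularD(2)) auto
  then show ?thesis using assms by (simp add: vectors_mod[OF triangularD(1)])
qed

lemma triangular_comp:
  assumes "triangular p n f" "triangular p n g" "0 < p"
  shows "triangular p n (\<lambda>c. f (g c))"
  unfolding triangular_def
proof (intro conjI ballI allI impI)
  fix c c' i assume c: "c \<in> vectors p n" "c' \<in> vectors p n" "\<forall>j<i. c j = c' j"
  have "f (g c) i mod int p = (f (g c') i + (g c i - g c' i)) mod int p"
    using c triangular_agree[OF assms(2,3) c(1,2), of i]
    by (intro triangularD(2)[OF assms(1)] triangularD(1)[OF assms(2)]) auto
  also have "\<dots> = (f (g c') i - g c' i + g c i mod int p) mod int p"
    by (simp only: mod_add_right_eq) (simp add: algebra_simps)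
  also have "g c i mod int p = (g c' i + (c i - c' i)) mod int p"
    using c by (intro triangularD(2)[OF assms(2)]) auto
  finally show "f (g c) i mod int p = (f (g c') i + (c i - c' i)) mod int p"
    by (simp only: mod_add_right_eq) (simp add: algebra_simps)
qed (use triangularD(1) assms in blast)

lemma triangular_funpow: "triangular p n f \<Longrightarrow> 0 < p \<Longrightarrow> triangular p n (f ^^ m)"
  by (induction m) (auto simp: triangular_id id_def o_def intro: triangular_comp)

lemma triangular_transvection:
  assumes "0 < p" shows "triangular p (length bs) (transvection p bs e)"
  unfolding triangular_def
proof (intro conjI ballI allI impI)
  fix c c' :: "nat \<Rightarrow> int" and i assume c: "\<forall>j<i. c j = c' j"
  then have "0 < i \<Longrightarrow> c (i - 1) = c' (i - 1)" by simp
  then show "transvection p bs e c i mod int p = (transvection p bs e c' i + (c i - c' i)) mod int p"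
    by (auto simp: transvection_def mod_add_left_eq) (simp add: add.commute)
qed (use transvection_closed assms in blast)

text \<open>Once \<open>g = f ^^ (p ^ m)\<close> fixes all coordinates below \<open>m\<close>, each
  application of \<open>g\<close> adds the same increment to coordinate \<open>m\<close>, and
  \<open>p\<close> applications add zero modulo \<open>p\<close>.\<close>

lemma triangular_exponent_aux:
  assumes "triangular p n f" "0 < p" "c \<in> vectors p n" "i < m"
  shows "(f ^^ (p ^ m)) c i = c i"
  using assms(3,4)
proof (induction m arbitrary: c i)
  case (Suc m)
  define g where "g = f ^^ (p ^ m)"
  have g: "triangular p n g" unfolding g_def by (intro triangular_funpow assms)
  note cP = Suc.prems(1)
  have stay: "g c j = c j" if "c \<in> vectors p n" "j < m" for c j
    using Suc.IH that by (simp add: g_def)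
  have low: "(g ^^ t) c \<in> vectors p n \<and> (\<forall>j<m. (g ^^ t) c j = c j)" for t
    by (induction t) (use Suc.prems stay triangularD(1)[OF g] in auto)
  have "(g ^^ t) c m mod int p = (c m + int t * (g c m - c m)) mod int p" for t
  proof (induction t)
    case (Suc t)
    have "(g ^^ Suc t) c m mod int p = (g c m + ((g ^^ t) c m - c m)) mod int p"
      using low[of t] cP by (simp, intro triangularD(2)[OF g]) auto
    also have "\<dots> = (g c m - c m + (g ^^ t) c m mod int p) mod int p"
      by (simp only: mod_add_right_eq) (simp add: algebra_simps)
    finally show ?case unfolding Suc.IH by (simp only: mod_add_right_eq) (simp add: algebra_simps)
  qed simp
  from this[of p] have top: "(g ^^ p) c m = c m"
    using vectors_mod[of _ p n m] low[of p] Suc.prems assms(2) by auto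
  have "(f ^^ (p ^ Suc m)) = g ^^ p" by (simp add: g_def funpow_mult mult.commute)
  then show ?case using top low[of p] Suc.prems by (cases "i = m") auto
qed auto

lemma triangular_exponent:
  assumes "triangular p n f" "0 < p" "c \<in> vectors p n"
  shows "(f ^^ (p ^ Suc n)) c = c"
proof
  fix i
  have "(f ^^ (p ^ Suc n)) c \<in> vectors p n" using triangularD(1)[OF triangular_funpow] assms by blast
  then show "(f ^^ (p ^ Suc n)) c i = c i"
    using triangular_exponent_aux[OF assms, of i "Suc n"] assms(3) by (cases "i < Suc n") (auto simp: vectors_def)
qed

text \<open>Doubling the letters, \<open>x = x\<^sub>0 x\<^sub>1\<close>, turns reduced words into words without adjacent equal bases.\<close>
definition double :: "'a \<times> bool \<Rightarrow> (('a \<times> bool) \<times> bool) list" where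
  "double l = (if snd l then [((fst l, True), True), ((fst l, False), True)]
     else [((fst l, False), False), ((fst l, True), False)])"

text \<open>The leading \<open>None\<close> is the coordinate from which the letters of
  \<open>w\<close> push a unit vector to the end of the block; it also keeps adjacent blocks from
  producing equal neighbouring labels.\<close>

definition block :: "('a \<times> bool) list \<Rightarrow> ('a \<times> bool) option list" where
  "block w = None # map (Some \<circ> fst) (rev (concat (map double w)))"

lemma no_repeats_append_block:
  assumes "no_repeats bs" "bs = [] \<or> hd bs = None" "reduced_word w"
  shows "no_repeats (block w @ bs)"
proof -
  have "successively (\<lambda>a b. fst a \<noteq> fst b) (concat (map double w))"
    using assms(3)
  proof (induction w)
    case (Cons l w)
    then show ?case by (cases w) (auto simp: successively_append_iff double_def reduced_word_Cons linv_def prod_eq_iff)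
  qed auto
  then have "successively (\<lambda>a b. a = None \<or> b \<noteq> a) (map (Some \<circ> fst) (rev (concat (map double w))))"
    by (simp add: successively_map)
  then show ?thesis using assms(1,2)
    by (auto simp: no_repeats_def block_def successively_Cons successively_append_iff)
qed

lemma no_repeats_blocks: "(\<And>w. w \<in> set ws \<Longrightarrow> reduced_word w) \<Longrightarrow> no_repeats (concat (map block ws))"
proof (induction ws)
  case (Cons w ws)
  then have "no_repeats (concat (map block ws))" by auto
  moreover have "concat (map block ws) = [] \<or> hd (concat (map block ws)) = None"
    by (cases ws) (auto simp: block_def)
  ultimately show ?case using Cons.prems by (auto intro: no_repeats_append_block)
qed (auto simp: no_repeats_def)

text \<open>Free groups are residually finite \<open>p\<close>-groups, here for finitely many words
  at once: every word of \<open>W\<close> has its own block in a common label list and moves the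
  unit vector at the \<open>None\<close> of that block. The exponent comes from
  triangularity.\<close>

lemma residually_p:
  fixes W :: "('a \<times> bool) list set"
  assumes p: "2 \<le> p" and "finite W" and "\<And>w. w \<in> W \<Longrightarrow> reduced_word w \<and> w \<noteq> []"
  shows "\<exists>(S :: (nat \<Rightarrow> int) set) \<rho> n. finite S \<and> letter_action \<rho> UNIV S \<and>
    (\<forall>w. \<forall>c\<in>S. (foldr \<rho> w ^^ (p ^ Suc n)) c = c) \<and> (\<forall>w\<in>W. \<exists>c\<in>S. foldr \<rho> w c \<noteq> c)"
proof -
  obtain ws where ws: "set ws = W" using assms(2) finite_list by blast
  define bs where "bs = concat (map block ws)"
  let ?t = "transvection p bs" and ?S = "vectors p (length bs)"
  let ?\<rho> = "\<lambda>l :: 'a \<times> bool. foldr ?t (double l)"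
  have nr: "no_repeats bs" unfolding bs_def using assms(3) ws by (intro no_repeats_blocks) auto
  have act: "letter_action ?t UNIV ?S" using transvection_action[OF nr] p by simp
  have "foldr ?\<rho> w c = foldr ?t (concat (map double w)) c" for w c
    by (induction w) simp_all
  then have fw: "foldr ?\<rho> w = foldr ?t (concat (map double w))" for w by blast
  have dl: "double (linv l) = winv (double l)" for l :: "'a \<times> bool"
    by (auto simp: double_def linv_def)
  have "letter_action ?\<rho> UNIV ?S"
    unfolding letter_action_def dl using word_closed[OF act] word_winv[OF act] by (meson subset_UNIV)
  moreover have tri: "triangular p (length bs) (foldr ?t E)" for E
  proof (induction E)
    case (Cons e E)
    show ?case using triangular_comp[OF triangular_transvection Cons, of e] p by (simp add: o_def)
  qed (simp add: triangular_id id_def)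
  have "\<forall>w. \<forall>c\<in>?S. (foldr ?\<rho> w ^^ (p ^ Suc (length bs))) c = c"
    unfolding fw using triangular_exponent[OF tri] p by auto
  moreover have "\<exists>c\<in>?S. foldr ?\<rho> w c \<noteq> c" if w: "w \<in> W" for w
  proof -
    define E where "E = concat (map double w)"
    obtain us vs where "ws = us @ w # vs" using w ws split_list by metis
    then have bs: "bs = concat (map block us) @ None # map (Some \<circ> fst) (rev E) @ concat (map block vs)"
      by (simp add: bs_def block_def E_def)
    define k where "k = length (concat (map block us))"
    let ?c = "\<lambda>i. if i = k then 1 else 0 :: int"
    have "length E > 0" using assms(3)[OF w] by (cases w) (auto simp: double_def E_def)
    moreover have "foldr ?t E ?c (k + length E) \<in> {1, int p - 1}"
      using transvections_detect[OF p bs, of "[]" E] by (simp add: Let_def k_def)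
    ultimately have "foldr ?\<rho> w ?c \<noteq> ?c" using p unfolding fw E_def[symmetric] by (auto dest!: fun_cong[of _ _ "k + length E"])
    moreover have "?c \<in> ?S" using p bs by (auto simp: vectors_def k_def)
    ultimately show ?thesis by blast
  qed
  ultimately show ?thesis using finite_vectors by blast
qed

text \<open>Abstracts from the Cayley graph of a finite quotient whose exponent divides
  \<open>k\<close> and in which the words of \<open>W\<close> survive; the last clause is
  connectedness.\<close>

definition free_model :: "'a set \<Rightarrow> ('a \<times> bool) list set \<Rightarrow> nat \<Rightarrow> 'u set \<Rightarrow> ('a \<times> bool \<Rightarrow> 'u \<Rightarrow> 'u) \<Rightarrow> 'u \<Rightarrow> bool" where
  "free_model A W k Q \<mu> e \<longleftrightarrow> finite Q \<and> e \<in> Q \<and> letter_action \<mu> A Q \<and>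
    (\<forall>w. fst ` set w \<subseteq> A \<longrightarrow> (\<forall>u\<in>Q. (foldr \<mu> w ^^ k) u = u)) \<and>
    (\<forall>w\<in>W. \<forall>u\<in>Q. foldr \<mu> w u \<noteq> u) \<and> (\<forall>u\<in>Q. \<exists>w. fst ` set w \<subseteq> A \<and> u = foldr \<mu> w e)"

lemma free_modelD:
  assumes "free_model A W k Q \<mu> e"
  shows "finite Q" "e \<in> Q" "letter_action \<mu> A Q"
    "\<And>w u. fst ` set w \<subseteq> A \<Longrightarrow> u \<in> Q \<Longrightarrow> (foldr \<mu> w ^^ k) u = u"
    "\<And>w u. w \<in> W \<Longrightarrow> u \<in> Q \<Longrightarrow> foldr \<mu> w u \<noteq> u"
    "\<And>u. u \<in> Q \<Longrightarrow> \<exists>w. fst ` set w \<subseteq> A \<and> u = foldr \<mu> w e"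
  using assms unfolding free_model_def by simp_all

text \<open>Passing to the regular action of the permutation group makes the detected words act freely.\<close>
lemma residually_p_regular:
  fixes W :: "('a \<times> bool) list set"
  assumes p: "2 \<le> p" and "finite W" and "\<And>w. w \<in> W \<Longrightarrow> reduced_word w \<and> w \<noteq> [] \<and> fst ` set w \<subseteq> A"
  shows "\<exists>(Q :: ((nat \<Rightarrow> int) \<Rightarrow> nat \<Rightarrow> int) set) \<mu> n e. free_model A W (p ^ Suc n) Q \<mu> e"
proof -
  obtain S :: "(nat \<Rightarrow> int) set" and \<rho> n where S: "finite S" "letter_action \<rho> UNIV S"
    "\<And>w c. c \<in> S \<Longrightarrow> (foldr \<rho> w ^^ (p ^ Suc n)) c = c" "\<And>w. w \<in> W \<Longrightarrow> \<exists>c\<in>S. foldr \<rho> w c \<noteq> c"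
    using residually_p[of p W] assms by metis
  define \<mu> where "\<mu> l f = (\<lambda>c\<in>S. \<rho> l (f c))" for l and f :: "(nat \<Rightarrow> int) \<Rightarrow> nat \<Rightarrow> int"
  define e :: "(nat \<Rightarrow> int) \<Rightarrow> nat \<Rightarrow> int" where "e = (\<lambda>c\<in>S. c)"
  define Q where "Q = {foldr \<mu> w e | w. fst ` set w \<subseteq> A}"
  note cl = word_closed[OF S(2), of _ _, simplified]
  have app: "foldr \<mu> w f = (\<lambda>c\<in>S. foldr \<rho> w (f c))" if "f \<in> S \<rightarrow>\<^sub>E S" for w f
  proof (induction w)
    case Nil
    then show ?case using that by (auto simp: PiE_def extensional_def)
  next
    case (Cons l w)
    have "foldr \<mu> (l # w) f = \<mu> l (\<lambda>c\<in>S. foldr \<rho> w (f c))" by (simp only: foldr.simps o_apply Cons.IH)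
    also have "\<dots> = (\<lambda>c\<in>S. foldr \<rho> (l # w) (f c))" by (auto simp: \<mu>_def)
    finally show ?case .
  qed
  have e: "e \<in> S \<rightarrow>\<^sub>E S" by (auto simp: e_def)
  have Qw: "foldr \<mu> w e = (\<lambda>c\<in>S. foldr \<rho> w c)" for w
    using app[OF e] by (auto simp: e_def)
  have QS: "Q \<subseteq> S \<rightarrow>\<^sub>E S" using cl by (auto simp: Q_def Qw)
  have "letter_action \<mu> A Q"
    unfolding letter_action_def
  proof (intro allI impI ballI conjI)
    fix l :: "'a \<times> bool" and f assume l: "fst l \<in> A" and f: "f \<in> Q"
    then obtain w where w: "f = foldr \<mu> w e" "fst ` set w \<subseteq> A" by (auto simp: Q_def)
    show "\<mu> l f \<in> Q" unfolding Q_def using l w by (intro CollectI exI[of _ "l # w"]) simp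
    have "f \<in> S \<rightarrow>\<^sub>E S" using f QS by blast
    then show "\<mu> (linv l) (\<mu> l f) = f"
      using letter_actionD[OF S(2)] by (auto simp: \<mu>_def fun_eq_iff PiE_iff extensional_def)
  qed
  moreover have "(foldr \<mu> w ^^ (p ^ Suc n)) u = u" if "u \<in> Q" for w u
  proof -
    have u: "u \<in> S \<rightarrow>\<^sub>E S" using that QS by blast
    have "(foldr \<mu> w ^^ (p ^ Suc n)) u = (\<lambda>c\<in>S. (foldr \<rho> w ^^ (p ^ Suc n)) (u c))"
      unfolding word_wpow[symmetric] by (rule app[OF u])
    also have "\<dots> = (\<lambda>c\<in>S. u c)" using u by (intro restrict_ext S(3)) auto
    also have "\<dots> = u" using u by (auto simp: fun_eq_iff PiE_iff extensional_def)
    finally show ?thesis .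
  qed
  moreover have "foldr \<mu> w u \<noteq> u" if wu: "w \<in> W" "u \<in> Q" for w u
  proof
    assume eq: "foldr \<mu> w u = u"
    obtain c where c: "c \<in> S" "foldr \<rho> w c \<noteq> c" using S(4) wu by blast
    obtain v where v: "u = foldr \<mu> v e" using wu by (auto simp: Q_def)
    \<comment> \<open>The permutation \<open>u\<close> carries this point back to \<open>c\<close>,
      so evaluating \<open>foldr \<mu> w u = u\<close> here would make \<open>w\<close> fix
      \<open>c\<close>.\<close>
    let ?c = "foldr \<rho> (winv v) c"
    have c': "?c \<in> S" using c cl by auto
    have "u ?c = c" using c c' word_winv[OF S(2), of "winv v" c] by (simp add: v Qw)
    moreover have "u ?c = foldr \<rho> w (u ?c)"
      using fun_cong[OF eq, of ?c] app[of u w] QS wu c' by (auto simp: restrict_apply')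
    ultimately show False using c by simp
  qed
  moreover have "finite Q" using QS S(1) by (meson finite_PiE finite_subset)
  moreover have "e \<in> Q" unfolding Q_def by (rule CollectI, rule exI[of _ "[]"]) simp
  moreover have "\<forall>u\<in>Q. \<exists>w. fst ` set w \<subseteq> A \<and> u = foldr \<mu> w e" by (auto simp: Q_def)
  ultimately have "free_model A W (p ^ Suc n) Q \<mu> e" unfolding free_model_def by blast
  then show ?thesis by blast
qed

subsection \<open>Generating the alternating group\<close>

definition cyc3 :: "'x \<Rightarrow> 'x \<Rightarrow> 'x \<Rightarrow> 'x \<Rightarrow> 'x" where
  "cyc3 a b c = cycle_of_list [a, b, c]"

lemma cyc3_apply: "distinct [a, b, c] \<Longrightarrow>
    cyc3 a b c v = (if v = a then b else if v = b then c else if v = c then a else v)"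
  by (auto simp: cyc3_def transpose_def)

lemma cyc3_rotate: "distinct [a, b, c] \<Longrightarrow> cyc3 a b c = cyc3 b c a"
  by (rule ext) (auto simp: cyc3_apply)

lemma cyc3_flip: "distinct [a, b, c] \<Longrightarrow> cyc3 b a c = cyc3 a b c \<circ> cyc3 a b c"
  by (rule ext) (auto simp: cyc3_apply)

lemma cyc3_conj: "bij h \<Longrightarrow> distinct [a, b, c] \<Longrightarrow> h \<circ> cyc3 a b c \<circ> inv' h = cyc3 (h a) (h b) (h c)"
  using conjugation_of_cycle[of "[a, b, c]" h] by (simp add: cyc3_def)

text \<open>A point moved by both maps is \<open>v\<close>; hence \<open>g\<close> fixes
  \<open>f v\<close>, \<open>f\<close> fixes \<open>g v\<close>, and the commutator is confined to
  these three points.\<close>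

lemma commutator_cyc3:
  assumes "bij f" "bij g" "f v \<noteq> v" "g v \<noteq> v" "\<And>u. f u \<noteq> u \<Longrightarrow> g u \<noteq> u \<Longrightarrow> u = v"
  shows "distinct [v, f v, g v]" "f \<circ> g \<circ> inv' f \<circ> inv' g = cyc3 v (f v) (g v)"
proof -
  have inj: "f a = f b \<longleftrightarrow> a = b" "g a = g b \<longleftrightarrow> a = b" for a b
    using assms(1,2) by (auto dest: bij_is_inj simp: inj_eq)
  have fg: "f (inv' f a) = a" "inv' f (f a) = a" "g (inv' g a) = a" "inv' g (g a) = a" for a
    using assms(1,2) by (auto simp: bij_is_inj bij_is_surj surj_f_inv_f)
  show d: "distinct [v, f v, g v]" using assms inj by (metis distinct_length_2_or_more distinct_singleton)
  have E: "inv' f a = b \<longleftrightarrow> a = f b" "inv' g a = b \<longleftrightarrow> a = g b" for a b using fg by metis+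
  show "f \<circ> g \<circ> inv' f \<circ> inv' g = cyc3 v (f v) (g v)"
  proof
    fix u
    have dis: "f w = w \<or> g w = w \<or> w = v" for w using assms(5) by blast
    have "f (g (inv' f (inv' g u))) = (if u = v then f v else if u = f v then g v else if u = g v then v else u)"
      using dis assms(3,4) inj fg by (smt (verit, ccfv_threshold))
    then show "(f \<circ> g \<circ> inv' f \<circ> inv' g) u = cyc3 v (f v) (g v) u"
      using cyc3_apply[OF d] by simp
  qed
qed

locale perm_closed =
  fixes G :: "('x \<Rightarrow> 'x) set"
  assumes G_bij: "f \<in> G \<Longrightarrow> bij f"
    and G_comp: "f \<in> G \<Longrightarrow> g \<in> G \<Longrightarrow> f \<circ> g \<in> G"
    and G_inv: "f \<in> G \<Longrightarrow> inv' f \<in> G"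
begin

text \<open>For finite \<open>D\<close> with at least three points this says that \<open>G\<close>
  contains every even permutation supported on \<open>D\<close>.\<close>

definition full :: "'x set \<Rightarrow> bool" where
  "full D \<longleftrightarrow> (\<forall>a\<in>D. \<forall>b\<in>D. \<forall>c\<in>D. distinct [a, b, c] \<longrightarrow> cyc3 a b c \<in> G)"

lemma fullD: "full D \<Longrightarrow> a \<in> D \<Longrightarrow> b \<in> D \<Longrightarrow> c \<in> D \<Longrightarrow> a \<noteq> b \<Longrightarrow> a \<noteq> c \<Longrightarrow> b \<noteq> c \<Longrightarrow> cyc3 a b c \<in> G"
  unfolding full_def by (metis distinct_length_2_or_more distinct_singleton)

lemma G_conj: "h \<in> G \<Longrightarrow> cyc3 a b c \<in> G \<Longrightarrow> distinct [a, b, c] \<Longrightarrow> cyc3 (h a) (h b) (h c) \<in> G"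
  using cyc3_conj[of h a b c] G_bij G_comp G_inv by metis

lemma G_power: "f \<in> G \<Longrightarrow> 0 < n \<Longrightarrow> f ^^ n \<in> G"
proof (induction n)
  case (Suc n)
  then show ?case using G_comp[of f "f ^^ n"] by (cases "n = 0") (auto simp only: funpow.simps o_id)
qed auto

text \<open>Conjugation by 3-cycles inside \<open>D\<close>, which fix \<open>d\<close>, together
  with inversion carries the pair \<open>(a, e)\<close> to every ordered pair of distinct points of
  \<open>D\<close>.\<close>

lemma full_insert_pair:
  assumes "full D" "a \<in> D" "e \<in> D" "a \<noteq> e" "d \<notin> D" "cyc3 a e d \<in> G"
  shows "full (insert d D)"
proof -
  define P where "P x y \<longleftrightarrow> cyc3 x y d \<in> G" for x y
  have sym: "P y x" if "P x y" "x \<in> D" "y \<in> D" "x \<noteq> y" for x y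
  proof -
    have "distinct [x, y, d]" using that assms(5) by auto
    then show ?thesis using cyc3_flip[of x y d] G_comp that(1) unfolding P_def by metis
  qed
  have step: "P y c" if "P x y" "x \<in> D" "y \<in> D" "c \<in> D" "x \<noteq> y" "c \<noteq> y" for x y c
  proof (cases "c = x")
    case False
    have d: "d \<noteq> x" "d \<noteq> y" "d \<noteq> c" using assms(5) that by auto
    have "cyc3 x y c \<in> G" using fullD[OF assms(1), of x y c] that False by blast
    moreover have "distinct [x, y, d]" using d that(5) by auto
    ultimately have "cyc3 (cyc3 x y c x) (cyc3 x y c y) (cyc3 x y c d) \<in> G"
      using G_conj that(1) unfolding P_def by blast
    moreover have "cyc3 x y c x = y" "cyc3 x y c y = c" "cyc3 x y c d = d"
      using d that(5,6) False cyc3_apply[of x y c] by auto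
    ultimately show ?thesis by (simp only: P_def)
  qed (use sym that in auto)
  have e: "P e c" if "c \<in> D" "c \<noteq> e" for c
    using step[of a e c] assms that by (auto simp: P_def)
  have all: "P x y" if "x \<in> D" "y \<in> D" "x \<noteq> y" for x y
    using step[of e x y] e sym that assms(3) by metis
  show ?thesis unfolding full_def
  proof (intro ballI impI)
    fix x y z assume xyz: "x \<in> insert d D" "y \<in> insert d D" "z \<in> insert d D" "distinct [x, y, z]"
    consider "z = d" "x \<in> D" "y \<in> D" | "x = d" "y \<in> D" "z \<in> D" | "y = d" "x \<in> D" "z \<in> D"
      | "x \<in> D" "y \<in> D" "z \<in> D" using xyz by auto
    then show "cyc3 x y z \<in> G"
    proof cases
      case 1 then show ?thesis using all[of x y] xyz by (simp add: P_def)
    next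
      case 2 then show ?thesis using all[of y z] cyc3_rotate[OF xyz(4)] xyz by (simp add: P_def)
    next
      case 3
      then show ?thesis using all[of z x] cyc3_rotate[of z x y] xyz unfolding P_def by auto
    next
      case 4 then show ?thesis using fullD[OF assms(1)] xyz(4) by auto
    qed
  qed
qed

text \<open>If the 3-cycle \<open>(a d f)\<close> meets \<open>D\<close> only in \<open>a\<close>,
  it conjugates a 3-cycle \<open>(a b c)\<close> of \<open>D\<close> into \<open>(d b c)\<close>,
  which has two points in \<open>D\<close>; the bound on \<open>card D\<close> supplies
  \<open>b\<close> and \<open>c\<close>.\<close>

lemma full_insert:
  assumes "full D" "finite D" "3 \<le> card D" "a \<in> D" "d \<notin> D" "cyc3 a d f \<in> G" "distinct [a, d, f]"
  shows "full (insert d D)"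
proof (cases "f \<in> D")
  case True
  have "cyc3 f a d \<in> G" using assms(6,7) cyc3_rotate[of f a d] by auto
  then show ?thesis using full_insert_pair[OF assms(1) True assms(4)] assms by auto
next
  case False
  have "2 \<le> card (D - {a})" using assms by simp
  then obtain T where "T \<subseteq> D - {a}" "card T = 2" by (rule obtain_subset_with_card_n)
  then obtain b c where bc: "b \<in> D" "c \<in> D" "b \<noteq> a" "c \<noteq> a" "b \<noteq> c"
    by (auto simp: card_2_iff)
  let ?k = "cyc3 a d f"
  have "distinct [a, b, c]" "cyc3 a b c \<in> G" using fullD[OF assms(1,4) bc(1,2)] bc by auto
  then have "cyc3 (?k a) (?k b) (?k c) \<in> G" using G_conj[OF assms(6)] by blast
  have "b \<noteq> d" "c \<noteq> d" "b \<noteq> f" "c \<noteq> f" using False bc assms(5) by auto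
  then have "?k a = d" "?k b = b" "?k c = c" using bc cyc3_apply[OF assms(7)] assms(7) by auto
  then have "cyc3 d b c \<in> G" using \<open>cyc3 (?k a) (?k b) (?k c) \<in> G\<close> by (simp only:)
  moreover have "distinct [d, b, c]" using bc assms(5) by auto
  ultimately have "cyc3 b c d \<in> G" using cyc3_rotate by metis
  then show ?thesis using full_insert_pair[OF assms(1) bc(1,2)] bc assms by auto
qed

text \<open>The powers \<open>\<pi> z ^^ N\<close> have supports meeting only in \<open>v\<^sub>0\<close>, so their commutators are 3-cycles through
  \<open>v\<^sub>0\<close>; a maximal set all of whose 3-cycles lie in \<open>G\<close> is then invariant under every \<open>\<pi> z\<close>.\<close>
lemma full_transitive:
  assumes "finite V" "v\<^sub>0 \<in> V" and perm: "\<And>z. z \<in> A \<Longrightarrow> \<pi> z permutes V" and G: "\<And>z. z \<in> A \<Longrightarrow> \<pi> z \<in> G"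
    and A: "a \<in> A" "b \<in> A" "a \<noteq> b" and "0 < N"
    and moves: "\<And>z. z \<in> A \<Longrightarrow> (\<pi> z ^^ N) v\<^sub>0 \<noteq> v\<^sub>0"
    and supp: "\<And>y z v. y \<in> A \<Longrightarrow> z \<in> A \<Longrightarrow> y \<noteq> z \<Longrightarrow> (\<pi> y ^^ N) v \<noteq> v \<Longrightarrow> (\<pi> z ^^ N) v \<noteq> v \<Longrightarrow> v = v\<^sub>0"
    and per: "\<And>z. z \<in> A \<Longrightarrow> \<exists>t. ((\<pi> z ^^ N) ^^ t) v\<^sub>0 = \<pi> z v\<^sub>0"
    and trans: "\<And>D. D \<subseteq> V \<Longrightarrow> v\<^sub>0 \<in> D \<Longrightarrow> (\<And>z. z \<in> A \<Longrightarrow> \<pi> z ` D \<subseteq> D) \<Longrightarrow> D = V"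
  shows "full V"
proof -
  define f where "f z = \<pi> z ^^ N" for z
  have fG: "f z \<in> G" if "z \<in> A" for z unfolding f_def using that G assms(8) by (intro G_power)
  have fV: "f z permutes V" if "z \<in> A" for z unfolding f_def using that perm by (intro permutes_funpow)
  have c3: "distinct [v\<^sub>0, f y v\<^sub>0, f z v\<^sub>0]" "cyc3 v\<^sub>0 (f y v\<^sub>0) (f z v\<^sub>0) \<in> G" if "y \<in> A" "z \<in> A" "y \<noteq> z" for y z
  proof -
    note c = commutator_cyc3[of "f y" "f z" v\<^sub>0]
    have p: "bij (f y)" "bij (f z)" "f y v\<^sub>0 \<noteq> v\<^sub>0" "f z v\<^sub>0 \<noteq> v\<^sub>0" "\<And>u. f y u \<noteq> u \<Longrightarrow> f z u \<noteq> u \<Longrightarrow> u = v\<^sub>0"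
      using G_bij fG that moves supp[OF that] unfolding f_def by auto
    show "distinct [v\<^sub>0, f y v\<^sub>0, f z v\<^sub>0]" by (rule c(1)[OF p])
    have "f y \<circ> f z \<circ> inv' (f y) \<circ> inv' (f z) \<in> G" using fG that by (intro G_comp G_inv)
    then show "cyc3 v\<^sub>0 (f y v\<^sub>0) (f z v\<^sub>0) \<in> G" using c(2)[OF p] by simp
  qed
  let ?D0 = "{v\<^sub>0, f a v\<^sub>0, f b v\<^sub>0}"
  have "full ?D0"
    unfolding full_def
  proof (intro ballI impI)
    fix x y z assume "x \<in> ?D0" "y \<in> ?D0" "z \<in> ?D0" "distinct [x, y, z]"
    moreover note c3[OF A]  c3[OF A(2,1)] A(3)
    ultimately show "cyc3 x y z \<in> G"
      using cyc3_rotate[of x y z] cyc3_rotate[of y z x] by auto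
  qed
  moreover have "?D0 \<subseteq> V" using assms(2) fV A by (auto simp: permutes_in_image)
  ultimately have "{D. D \<subseteq> V \<and> ?D0 \<subseteq> D \<and> full D} \<noteq> {}" (is "?M \<noteq> _") by blast
  moreover have "finite ?M" using assms(1) by simp
  ultimately have "\<exists>D\<in>?M. \<forall>D'\<in>?M. D \<subseteq> D' \<longrightarrow> D = D'" by (rule finite_has_maximal[rotated])
  then obtain D where D': "D \<in> ?M" "\<forall>D'\<in>?M. D \<subseteq> D' \<longrightarrow> D = D'" by (rule bexE)
  then have D: "D \<subseteq> V" "?D0 \<subseteq> D" "full D" by simp_all
  have max: "D' = D" if "D' \<subseteq> V" "?D0 \<subseteq> D'" "full D'" "D \<subseteq> D'" for D'
    using D'(2) that by (metis (mono_tags, lifting) mem_Collect_eq)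
  have fin: "finite D" using D(1) assms(1) finite_subset by blast
  have "card ?D0 = 3" using c3(1)[OF A] by auto
  then have card: "3 \<le> card D" using card_mono[OF fin D(2)] by simp
  have absorb: "d \<in> D" if "x \<in> D" "cyc3 x d e \<in> G" "distinct [x, d, e]" "d \<in> V" for x d e
  proof (rule ccontr)
    assume "d \<notin> D"
    then have "full (insert d D)" using full_insert[OF D(3) fin card that(1)] that by blast
    then show False using max[of "insert d D"] D \<open>d \<notin> D\<close> that by blast
  qed
  \<comment> \<open>One point of \<open>D\<close> that stays in \<open>D\<close> forces all of
    \<open>D\<close> to stay: \<open>h\<close> conjugates a 3-cycle \<open>(x d e)\<close> of
    \<open>D\<close> to one through \<open>h x \<in> D\<close>, and maximality absorbs
    \<open>h d\<close>.\<close>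
  have inv_D: "h ` D \<subseteq> D" if h: "h \<in> G" "h permutes V" and x: "x \<in> D" "h x \<in> D" for h x
  proof
    fix v assume "v \<in> h ` D"
    then obtain d where d: "d \<in> D" "v = h d" by blast
    show "v \<in> D"
    proof (cases "d = x")
      case False
      have "card {x, d} < card D" using card False by simp
      then have "\<not> D \<subseteq> {x, d}" using card_mono[of "{x, d}" D] by auto
      then obtain e where e: "e \<in> D" "e \<noteq> x" "e \<noteq> d" by blast
      have di: "distinct [x, d, e]" using False e by simp
      have "cyc3 x d e \<in> G" using fullD[OF D(3) x(1) d(1) e(1)] di by simp
      then have c: "cyc3 (h x) (h d) (h e) \<in> G" using G_conj[OF h(1) _ di] by blast
      have "distinct [h x, h d, h e]"
        using di inj_eq[OF bij_is_inj[OF G_bij[OF h(1)]]] by simp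
      moreover have "h d \<in> V" using permutes_in_image[OF h(2)] d(1) D(1) by blast
      ultimately have "h d \<in> D" by (rule absorb[OF x(2) c])
      then show ?thesis using d(2) by simp
    qed (use d x in auto)
  qed
  have "\<pi> z ` D \<subseteq> D" if z: "z \<in> A" for z
  proof -
    obtain y where y: "y \<in> A" "y \<noteq> z" using A by blast
    \<comment> \<open>A 3-cycle through \<open>v\<^sub>0\<close> brings \<open>f z v\<^sub>0\<close>
      into \<open>D\<close>, so \<open>D\<close> is invariant under \<open>f z\<close>. Some power
      of \<open>f z\<close> agrees with \<open>\<pi> z\<close> at \<open>v\<^sub>0\<close>, which
      makes \<open>D\<close> invariant under \<open>\<pi> z\<close> too.\<close>
    have "f z v\<^sub>0 \<in> D" using absorb[of v\<^sub>0] D(2) c3[OF z y(1)] y(2) fV[OF z] assms(2)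
      by (metis insert_subset permutes_in_image)
    then have fD: "f z ` D \<subseteq> D" using inv_D[OF fG[OF z] fV[OF z], of v\<^sub>0] D(2) by blast
    have "(f z ^^ t) v\<^sub>0 \<in> D" for t by (induction t) (use D(2) fD in auto)
    then have "\<pi> z v\<^sub>0 \<in> D" using per[OF z] unfolding f_def by metis
    then show ?thesis using inv_D[OF G[OF z] perm[OF z], of v\<^sub>0] D(2) by blast
  qed
  then have "D = V" using trans[OF D(1)] D(2) by blast
  then show ?thesis using D(3) by simp
qed

end

lemma subgroup_perm_closed:
  assumes "subgroup G (sym_group m)" shows "perm_closed G"
proof
  interpret G: subgroup G "sym_group m" by fact
  fix f g assume fg: "f \<in> G" "g \<in> G"
  have f: "f \<in> carrier (sym_group m)" using fg(1) G.subset by blast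
  then show "bij f" using permutes_bij by (auto simp: sym_group_carrier)
  show "f \<circ> g \<in> G" using G.m_closed[OF fg] by (simp add: sym_group_mult)
  show "inv' f \<in> G" using f G.m_inv_closed[OF fg(1)] sym_group_inv_equality by metis
qed

lemma alt_group_subset:
  assumes "subgroup G (sym_group m)" "perm_closed.full G {1..m}"
  shows "carrier (alt_group m) \<subseteq> G"
proof -
  interpret P: perm_closed G by (rule subgroup_perm_closed[OF assms(1)])
  have "three_cycles m \<subseteq> G"
  proof
    fix p assume "p \<in> three_cycles m"
    then obtain cs where cs: "p = cycle_of_list cs" "distinct cs" "length cs = 3" "set cs \<subseteq> {1..m}"
      by auto
    then obtain a b c where "cs = [a, b, c]" by (auto simp: length_Suc_conv numeral_3_eq_3)
    then show "p \<in> G" using P.fullD[OF assms(2), of a b c] cs by (simp add: cyc3_def)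
  qed
  moreover have "generate (alt_group m) (three_cycles m) = generate (sym_group m) (three_cycles m)"
    using group.generate_consistent[OF sym_group_is_group three_cycles_incl alt_group_is_subgroup]
    by (simp add: alt_group_def)
  ultimately show ?thesis
    unfolding alt_group_carrier_as_three_cycles
    using group.generate_subgroup_incl[OF sym_group_is_group _ assms(1)] by simp
qed

subsection \<open>Subdividing virtual edges\<close>

text \<open>The edge of \<open>\<tau>\<close> leaving a point \<open>a \<in> V\<close> is rerouted through a private copy of the graph \<open>U\<close>:
  it enters the copy at \<open>m e\<^sub>0\<close>, and the edge of the copy leaving \<open>e\<^sub>0\<close> now ends at \<open>\<tau> a\<close>.\<close>
definition sub_fwd :: "'a \<Rightarrow> 'y set \<Rightarrow> ('y \<Rightarrow> 'y) \<Rightarrow> ('u \<Rightarrow> 'u) \<Rightarrow> 'u \<Rightarrow> 'y + 'y \<times> 'a \<times> 'u \<Rightarrow> 'y + 'y \<times> 'a \<times> 'u" where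
  "sub_fwd z V \<tau> m e\<^sub>0 s = (case s of
     Inl a \<Rightarrow> if a \<in> V then Inr (a, z, m e\<^sub>0) else Inl (\<tau> a)
   | Inr (a, y, u) \<Rightarrow> if y = z \<and> u = e\<^sub>0 then Inl (\<tau> a) else Inr (a, y, m u))"

definition sub_bwd :: "'a \<Rightarrow> 'y set \<Rightarrow> ('y \<Rightarrow> 'y) \<Rightarrow> ('u \<Rightarrow> 'u) \<Rightarrow> ('u \<Rightarrow> 'u) \<Rightarrow> 'u \<Rightarrow> 'y + 'y \<times> 'a \<times> 'u \<Rightarrow> 'y + 'y \<times> 'a \<times> 'u" where
  "sub_bwd z V \<tau> m m' e\<^sub>0 s = (case s of
     Inl b \<Rightarrow> if inv' \<tau> b \<in> V then Inr (inv' \<tau> b, z, e\<^sub>0) else Inl (inv' \<tau> b)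
   | Inr (a, y, u) \<Rightarrow> if y = z \<and> u = m e\<^sub>0 then Inl a else Inr (a, y, m' u))"

text \<open>On \<open>V\<close> the map \<open>\<tau>\<close> is consulted only where a copy of the
  graph is left, so exchanging two virtual edges multiplies the subdivided map by one transposition
  of exit points. This is the source of the parity change.\<close>

lemma sub_fwd_transpose:
  assumes "c \<in> V" "c' \<in> V"
  shows "sub_fwd z V (\<tau> \<circ> transpose c c') m e\<^sub>0 =
    sub_fwd z V \<tau> m e\<^sub>0 \<circ> transpose (Inr (c, z, e\<^sub>0)) (Inr (c', z, e\<^sub>0))"
proof
  fix s
  show "sub_fwd z V (\<tau> \<circ> transpose c c') m e\<^sub>0 s =
    (sub_fwd z V \<tau> m e\<^sub>0 \<circ> transpose (Inr (c, z, e\<^sub>0)) (Inr (c', z, e\<^sub>0))) s"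
  proof (cases s)
    case (Inl a)
    then show ?thesis using assms by (auto simp: sub_fwd_def transpose_def)
  next
    case (Inr t)
    obtain a y u where t: "t = (a, y, u)" by (cases t)
    show ?thesis
    proof (cases "y = z \<and> u = e\<^sub>0")
      case False
      then have "transpose (Inr (c, z, e\<^sub>0)) (Inr (c', z, e\<^sub>0)) s = s" by (auto simp: Inr t transpose_def)
      then show ?thesis using False by (auto simp: Inr t sub_fwd_def)
    qed (auto simp: Inr t sub_fwd_def transpose_def)
  qed
qed

text \<open>\<open>V z\<close> holds the tails of the virtual \<open>z\<close>-edges, and
  \<open>free\<close> makes the girth of \<open>U\<close> exceed \<open>L\<close>. A slot point
  \<open>(a, y, u)\<close> is the vertex \<open>u\<close> of the copy placed on the
  \<open>y\<close>-edge at \<open>a\<close>.\<close>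

locale subdivision =
  fixes A :: "'a set" and Y :: "'y set" and V :: "'a \<Rightarrow> 'y set" and \<sigma> :: "'a \<Rightarrow> 'y \<Rightarrow> 'y"
    and U :: "'u set" and \<mu> :: "'a \<times> bool \<Rightarrow> 'u \<Rightarrow> 'u" and e\<^sub>0 :: 'u and L :: nat
  assumes V_sub: "z \<in> A \<Longrightarrow> V z \<subseteq> Y"
    and \<sigma>: "z \<in> A \<Longrightarrow> \<sigma> z permutes Y"
    and fin: "finite Y" "finite U" "finite A"
    and e\<^sub>0: "e\<^sub>0 \<in> U"
    and \<mu>: "letter_action \<mu> A U"
    and free: "fst ` set w \<subseteq> A \<Longrightarrow> reduced_word w \<Longrightarrow> w \<noteq> [] \<Longrightarrow> length w \<le> L \<Longrightarrow> u \<in> U \<Longrightarrow> foldr \<mu> w u \<noteq> u"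
    and conn: "u \<in> U \<Longrightarrow> \<exists>w. fst ` set w \<subseteq> A \<and> u = foldr \<mu> w e\<^sub>0"
begin

definition space :: "('y + 'y \<times> 'a \<times> 'u) set" where
  "space = Inl ` Y \<union> Inr ` {(a, y, u). y \<in> A \<and> a \<in> V y \<and> u \<in> U}"

definition step :: "'a \<times> bool \<Rightarrow> 'y + 'y \<times> 'a \<times> 'u \<Rightarrow> 'y + 'y \<times> 'a \<times> 'u" where
  "step l = (if snd l then sub_fwd (fst l) (V (fst l)) (\<sigma> (fst l)) (\<mu> (fst l, True)) e\<^sub>0
     else sub_bwd (fst l) (V (fst l)) (\<sigma> (fst l)) (\<mu> (fst l, True)) (\<mu> (fst l, False)) e\<^sub>0)"

lemma space_simps [simp]: "Inl a \<in> space \<longleftrightarrow> a \<in> Y" "Inr (a, y, u) \<in> space \<longleftrightarrow> y \<in> A \<and> a \<in> V y \<and> u \<in> U"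
  by (auto simp: space_def)

lemma finite_space: "finite space"
proof -
  have "{(a, y, u). y \<in> A \<and> a \<in> V y \<and> u \<in> U} \<subseteq> Y \<times> A \<times> U" using V_sub by auto
  then show ?thesis using fin finite_subset unfolding space_def by blast
qed

lemma \<sigma>_mem: "z \<in> A \<Longrightarrow> a \<in> Y \<Longrightarrow> \<sigma> z a \<in> Y" "z \<in> A \<Longrightarrow> a \<in> Y \<Longrightarrow> inv' (\<sigma> z) a \<in> Y"
  "z \<in> A \<Longrightarrow> inv' (\<sigma> z) (\<sigma> z a) = a" "z \<in> A \<Longrightarrow> \<sigma> z (inv' (\<sigma> z) a) = a"
  using \<sigma>[of z] permutes_inv[OF \<sigma>[of z]] by (simp_all add: permutes_in_image permutes_inverses)

lemma step_Inl: "step (z, True) (Inl a) = (if a \<in> V z then Inr (a, z, \<mu> (z, True) e\<^sub>0) else Inl (\<sigma> z a))"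
  "step (z, False) (Inl a) = (if inv' (\<sigma> z) a \<in> V z then Inr (inv' (\<sigma> z) a, z, e\<^sub>0) else Inl (inv' (\<sigma> z) a))"
  and step_Inr: "step (z, True) (Inr (a, y, u)) = (if y = z \<and> u = e\<^sub>0 then Inl (\<sigma> z a) else Inr (a, y, \<mu> (z, True) u))"
  "step (z, False) (Inr (a, y, u)) = (if y = z \<and> u = \<mu> (z, True) e\<^sub>0 then Inl a else Inr (a, y, \<mu> (z, False) u))"
  by (auto simp: step_def sub_fwd_def sub_bwd_def)

lemma \<mu>D: "z \<in> A \<Longrightarrow> u \<in> U \<Longrightarrow> \<mu> (z, b) u \<in> U" "z \<in> A \<Longrightarrow> u \<in> U \<Longrightarrow> \<mu> (z, \<not> b) (\<mu> (z, b) u) = u"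
  "z \<in> A \<Longrightarrow> u \<in> U \<Longrightarrow> \<mu> (z, b) (\<mu> (z, \<not> b) u) = u"
  using letter_actionD[OF \<mu>, of "(z, b)"] by auto

lemma step_action: "letter_action step A space"
  unfolding letter_action_def
proof (intro allI impI ballI conjI)
  fix l :: "'a \<times> bool" and s
  assume l: "fst l \<in> A" and s: "s \<in> space"
  obtain z b where zb: "l = (z, b)" by (cases l)
  then have z: "z \<in> A" using l by simp
  have V: "a \<in> V y \<Longrightarrow> y \<in> A \<Longrightarrow> a \<in> Y" for a y using V_sub by blast
  note \<mu>T = \<mu>D[OF z, where b = True, simplified] and \<mu>F = \<mu>D[OF z, where b = False, simplified]
  show "step l s \<in> space"
    using s z e\<^sub>0 by (cases s; cases b) (auto simp: zb step_Inl step_Inr \<sigma>_mem V \<mu>T \<mu>F)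
  have cancel: "step (z, \<not> b) (step (z, b) s) = s"
  proof (cases s)
    case (Inl a)
    then show ?thesis using z e\<^sub>0 by (cases b) (auto simp: step_Inl step_Inr \<sigma>_mem \<mu>T \<mu>F)
  next
    case (Inr t)
    obtain a y u where t: "t = (a, y, u)" by (cases t)
    have "y \<in> A" "a \<in> V y" "u \<in> U" using s Inr t by auto
    moreover have inj: "\<mu> (z, b) u = \<mu> (z, b) u' \<longleftrightarrow> u = u'" if "u' \<in> U" for u' b
      using \<mu>D(2)[OF z] that \<open>u \<in> U\<close> by metis
    moreover have "y = z \<Longrightarrow> \<mu> (z, False) u = e\<^sub>0 \<longleftrightarrow> u = \<mu> (z, True) e\<^sub>0"
      using \<mu>T(2)[OF e\<^sub>0] \<mu>F(2)[OF \<open>u \<in> U\<close>] by metis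
    ultimately show ?thesis using z inj[OF e\<^sub>0] \<mu>T(2)[OF \<open>u \<in> U\<close>] \<mu>F(2)[OF \<open>u \<in> U\<close>]
      by (cases b; cases "y = z") (simp_all add: Inr t step_Inl step_Inr \<sigma>_mem)
  qed
  show "step (linv l) (step l s) = s" using cancel by (simp add: zb)
qed

text \<open>A reduced path of length at most \<open>L\<close> that has entered a slot never leaves
  it: leaving would close a reduced path in \<open>U\<close> or make \<open>w\<close> backtrack. In
  the second alternative \<open>p\<close> is the part walked inside the slot; the extra letter for
  \<open>s\<close> records that a forward edge enters at \<open>\<mu> (y, True) e\<^sub>0\<close>, a
  backward edge at \<open>e\<^sub>0\<close>.\<close>

lemma path_state:
  assumes v: "v \<in> Y" and \<rho>: "letter_action \<rho> A M" and \<theta>: "\<And>a. a \<in> Y \<Longrightarrow> \<theta> a \<in> M"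
    and real: "\<And>z a. z \<in> A \<Longrightarrow> a \<in> Y \<Longrightarrow> a \<notin> V z \<Longrightarrow> \<theta> (\<sigma> z a) = \<rho> (z, True) (\<theta> a)"
    and w: "fst ` set w \<subseteq> A" "reduced_word w" "length w \<le> L"
  shows "(\<exists>b\<in>Y. foldr step w (Inl v) = Inl b \<and> foldr \<rho> w (\<theta> v) = \<theta> b \<and>
        (\<forall>w1 w2. w = w1 @ w2 \<longrightarrow> (\<exists>c\<in>Y. foldr step w2 (Inl v) = Inl c))) \<or>
    (\<exists>a y p s w2. foldr step w (Inl v) = Inr (a, y, foldr \<mu> (p @ (if s then [(y, True)] else [])) e\<^sub>0) \<and>
        y \<in> A \<and> a \<in> V y \<and> w = p @ (y, s) # w2)"
  using w
proof (induction w)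
  case Nil
  then show ?case using v by auto
next
  case (Cons l w)
  obtain z b where zb: "l = (z, b)" by (cases l)
  have z: "z \<in> A" and w: "fst ` set w \<subseteq> A" "reduced_word w" "length w \<le> L"
    using Cons.prems zb by (auto simp: reduced_word_Cons)
  from Cons.IH[OF w] show ?case
  proof (elim disjE bexE exE conjE)
    fix c assume c: "c \<in> Y" "foldr step w (Inl v) = Inl c" "foldr \<rho> w (\<theta> v) = \<theta> c"
      and suf: "\<forall>w1 w2. w = w1 @ w2 \<longrightarrow> (\<exists>c\<in>Y. foldr step w2 (Inl v) = Inl c)"
    define d where "d = (if b then \<sigma> z c else inv' (\<sigma> z) c)"
    have d: "d \<in> Y" using c z by (auto simp: d_def \<sigma>_mem)
    show ?thesis
    proof (cases "(if b then c else d) \<in> V z")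
      case True
      then have "foldr step (l # w) (Inl v) = Inr (if b then c else d, z, foldr \<mu> ([] @ (if b then [(z, True)] else [])) e\<^sub>0)"
        by (cases b) (auto simp: zb c step_Inl d_def)
      moreover have "(if b then c else d) \<in> V z \<and> l # w = [] @ (z, b) # w" using True zb by simp
      ultimately show ?thesis using z by blast
    next
      case False
      then have s: "foldr step (l # w) (Inl v) = Inl d" by (cases b) (auto simp: zb c step_Inl d_def)
      have "foldr \<rho> (l # w) (\<theta> v) = \<theta> d"
      proof (cases b)
        case True
        then show ?thesis using False real[OF z c(1)] by (simp add: zb c d_def)
      next
        case b: False
        then have "\<theta> c = \<rho> (z, True) (\<theta> d)" using False real[OF z d] z by (simp add: d_def \<sigma>_mem)
        then show ?thesis using b letter_actionD(2)[OF \<rho>, of "(z, True)" "\<theta> d"] z \<theta>[OF d] by (simp add: zb c)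
      qed
      moreover have "\<exists>c\<in>Y. foldr step w2 (Inl v) = Inl c" if "l # w = w1 @ w2" for w1 w2
        using that s d suf by (cases w1) auto
      ultimately show ?thesis using s d by blast
    qed
  next
    fix a :: 'y and y :: 'a and p and s :: bool and w2 :: "('a \<times> bool) list"
    let ?q = "p @ (if s then [(y, True)] else [])"
    assume st: "foldr step w (Inl v) = Inr (a, y, foldr \<mu> ?q e\<^sub>0)" and ya: "y \<in> A" "a \<in> V y"
      and wp: "w = p @ (y, s) # w2"
    have red: "reduced_word (l # p @ (y, s) # w2)" "length (l # p) \<le> L" using Cons.prems wp by auto
    have p: "fst ` set p \<subseteq> A" "reduced_word (l # p)" "reduced_word (p @ [(y, s)])"
      using Cons.prems wp reduced_word_infix[of "[]" "l # p"] reduced_word_infix[of "[l]" "p @ [(y, s)]"] by auto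
    have U: "\<mu> (y, True) e\<^sub>0 \<in> U" using \<mu>D(1)[OF ya(1) e\<^sub>0] .
    have "step l (Inr (a, y, foldr \<mu> ?q e\<^sub>0)) = Inr (a, y, \<mu> l (foldr \<mu> ?q e\<^sub>0))"
    proof (rule ccontr)
      assume exit: "step l (Inr (a, y, foldr \<mu> ?q e\<^sub>0)) \<noteq> Inr (a, y, \<mu> l (foldr \<mu> ?q e\<^sub>0))"
      then have ly: "l = (y, b)" by (cases b) (auto simp: zb step_Inr split: if_splits)
      from exit have eq: "foldr \<mu> ?q e\<^sub>0 = (if b then e\<^sub>0 else \<mu> (y, True) e\<^sub>0)"
        by (cases b) (auto simp: ly step_Inr split: if_splits)
      show False
      \<comment> \<open>With \<open>b \<noteq> s\<close> the slot is left by the end through which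
        it was entered, so \<open>p\<close> is closed, hence empty, and \<open>l\<close> cancels
        \<open>(y, s)\<close>. With \<open>b = s\<close> the slot is traversed, and the
        \<open>y\<close>-edge at \<open>e\<^sub>0\<close> completes the way to a nonempty closed
        path in \<open>U\<close>.\<close>
      proof (cases "b = s")
        case False
        then have "foldr \<mu> p (foldr \<mu> (if s then [(y, True)] else []) e\<^sub>0) = foldr \<mu> (if s then [(y, True)] else []) e\<^sub>0"
          using eq by auto
        moreover have "foldr \<mu> (if s then [(y, True)] else []) e\<^sub>0 \<in> U" using U e\<^sub>0 by auto
        moreover have "reduced_word p" "length p \<le> L" using p(2) red by (auto simp: reduced_word_Cons)
        ultimately have "p = []" using free p(1) by blast
        then show False using red(1) ly False by (auto simp: reduced_word_Cons)
      next
        case True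
        show False
        proof (cases s)
          case s: True
          have "foldr \<mu> (p @ [(y, True)]) e\<^sub>0 = e\<^sub>0" using eq True s by auto
          moreover have "length (p @ [(y, True)]) \<le> L" using red(2) by simp
          ultimately show False using free[of "p @ [(y, True)]" e\<^sub>0] p ya(1) s e\<^sub>0 by auto
        next
          case s: False
          have "foldr \<mu> (l # p) e\<^sub>0 = e\<^sub>0"
            using eq True s ly \<mu>D(2)[OF ya(1) e\<^sub>0, of True] by simp
          then show False using free[of "l # p" e\<^sub>0] p red(2) e\<^sub>0 ly ya(1) by auto
        qed
      qed
    qed
    then have "foldr step (l # w) (Inl v) = Inr (a, y, foldr \<mu> ((l # p) @ (if s then [(y, True)] else [])) e\<^sub>0)"
      using st by simp
    moreover have "l # w = (l # p) @ (y, s) # w2" using wp by simp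
    ultimately show ?thesis using ya by blast
  qed
qed

lemma fixed_path_real:
  assumes "v \<in> Y" "letter_action \<rho> A M" "\<And>a. a \<in> Y \<Longrightarrow> \<theta> a \<in> M"
    and "\<And>z a. z \<in> A \<Longrightarrow> a \<in> Y \<Longrightarrow> a \<notin> V z \<Longrightarrow> \<theta> (\<sigma> z a) = \<rho> (z, True) (\<theta> a)"
    and "fst ` set w \<subseteq> A" "reduced_word w" "length w \<le> L" "foldr step w (Inl v) = Inl v"
  shows "foldr \<rho> w (\<theta> v) = \<theta> v"
  using path_state[OF assms(1,2,3,4,5,6,7)] assms(8) by auto

text \<open>A closed path through a slot that leaves the slot is, up to rotation, a closed path based in \<open>Y\<close>,
  and those never enter a slot.\<close>
lemma slot_free:
  assumes "cyc_reduced w" "w \<noteq> []" "fst ` set w \<subseteq> A" "length w \<le> L" "s \<in> space" "s \<notin> Inl ` Y"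
  shows "foldr step w s \<noteq> s"
proof
  assume eq: "foldr step w s = s"
  obtain a y u where s: "s = Inr (a, y, u)" using assms(5,6) by (auto simp: space_def)
  have u: "y \<in> A" "a \<in> V y" "u \<in> U" using assms(5) s by auto
  have wr: "reduced_word w" using assms(1) by (auto simp: cyc_reduced_def reduced_word_append)
  have alt: "foldr step v s = Inr (a, y, foldr \<mu> v u) \<or> (\<exists>w1 w2 b. v = w1 @ w2 \<and> b \<in> Y \<and> foldr step w2 s = Inl b)"
    if "fst ` set v \<subseteq> A" for v
    using that
  proof (induction v)
    case (Cons l v)
    obtain z b where zb: "l = (z, b)" by (cases l)
    show ?case
    proof (cases "\<exists>c\<in>Y. foldr step (l # v) s = Inl c")
      case True
      then show ?thesis by (metis append_Nil)
    next
      case False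
      have cl: "foldr step (l # v) s \<in> space"
        using word_closed[OF step_action Cons.prems assms(5)] .
      from Cons consider "foldr step v s = Inr (a, y, foldr \<mu> v u)"
        | w1 w2 b where "v = w1 @ w2" "b \<in> Y" "foldr step w2 s = Inl b" by auto
      then show ?thesis
      proof cases
        case 1
        then show ?thesis using False cl by (cases b) (auto simp: zb step_Inr split: if_splits)
      next
        case 2
        then show ?thesis by (metis append_Cons)
      qed
    qed
  qed (simp add: s)
  from alt[OF assms(3)] show False
  proof (elim disjE exE conjE)
    assume "foldr step w s = Inr (a, y, foldr \<mu> w u)"
    then show False using eq free[OF assms(3) wr assms(2,4) u(3)] s by simp
  next
    fix w1 w2 b assume w: "w = w1 @ w2" and b: "b \<in> Y" "foldr step w2 s = Inl b"
    have s': "foldr step w1 (Inl b) = s" using eq w b by simp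
    have "reduced_word (w2 @ w1)"
      using assms(1) reduced_word_infix[of w1 "w2 @ w1" w2] unfolding cyc_reduced_def w by simp
    \<comment> \<open>A trivial label action suffices, as only the two alternatives matter. Along a
      path confined to \<open>Y\<close> the word \<open>w1\<close> could not end at the slot point
      \<open>s\<close>; a path ending in a slot could not return to \<open>Inl b\<close>.\<close>
    then have "(\<exists>c\<in>Y. foldr step w1 (Inl b) = Inl c) \<or> (\<exists>t. foldr step (w2 @ w1) (Inl b) = Inr t)"
      using path_state[OF b(1), of "\<lambda>_ _. ()" UNIV "\<lambda>_. ()" "w2 @ w1"] assms(3,4) w
      by (auto simp: letter_action_def image_Un)
    then show False using s' b s by auto
  qed
qed

text \<open>An injective self-map of a finite space sending \<open>D\<close> into \<open>D\<close>
  sends it onto \<open>D\<close>, so \<open>D\<close> is also closed backwards. Connectedness of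
  \<open>U\<close> then fills the slot at \<open>b\<close>, although one of its edges is
  cut.\<close>

lemma closed_set:
  assumes D: "D \<subseteq> space" "\<And>z. z \<in> A \<Longrightarrow> step (z, True) ` D \<subseteq> D" and b: "Inl b \<in> D" "z \<in> A"
  shows "Inl (\<sigma> z b) \<in> D" "b \<in> V z \<Longrightarrow> u \<in> U \<Longrightarrow> Inr (b, z, u) \<in> D"
proof -
  have fwd: "step (y, True) s \<in> D" if "s \<in> D" "y \<in> A" for s y using D that by blast
  have bwd: "s \<in> D" if "step (y, True) s \<in> D" "s \<in> space" "y \<in> A" for s y
  proof -
    have "inj_on (step (y, True)) space"
      using letter_actionD(2)[OF step_action, of "(y, True)"] that(3) by (metis fst_conv inj_onI)
    then have "step (y, True) ` D = D"
      using D(1) D(2)[OF that(3)] finite_subset[OF D(1) finite_space]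
      by (metis endo_inj_surj inj_on_subset)
    then have "step (y, True) s \<in> step (y, True) ` D" using that(1) by (simp only:)
    then obtain s' where s': "step (y, True) s = step (y, True) s'" "s' \<in> D" by (rule imageE)
    have "s = s'"
      using s' \<open>inj_on (step (y, True)) space\<close> D(1) that(2) by (metis inj_onD subsetD)
    then show ?thesis using s'(2) by simp
  qed
  have slot: "(\<forall>u\<in>U. Inr (b, z, u) \<in> D) \<and> Inl (\<sigma> z b) \<in> D" if V: "b \<in> V z"
  proof -
    let ?m = "\<mu> (z, True)"
    obtain t where t: "0 < t" "(?m ^^ t) e\<^sub>0 = e\<^sub>0"
      using word_periodic[OF \<mu> fin(2) _ e\<^sub>0, of "[(z, True)]"] b(2) by auto
    \<comment> \<open>The cut edge is bypassed: from the entrance \<open>?m e\<^sub>0\<close> the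
      \<open>z\<close>-cycle is followed the long way round until it reaches
      \<open>e\<^sub>0\<close>.\<close>
    have in_D: "Inr (b, z, (?m ^^ Suc i) e\<^sub>0) \<in> D \<or> Inr (b, z, e\<^sub>0) \<in> D" for i
    proof (induction i)
      case 0
      show ?case using fwd[OF b] V by (simp add: step_Inl)
    next
      case (Suc i)
      show ?case
      proof (cases "Inr (b, z, e\<^sub>0) \<in> D")
        case False
        then have "Inr (b, z, (?m ^^ Suc i) e\<^sub>0) \<in> D" "(?m ^^ Suc i) e\<^sub>0 \<noteq> e\<^sub>0" using Suc by (blast, metis)
        then show ?thesis using fwd[OF _ b(2), of "Inr (b, z, (?m ^^ Suc i) e\<^sub>0)"] by (simp add: step_Inr)
      qed simp
    qed
    have e0: "Inr (b, z, e\<^sub>0) \<in> D" using in_D[of "t - 1"] t by simp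
    have m0: "Inr (b, z, ?m e\<^sub>0) \<in> D" using fwd[OF b] V by (simp add: step_Inl)
    have "Inr (b, z, foldr \<mu> w e\<^sub>0) \<in> D" if "fst ` set w \<subseteq> A" for w
      using that
    proof (induction w)
      case (Cons l w)
      obtain y s where l: "l = (y, s)" by (cases l)
      have y: "y \<in> A" "fst ` set w \<subseteq> A" using Cons.prems l by auto
      let ?u = "foldr \<mu> w e\<^sub>0"
      have IH: "Inr (b, z, ?u) \<in> D" using Cons.IH y by simp
      have uU: "?u \<in> U" using word_closed[OF \<mu> y(2) e\<^sub>0] .
      show ?case
      proof (cases s)
        case True
        then show ?thesis using fwd[OF IH y(1)] m0 by (auto simp: l step_Inr split: if_splits)
      next
        case False
        let ?u' = "\<mu> (y, False) ?u"
        have u': "?u' \<in> U" "\<mu> (y, True) ?u' = ?u" using \<mu>D(1)[OF y(1) uU] \<mu>D(3)[OF y(1) uU, of True] by auto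
        show ?thesis
        proof (cases "y = z \<and> ?u' = e\<^sub>0")
          case True
          then have "foldr \<mu> (l # w) e\<^sub>0 = e\<^sub>0" using False l by auto
          then show ?thesis using e0 by (simp only:)
        next
          case F: False
          then have "step (y, True) (Inr (b, z, ?u')) = Inr (b, z, ?u)" using u' by (auto simp: step_Inr)
          then have "Inr (b, z, ?u') \<in> D" using bwd[OF _ _ y(1), of "Inr (b, z, ?u')"] IH u' V b(2) by simp
          then show ?thesis using False l by simp
        qed
      qed
    qed (simp add: e0)
    then have "\<forall>u\<in>U. Inr (b, z, u) \<in> D" using conn by metis
    moreover have "Inl (\<sigma> z b) \<in> D" using fwd[OF e0 b(2)] by (simp add: step_Inr)
    ultimately show ?thesis by blast
  qed
  show "Inl (\<sigma> z b) \<in> D"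
  proof (cases "b \<in> V z")
    case False
    then show ?thesis using fwd[OF b] by (simp add: step_Inl)
  qed (use slot in blast)
  show "b \<in> V z \<Longrightarrow> u \<in> U \<Longrightarrow> Inr (b, z, u) \<in> D" using slot by blast
qed

end

subsection \<open>A finite model with prescribed local structure\<close>

text \<open>The orbit of \<open>s\<close> closes up after at most \<open>card I\<close> steps, and a
  period not exceeding \<open>k\<close> divides \<open>fact k\<close>.\<close>

lemma funpow_fact_fixed:
  assumes "finite I" "s \<in> I" "g ` I \<subseteq> I" "inj_on g I" "card I \<le> k"
  shows "(g ^^ fact k) s = s"
proof -
  have cl: "(g ^^ i) t \<in> I" if "t \<in> I" for i t using that assms(3) by (induction i) auto
  have inj: "inj_on (g ^^ i) I" for i
  proof (induction i)
    case (Suc i)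
    have "inj_on (g \<circ> (g ^^ i)) I"
      using Suc cl by (intro comp_inj_on inj_on_subset[OF assms(4)]) auto
    then show ?case by (simp add: comp_def)
  qed simp
  have "\<not> inj_on (\<lambda>i. (g ^^ i) s) {..card I}"
  proof
    assume "inj_on (\<lambda>i. (g ^^ i) s) {..card I}"
    moreover have "(\<lambda>i. (g ^^ i) s) ` {..card I} \<subseteq> I" using cl assms(2) by blast
    ultimately have "card {..card I} \<le> card I" using card_inj_on_le assms(1) by blast
    then show False by simp
  qed
  then obtain i j where "i \<le> card I" "j \<le> card I" "(g ^^ i) s = (g ^^ j) s" "i \<noteq> j"
    unfolding inj_on_def by auto
  then obtain i j where ij: "i < j" "j \<le> card I" "(g ^^ i) s = (g ^^ j) s"
    by (cases i j rule: linorder_cases) metis+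
  define t where "t = j - i"
  have t: "0 < t" "t \<le> k" "j = i + t" using ij assms(5) by (auto simp: t_def)
  have "(g ^^ i) s = (g ^^ i) ((g ^^ t) s)" using ij(3) unfolding t(3) by (simp add: funpow_add)
  then have per: "(g ^^ t) s = s" using inj_onD[OF inj _ assms(2) cl[OF assms(2)]] by metis
  have "t dvd fact k" using t dvd_fact by (metis Suc_leI One_nat_def)
  then obtain c :: nat where "fact k = t * c" by (elim dvdE)
  moreover have "((g ^^ t) ^^ c) s = s" by (induction c) (auto simp: per)
  ultimately show ?thesis by (simp add: funpow_mult)
qed

lemma injection_extends_to_permutation:
  assumes "finite J" "D \<subseteq> J" "inj_on f D" "f ` D \<subseteq> J"
  shows "\<exists>\<kappa>. \<kappa> permutes J \<and> (\<forall>x\<in>D. \<kappa> x = f x)"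
proof -
  have fin: "finite D" "finite (f ` D)" using assms finite_subset by blast+
  have "card (J - D) = card (J - f ` D)"
    using assms fin by (simp add: card_Diff_subset card_image)
  then obtain g where g: "bij_betw g (J - D) (J - f ` D)"
    using assms(1) by (metis finite_Diff finite_same_card_bij)
  define \<kappa> where "\<kappa> x = (if x \<in> D then f x else if x \<in> J then g x else x)" for x
  have "bij_betw \<kappa> D (f ` D)" using assms(3) by (auto simp: bij_betw_def \<kappa>_def inj_on_def)
  moreover have "bij_betw \<kappa> (J - D) (J - f ` D)" using g by (subst bij_betw_cong[of _ _ g]) (auto simp: \<kappa>_def)
  ultimately have "bij_betw \<kappa> (D \<union> (J - D)) (f ` D \<union> (J - f ` D))" by (intro bij_betw_combine) auto
  then have "bij_betw \<kappa> J J" using assms(2,4) by (simp add: Un_absorb1)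
  then have "\<kappa> permutes J" using assms(2) by (intro bij_imp_permutes) (auto simp: \<kappa>_def)
  then show ?thesis by (intro exI[of _ \<kappa>]) (auto simp: \<kappa>_def)
qed

section \<open>The bouquet of long cycles and the completion of the letters\<close>

datatype ('o, 'a) base = Orig 'o | Hub | Arc 'a nat

text \<open>The points \<open>Hub\<close> and \<open>Arc z t\<close>, \<open>0 < t < q\<close>, form a cycle of length \<open>q\<close> for every letter \<open>z\<close>.
  A power of the letter \<open>z\<close> will move only this cycle, because all its other cycles are shorter
  than the prime \<open>p\<close> dividing \<open>q\<close>.\<close>
locale bouquet =
  fixes A :: "'a set" and Y :: "'o set" and \<rho> :: "'a \<times> bool \<Rightarrow> 'o \<Rightarrow> 'o" and M :: "'o set" and L :: nat
    and x\<^sub>0 y\<^sub>0 :: 'a and U :: "'u set" and \<mu> :: "'a \<times> bool \<Rightarrow> 'u \<Rightarrow> 'u" and e\<^sub>0 :: 'u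
    and Q :: "'q set" and \<nu> :: "'a \<times> bool \<Rightarrow> 'q \<Rightarrow> 'q" and e\<^sub>1 :: 'q and p r :: nat
  assumes A: "finite A" "x\<^sub>0 \<in> A" "y\<^sub>0 \<in> A" "x\<^sub>0 \<noteq> y\<^sub>0"
    and \<rho>: "letter_action \<rho> A M" and Y: "finite Y" "Y \<subseteq> M"
    and no_closed: "\<And>Z. Z \<subseteq> Y \<Longrightarrow> (\<And>z. z \<in> A \<Longrightarrow> \<rho> (z, True) ` Z \<subseteq> Z) \<Longrightarrow> Z = {}"
    and U: "finite U" "e\<^sub>0 \<in> U" "letter_action \<mu> A U"
      "\<And>w u. fst ` set w \<subseteq> A \<Longrightarrow> reduced_word w \<Longrightarrow> w \<noteq> [] \<Longrightarrow> length w \<le> L \<Longrightarrow> u \<in> U \<Longrightarrow> foldr \<mu> w u \<noteq> u"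
      "\<And>u. u \<in> U \<Longrightarrow> \<exists>w. fst ` set w \<subseteq> A \<and> u = foldr \<mu> w e\<^sub>0"
    and Q: "e\<^sub>1 \<in> Q" "letter_action \<nu> A Q" "\<And>z. z \<in> A \<Longrightarrow> (\<nu> (z, True) ^^ (p ^ Suc r)) e\<^sub>1 = e\<^sub>1"
      "\<And>w u. fst ` set w \<subseteq> A \<Longrightarrow> reduced_word w \<Longrightarrow> w \<noteq> [] \<Longrightarrow> length w \<le> L \<Longrightarrow> u \<in> Q \<Longrightarrow> foldr \<nu> w u \<noteq> u"
    and p: "Factorial_Ring.prime p" "(2 * card Y + 2) * (1 + card U) < p"
begin

text \<open>As a multiple of the periods of \<open>e\<^sub>1\<close> it lets the labels
  \<open>\<theta>\<close> close up around every arc; as a positive power of \<open>p\<close> it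
  exceeds the bound for the other cycles and is coprime to \<open>N\<close>.\<close>

definition q :: nat where "q = p ^ Suc r"

definition nx :: "'a \<Rightarrow> 'a" where "nx z = (if z = x\<^sub>0 then y\<^sub>0 else x\<^sub>0)"

definition arc :: "'a \<Rightarrow> nat \<Rightarrow> ('o, 'a) base" where
  "arc z t = (if t mod q = 0 then Hub else Arc z (t mod q))"

definition rot :: "'a \<Rightarrow> ('o, 'a) base \<Rightarrow> ('o, 'a) base" where
  "rot z = cycle_of_list (map (arc z) [0..<q])"

definition numbering :: "'o \<Rightarrow> nat" where
  "numbering = (SOME h. bij_betw h Y {1..card Y})"

text \<open>The region in which the letter \<open>z\<close> is completed arbitrarily; its size
  depends on \<open>Y\<close> alone and not on \<open>q\<close>. The segment of the foreign arc has
  \<open>card Y\<close> targets for missing edges; the two further points ensure that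
  \<open>Arc (nx z) 1\<close> and \<open>Arc (nx z) 2\<close> are available for the parity swap even
  when \<open>Y\<close> is small.\<close>

definition junk :: "'a \<Rightarrow> ('o, 'a) base set" where
  "junk z = Orig ` Y \<union> Arc (nx z) ` {1..card Y + 2}"

definition points :: "('o, 'a) base set" where
  "points = Orig ` Y \<union> {Hub} \<union> {Arc x t | x t. x \<in> A \<and> t \<in> {1..<q}}"

text \<open>Tails of all \<open>z\<close>-edges that neither belong to the given action inside
  \<open>Y\<close> nor lie on the arc of \<open>z\<close>.\<close>

definition virtual :: "'a \<Rightarrow> ('o, 'a) base set" where
  "virtual z = Orig ` {a \<in> Y. \<rho> (z, True) a \<notin> Y} \<union> {Arc x t | x t. x \<in> A \<and> x \<noteq> z \<and> t \<in> {1..<q}}"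

text \<open>A missing \<open>z\<close>-edge leads to the arc of another letter, because the arc of
  \<open>z\<close> has to remain a cycle of \<open>z\<close>. These edges join the pieces to the
  bouquet.\<close>

definition prescribed :: "'a \<Rightarrow> 'o \<Rightarrow> ('o, 'a) base" where
  "prescribed z a = (if \<rho> (z, True) a \<in> Y then Orig (\<rho> (z, True) a) else Arc (nx z) (numbering a))"

definition completion :: "'a \<Rightarrow> (('o, 'a) base \<Rightarrow> ('o, 'a) base) \<Rightarrow> bool" where
  "completion z \<kappa> \<longleftrightarrow> \<kappa> permutes junk z \<and> (\<forall>a\<in>Y. \<kappa> (Orig a) = prescribed z a)"

lemma q_bounds: "p \<le> q" "2 * card Y + 2 < q" "0 < q" "1 < q"
proof -
  have "p ^ 1 \<le> q" unfolding q_def using prime_gt_0_nat[OF p(1)] by (intro power_increasing) auto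
  then show "p \<le> q" by simp
  moreover have "2 * card Y + 2 \<le> (2 * card Y + 2) * (1 + card U)" by simp
  ultimately show "2 * card Y + 2 < q" "0 < q" "1 < q" using p(2) by linarith+
qed

lemma nx: "nx z \<noteq> z" "nx z \<in> A"
  using A by (auto simp: nx_def)

lemma numbering: "bij_betw numbering Y {1..card Y}"
proof -
  have "\<exists>h. bij_betw h Y {1..card Y}" using finite_same_card_bij[OF Y(1), of "{1..card Y}"] by simp
  then show ?thesis unfolding numbering_def by (rule someI_ex)
qed

lemma finite_points: "finite points"
proof -
  have "{Arc x t | x t. x \<in> A \<and> t \<in> {1..<q}} \<subseteq> (\<lambda>(x, t). Arc x t) ` (A \<times> {1..<q})" by auto
  moreover have "finite ((\<lambda>(x, t). Arc x t) ` (A \<times> {1..<q}))" using A(1) by simp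
  ultimately have "finite {Arc x t | x t. x \<in> A \<and> t \<in> {1..<q}}" by (rule finite_subset)
  then show ?thesis unfolding points_def using Y(1) by simp
qed

lemma card_junk: "card (junk z) \<le> 2 * card Y + 2"
  and junk_sub: "junk z \<subseteq> points" and virtual_sub: "virtual z \<subseteq> points"
proof -
  have "card (junk z) \<le> card (Orig ` Y :: ('o, 'a) base set) + card (Arc (nx z) ` {1..card Y + 2} :: ('o, 'a) base set)"
    unfolding junk_def by (rule card_Un_le)
  also have "\<dots> \<le> card Y + card {1..card Y + 2}" by (intro add_mono card_image_le Y(1)) simp
  finally show "card (junk z) \<le> 2 * card Y + 2" by simp
  show "junk z \<subseteq> points" using q_bounds(2) nx by (auto simp: junk_def points_def)
  show "virtual z \<subseteq> points" by (auto simp: virtual_def points_def)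
qed

lemma completion_exists: "z \<in> A \<Longrightarrow> \<exists>\<kappa>. completion z \<kappa>"
proof -
  assume z: "z \<in> A"
  let ?f = "\<lambda>b. case b of Orig a \<Rightarrow> prescribed z a | _ \<Rightarrow> b"
  have num: "numbering a \<in> {1..card Y}" if "a \<in> Y" for a
    using that numbering by (auto simp: bij_betw_def)
  have inj: "a = a'" if "a \<in> Y" "a' \<in> Y" "prescribed z a = prescribed z a'" for a a'
  proof (cases "\<rho> (z, True) a \<in> Y")
    case True
    then have "\<rho> (z, True) a = \<rho> (z, True) a'" using that(3) by (auto simp: prescribed_def split: if_splits)
    then show ?thesis
      using letter_actionD(2)[OF \<rho>, of "(z, True)"] z that Y(2) by (metis fst_conv subsetD)
  next
    case False
    then have "numbering a = numbering a'" using that(3) by (auto simp: prescribed_def split: if_splits)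
    then show ?thesis using numbering that by (auto simp: bij_betw_def inj_on_def)
  qed
  have "\<exists>\<kappa>. \<kappa> permutes junk z \<and> (\<forall>b\<in>Orig ` Y. \<kappa> b = ?f b)"
  proof (rule injection_extends_to_permutation)
    show "inj_on ?f (Orig ` Y)" using inj by (auto simp: inj_on_def)
    show "?f ` Orig ` Y \<subseteq> junk z" using num by (fastforce simp: junk_def prescribed_def)
  qed (auto simp: junk_def Y(1))
  then show ?thesis by (auto simp: completion_def)
qed

lemma arc_0: "arc z 0 = Hub" and arc_mod: "arc z (t mod q) = arc z t"
  by (auto simp: arc_def)

lemma arc_Arc: "t \<in> {1..<q} \<Longrightarrow> Arc z t = arc z t"
  by (auto simp: arc_def)

lemma arc_points: "z \<in> A \<Longrightarrow> arc z t \<in> points"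
  using q_bounds(3) by (auto simp: arc_def points_def Suc_le_eq)

lemma arc_not_junk: "arc z t \<notin> junk z" and arc_not_virtual: "arc z t \<notin> virtual z"
  using nx(1)[of z] nx(1)[of z, symmetric] by (auto simp: arc_def junk_def virtual_def)

lemma rot_list: "distinct (map (arc z) [0..<q])" "set (map (arc z) [0..<q]) = range (arc z)"
proof -
  show "distinct (map (arc z) [0..<q])" by (auto simp: distinct_map inj_on_def arc_def split: if_splits)
  show "set (map (arc z) [0..<q]) = range (arc z)"
    using arc_mod[of z] q_bounds(3) by (auto simp: image_iff) (metis mod_less_divisor atLeastLessThan_iff zero_le)
qed

lemma rot_permutes: "rot z permutes range (arc z)"
  using cycle_permutes[of "map (arc z) [0..<q]"] rot_list(2)[of z] by (simp only: rot_def)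

lemma rot_arc: "rot z (arc z t) = arc z (Suc t)"
proof -
  let ?cs = "map (arc z) [0..<q]"
  have "map (rot z) ?cs = rotate 1 ?cs" using cyclic_rotation[OF rot_list(1), of 1 z] by (simp add: rot_def)
  then have "map (rot z) ?cs ! (t mod q) = rotate 1 ?cs ! (t mod q)" by (simp only:)
  then have "rot z (arc z (t mod q)) = arc z (Suc (t mod q) mod q)"
    using q_bounds(3) by (simp add: nth_rotate del: rotate_Suc)
  then show ?thesis by (simp add: arc_mod mod_Suc_eq)
qed

lemma rot_other: "b \<notin> range (arc z) \<Longrightarrow> rot z b = b"
  using rot_permutes by (simp add: permutes_def)

text \<open>Labels for which all non-virtual edges are equivariant: original points keep their own,
  bouquet points are labelled in \<open>Q\<close> by walking from \<open>e\<^sub>1\<close> along the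
  arc.\<close>

definition \<theta> :: "('o, 'a) base \<Rightarrow> 'o + 'q" where
  "\<theta> b = (case b of Orig a \<Rightarrow> Inl a | Hub \<Rightarrow> Inr e\<^sub>1 | Arc x t \<Rightarrow> Inr ((\<nu> (x, True) ^^ t) e\<^sub>1))"

definition \<omega> :: "'a \<times> bool \<Rightarrow> 'o + 'q \<Rightarrow> 'o + 'q" where
  "\<omega> l = map_sum (\<rho> l) (\<nu> l)"

lemma \<omega>_action: "letter_action \<omega> A (Inl ` M \<union> Inr ` Q)"
  using \<rho> Q(2) unfolding letter_action_def \<omega>_def by fastforce

lemma \<omega>_word: "foldr \<omega> w (Inl a) = Inl (foldr \<rho> w a)" "foldr \<omega> w (Inr b) = Inr (foldr \<nu> w b)"
  by (induction w) (auto simp: \<omega>_def)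

lemma \<nu>_funpow: "z \<in> A \<Longrightarrow> (\<nu> (z, True) ^^ t) e\<^sub>1 \<in> Q"
  using letter_actionD(1)[OF Q(2), of "(z, True)"] by (induction t) (auto simp: Q(1))

lemma \<theta>_arc: "z \<in> A \<Longrightarrow> \<theta> (arc z t) = Inr ((\<nu> (z, True) ^^ t) e\<^sub>1)"
  using funpow_mod_eq[OF Q(3)[of z], of t] by (auto simp: \<theta>_def arc_def q_def simp del: power_Suc)

lemma \<theta>_mem: "b \<in> points \<Longrightarrow> \<theta> b \<in> Inl ` M \<union> Inr ` Q"
  using Y(2) \<nu>_funpow Q(1) by (auto simp: points_def \<theta>_def)

end

text \<open>Kept apart from \<open>bouquet\<close> because the parity correction compares two
  completions over the same points and the same virtual edges.\<close>

locale completed_bouquet = bouquet A Y \<rho> M L x\<^sub>0 y\<^sub>0 U \<mu> e\<^sub>0 Q \<nu> e\<^sub>1 p r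
  for A :: "'a set" and Y :: "'o set" and \<rho> :: "'a \<times> bool \<Rightarrow> 'o \<Rightarrow> 'o" and M :: "'o set" and L :: nat
    and x\<^sub>0 y\<^sub>0 :: 'a and U :: "'u set" and \<mu> :: "'a \<times> bool \<Rightarrow> 'u \<Rightarrow> 'u" and e\<^sub>0 :: 'u
    and Q :: "'q set" and \<nu> :: "'a \<times> bool \<Rightarrow> 'q \<Rightarrow> 'q" and e\<^sub>1 :: 'q and p r :: nat +
  fixes \<kappa> :: "'a \<Rightarrow> ('o, 'a) base \<Rightarrow> ('o, 'a) base"
  assumes \<kappa>: "z \<in> A \<Longrightarrow> completion z (\<kappa> z)"
begin

definition \<sigma> where "\<sigma> z = \<kappa> z \<circ> rot z"

lemma \<sigma>_permutes: "z \<in> A \<Longrightarrow> \<sigma> z permutes points"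
proof -
  assume z: "z \<in> A"
  have "\<kappa> z permutes points"
    using \<kappa>[OF z] junk_sub permutes_subset unfolding completion_def by blast
  moreover have "rot z permutes points"
    using permutes_subset[OF rot_permutes] arc_points[OF z] by blast
  ultimately show "\<sigma> z permutes points" unfolding \<sigma>_def by (intro permutes_compose)
qed

lemma \<sigma>_Orig: "z \<in> A \<Longrightarrow> a \<in> Y \<Longrightarrow> \<sigma> z (Orig a) = prescribed z a"
proof -
  assume z: "z \<in> A" and a: "a \<in> Y"
  have "Orig a \<notin> range (arc z)" by (auto simp: arc_def)
  then show "\<sigma> z (Orig a) = prescribed z a"
    using \<kappa>[OF z] a rot_other[of "Orig a" z] by (simp add: \<sigma>_def completion_def)
qed

lemma \<sigma>_arc: "z \<in> A \<Longrightarrow> \<sigma> z (arc z t) = arc z (Suc t)"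
  using \<kappa>[of z] arc_not_junk[where z = z] by (auto simp: \<sigma>_def rot_arc completion_def permutes_def)

lemma \<sigma>_junk: "z \<in> A \<Longrightarrow> b \<in> junk z \<Longrightarrow> \<sigma> z b \<in> junk z"
proof -
  assume z: "z \<in> A" and b: "b \<in> junk z"
  then have "b \<notin> range (arc z)" using arc_not_junk[of z] by blast
  then show "\<sigma> z b \<in> junk z" using rot_other[of b z] \<kappa>[OF z] b by (simp add: \<sigma>_def completion_def permutes_in_image)
qed

lemma \<sigma>_loop: "z \<in> A \<Longrightarrow> b \<notin> junk z \<Longrightarrow> b \<notin> range (arc z) \<Longrightarrow> \<sigma> z b = b"
  using \<kappa>[of z] rot_other[of b z] by (simp add: \<sigma>_def completion_def permutes_def)

lemma \<theta>_equivariant: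
  assumes "z \<in> A" "b \<in> points" "b \<notin> virtual z"
  shows "\<theta> (\<sigma> z b) = \<omega> (z, True) (\<theta> b)"
proof -
  consider a where "b = Orig a" "a \<in> Y" "\<rho> (z, True) a \<in> Y" | t where "b = arc z t"
  proof (cases b)
    case (Orig a)
    then have "a \<in> Y" "\<rho> (z, True) a \<in> Y" using assms(2,3) by (auto simp: points_def virtual_def)
    then show ?thesis using Orig that(1) by blast
  next
    case Hub
    then show ?thesis using that(2)[of 0] arc_0[of z] by simp
  next
    case (Arc x t)
    then have xt: "x \<in> A" "t \<in> {1..<q}" using assms(2) by (auto simp: points_def)
    then have "x = z" using assms(3) Arc unfolding virtual_def by blast
    then show ?thesis using that(2)[of t] arc_Arc[OF xt(2), of z] Arc by simp
  qed
  then show ?thesis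
  proof cases
    case 1
    then show ?thesis using assms by (simp add: \<sigma>_Orig prescribed_def \<theta>_def \<omega>_def)
  next
    case 2
    then show ?thesis using assms by (simp add: \<sigma>_arc \<theta>_arc \<omega>_def)
  qed
qed

sublocale sub: subdivision A points virtual \<sigma> U \<mu> e\<^sub>0 L
  by unfold_locales (use virtual_sub \<sigma>_permutes finite_points U A(1) in auto)

lemma step_arc: "z \<in> A \<Longrightarrow> (sub.step (z, True) ^^ k) (Inl (arc z t)) = Inl (arc z (t + k))"
proof (induction k)
  case (Suc k)
  then show ?case using arc_not_virtual[of z "t + k"] by (simp add: sub.step_Inl \<sigma>_arc)
qed simp

text \<open>A factorial of a bound for the cycles of a letter off its own arc, so this power kills
  them; the prime \<open>p\<close> exceeds the bound, so the arc survives.\<close>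

definition N :: nat where "N = fact ((2 * card Y + 2) * (1 + card U))"

lemma N: "0 < N" "coprime N q"
proof -
  show "0 < N" by (simp add: N_def)
  have "\<not> p dvd N" unfolding N_def prime_dvd_fact_iff[OF p(1)] using p(2) by linarith
  then have "coprime p N" using prime_imp_coprime p(1) by blast
  then show "coprime N q" unfolding q_def by (simp add: coprime_commute)
qed

text \<open>Off the arc of \<open>z\<close> a point lies over a \<open>\<sigma> z\<close>-invariant
  set of base points, namely \<open>junk z\<close> or a single loop, or in a slot of another letter,
  where \<open>z\<close> moves only within the copy of \<open>U\<close>. Each such invariant set
  respects the bound in \<open>N\<close>.\<close>

lemma step_fixed:
  assumes z: "z \<in> A" and s: "s \<in> sub.space" "s \<notin> Inl ` range (arc z)"
  shows "(sub.step (z, True) ^^ N) s = s"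
proof -
  let ?g = "sub.step (z, True)"
  have "inj_on ?g sub.space"
    by (rule inj_on_inverseI[of _ "sub.step (z, False)"])
      (use letter_actionD(2)[OF sub.step_action, of "(z, True)"] z in simp)
  then have by_set: "(?g ^^ N) s = s"
    if "I \<subseteq> sub.space" "s \<in> I" "?g ` I \<subseteq> I" "card I \<le> (2 * card Y + 2) * (1 + card U)" for I
    unfolding N_def using that sub.finite_space finite_subset
    by (intro funpow_fact_fixed[of I]) (auto intro: inj_on_subset)
  \<comment> \<open>Over an invariant set \<open>K\<close> every base point carries at most one slot
    for \<open>z\<close>, whence the factor \<open>1 + card U\<close>.\<close>
  have closed: "(?g ^^ N) s = s" if K: "K \<subseteq> points" "\<And>b. b \<in> K \<Longrightarrow> \<sigma> z b \<in> K" "card K \<le> 2 * card Y + 2"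
    and sK: "(\<exists>b\<in>K. s = Inl b) \<or> (\<exists>b\<in>K. \<exists>u. s = Inr (b, z, u))" for K
  proof (rule by_set)
    let ?I = "{t \<in> sub.space. (\<exists>b\<in>K. t = Inl b) \<or> (\<exists>b\<in>K. \<exists>u. t = Inr (b, z, u))}"
    show "?I \<subseteq> sub.space" "s \<in> ?I" using s sK by auto
    have "?g t \<in> sub.space" if "t \<in> sub.space" for t
      using letter_actionD(1)[OF sub.step_action, of "(z, True)"] z that by simp
    moreover have "(\<exists>b\<in>K. ?g t = Inl b) \<or> (\<exists>b\<in>K. \<exists>u. ?g t = Inr (b, z, u))"
      if "b \<in> K" "t = Inl b \<or> t = Inr (b, z, u)" for t b u
      using that(2)
    proof
      assume t: "t = Inl b"
      show ?thesis using that(1) K(2)[OF that(1)] by (cases "b \<in> virtual z") (auto simp: t sub.step_Inl)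
    next
      assume t: "t = Inr (b, z, u)"
      show ?thesis using that(1) K(2)[OF that(1)] by (cases "u = e\<^sub>0") (auto simp: t sub.step_Inr)
    qed
    ultimately show "?g ` ?I \<subseteq> ?I" by blast
    let ?h = "\<lambda>(b, u). case u of None \<Rightarrow> Inl b | Some u \<Rightarrow> Inr (b, z, u)"
    have finK: "finite K" using K(1) finite_points finite_subset by blast
    have "?I \<subseteq> ?h ` (K \<times> insert None (Some ` U))"
    proof
      fix t assume t: "t \<in> ?I"
      then consider b where "b \<in> K" "t = Inl b" | b u where "b \<in> K" "t = Inr (b, z, u)" "u \<in> U" by auto
      then show "t \<in> ?h ` (K \<times> insert None (Some ` U))"
      proof cases
        case 1
        then show ?thesis by (intro image_eqI[of _ _ "(b, None)"]) auto
      next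
        case 2
        then show ?thesis by (intro image_eqI[of _ _ "(b, Some u)"]) auto
      qed
    qed
    then have "card ?I \<le> card (?h ` (K \<times> insert None (Some ` U)))"
      using finK U(1) by (intro card_mono) auto
    also have "\<dots> \<le> card (K \<times> insert None (Some ` U))" using finK U(1) by (intro card_image_le) auto
    also have "\<dots> = card K * (1 + card U)"
      using U(1) by (simp add: card_cartesian_product card_insert_if card_image)
    also have "\<dots> \<le> (2 * card Y + 2) * (1 + card U)" using K(3) by (rule mult_le_mono1)
    finally show "card ?I \<le> (2 * card Y + 2) * (1 + card U)" .
  qed
  have point: "(?g ^^ N) s = s" if b: "b \<in> points" "b \<notin> range (arc z)" "s = Inl b \<or> (\<exists>u. s = Inr (b, z, u))" for b
  proof (cases "b \<in> junk z")
    case True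
    show ?thesis by (rule closed[of "junk z"]) (use junk_sub \<sigma>_junk z card_junk True b in auto)
  next
    case False
    show ?thesis by (rule closed[of "{b}"]) (use \<sigma>_loop z False b in auto)
  qed
  show ?thesis
  proof (cases s)
    case (Inl b)
    then show ?thesis using s point[of b] by auto
  next
    case (Inr t)
    obtain b y u where t: "t = (b, y, u)" by (cases t)
    then have m: "y \<in> A" "b \<in> virtual y" "u \<in> U" using s Inr by auto
    show ?thesis
    proof (cases "y = z")
      case True
      then show ?thesis using point[of b] m virtual_sub arc_not_virtual[of z] Inr t by auto
    next
      case False
      let ?I = "(\<lambda>u. Inr (b, y, u)) ` U"
      show ?thesis
      proof (rule by_set)
        show "?I \<subseteq> sub.space" "s \<in> ?I" using m Inr t by auto
        show "?g ` ?I \<subseteq> ?I" using False sub.\<mu>D(1)[OF z] by (auto simp: sub.step_Inr)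
        have "card ?I \<le> card U" by (rule card_image_le[OF U(1)])
        also have "\<dots> \<le> 1 * (1 + card U)" by simp
        also have "\<dots> \<le> (2 * card Y + 2) * (1 + card U)" by (intro mult_le_mono1) simp
        finally show "card ?I \<le> (2 * card Y + 2) * (1 + card U)" .
      qed
    qed
  qed
qed

lemma transitive:
  assumes D: "D \<subseteq> sub.space" "Inl Hub \<in> D" "\<And>z. z \<in> A \<Longrightarrow> sub.step (z, True) ` D \<subseteq> D"
  shows "D = sub.space"
proof -
  define E where "E = {b \<in> points. Inl b \<in> D}"
  have E: "\<sigma> z b \<in> E" if "b \<in> E" "z \<in> A" for z b
    using sub.closed_set(1)[OF D(1,3) _ that(2), of b] that sub.\<sigma>_mem(1) by (auto simp: E_def)
  have arcE: "arc z t \<in> E" if "z \<in> A" for z t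
  proof (induction t)
    case 0
    then show ?case using D(2) by (simp add: E_def arc_0 points_def)
  next
    case (Suc t)
    then show ?case using E[OF Suc that] \<sigma>_arc[OF that] by simp
  qed
  have Eback: "b \<in> E" if "\<sigma> z b \<in> E" "z \<in> A" for z b
  proof -
    have inj: "inj (\<sigma> z)" using \<sigma>_permutes[OF that(2)] permutes_inj by blast
    have "finite E" using finite_points by (simp add: E_def)
    then have "\<sigma> z ` E = E" using E[OF _ that(2)] inj by (intro endo_inj_surj) (auto intro: inj_on_subset)
    then have "\<sigma> z b \<in> \<sigma> z ` E" using that by simp
    then show ?thesis using inj by (simp add: inj_image_mem_iff)
  qed
  \<comment> \<open>The original points not reached are closed under all letters: an edge into
    \<open>E\<close>, or out of \<open>Y\<close> and hence to an arc, would pull its tail into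
    \<open>E\<close> by backward closure. So \<open>no_closed\<close> applies.\<close>
  have orig: "{a \<in> Y. Orig a \<notin> E} = {}"
  proof (rule no_closed)
    fix z assume z: "z \<in> A"
    show "\<rho> (z, True) ` {a \<in> Y. Orig a \<notin> E} \<subseteq> {a \<in> Y. Orig a \<notin> E}"
    proof (clarify, rule ccontr)
      fix a assume a: "a \<in> Y" "Orig a \<notin> E" and neg: "\<not> (\<rho> (z, True) a \<in> Y \<and> Orig (\<rho> (z, True) a) \<notin> E)"
      have "prescribed z a \<in> E"
      proof (cases "\<rho> (z, True) a \<in> Y")
        case True
        then show ?thesis using neg by (simp add: prescribed_def)
      next
        case False
        have "numbering a \<in> {1..card Y}" using numbering a by (auto simp: bij_betw_def)
        then have "Arc (nx z) (numbering a) = arc (nx z) (numbering a)"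
          using q_bounds(2) by (intro arc_Arc) auto
        then show ?thesis using False arcE[OF nx(2)] by (simp add: prescribed_def)
      qed
      then show False using Eback[of z "Orig a"] \<sigma>_Orig[OF z a(1)] a(2) z by simp
    qed
  qed auto
  have "b \<in> E" if "b \<in> points" for b
  proof (cases b)
    case (Orig a)
    then show ?thesis using that orig by (auto simp: points_def)
  next
    case Hub
    then show ?thesis using arcE[OF A(2), of 0] by (simp add: arc_0)
  next
    case (Arc x t)
    then have xt: "x \<in> A" "t \<in> {1..<q}" using that by (auto simp: points_def)
    then show ?thesis using arcE[OF xt(1), of t] arc_Arc[OF xt(2), of x] Arc by simp
  qed
  then have all: "Inl b \<in> D" if "b \<in> points" for b using that by (simp add: E_def)
  have "Inr (b, y, u) \<in> D" if "y \<in> A" "b \<in> virtual y" "u \<in> U" for b y u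
    using sub.closed_set(2)[OF D(1,3) all that(1,2,3)] that virtual_sub by blast
  then have "sub.space \<subseteq> D" using all by (auto simp: sub.space_def)
  then show ?thesis using D(1) by blast
qed

text \<open>Through \<open>\<theta>\<close>, a short path returning to a base point yields a fixed
  point of \<open>\<omega>\<close>. At original points this is the first claim; at bouquet points it
  would be a fixed point in \<open>Q\<close>, where short reduced words have none. Slots are covered
  by \<open>slot_free\<close>.\<close>

lemma return_words:
  assumes "fst ` set w \<subseteq> A" "w \<noteq> []" "length w \<le> L"
  shows "reduced_word w \<Longrightarrow> a \<in> Y \<Longrightarrow> foldr sub.step w (Inl (Orig a)) = Inl (Orig a) \<Longrightarrow> foldr \<rho> w a = a"
    and "cyc_reduced w \<Longrightarrow> s \<in> sub.space \<Longrightarrow> s \<notin> Inl ` Orig ` Y \<Longrightarrow> foldr sub.step w s \<noteq> s"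
proof -
  have fix_real: "foldr \<omega> w (\<theta> b) = \<theta> b" if "reduced_word w" "b \<in> points" "foldr sub.step w (Inl b) = Inl b" for b
    by (rule sub.fixed_path_real[OF that(2) \<omega>_action \<theta>_mem \<theta>_equivariant assms(1) that(1) assms(3) that(3)])
  show "foldr \<rho> w a = a" if "reduced_word w" "a \<in> Y" "foldr sub.step w (Inl (Orig a)) = Inl (Orig a)"
    using fix_real[of "Orig a"] that by (simp add: points_def \<theta>_def \<omega>_word)
  show "foldr sub.step w s \<noteq> s" if "cyc_reduced w" "s \<in> sub.space" "s \<notin> Inl ` Orig ` Y"
  proof (cases "s \<in> Inl ` points")
    case False
    then show ?thesis using sub.slot_free[OF that(1) assms(2,1,3) that(2)] by simp
  next
    case True
    then obtain b where b: "s = Inl b" "b \<in> points" by blast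
    have red: "reduced_word w" using that(1) by (auto simp: cyc_reduced_def reduced_word_append)
    have "\<exists>g\<in>Q. \<theta> b = Inr g" using b that(3) Q(1) \<nu>_funpow by (auto simp: points_def \<theta>_def)
    then obtain g where g: "g \<in> Q" "\<theta> b = Inr g" by blast
    have "foldr \<nu> w g \<noteq> g" using Q(4)[OF assms(1) red assms(2,3) g(1)] .
    then show ?thesis using fix_real[OF red b(2)] g(2) b(1) by (auto simp: \<omega>_word)
  qed
qed

end

section \<open>Transport to permutations of an initial segment, and parity\<close>

definition transport :: "'s set \<Rightarrow> ('s \<Rightarrow> 'x) \<Rightarrow> ('s \<Rightarrow> 's) \<Rightarrow> 'x \<Rightarrow> 'x" where
  "transport S e g i = (if i \<in> e ` S then e (g (the_inv_into S e i)) else i)"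

lemma transport_apply: "inj_on e S \<Longrightarrow> s \<in> S \<Longrightarrow> transport S e g (e s) = e (g s)"
  by (simp add: transport_def the_inv_into_f_f)

lemma transport_permutes:
  assumes "inj_on e S" "bij_betw g S S"
  shows "transport S e g permutes e ` S"
proof (rule bij_imp_permutes)
  have "bij_betw (e \<circ> g \<circ> the_inv_into S e) (e ` S) (e ` S)"
    using assms by (intro bij_betw_trans[of "the_inv_into S e" _ S] bij_betw_trans[of g S S])
      (auto intro: bij_betw_the_inv_into simp: bij_betw_def[of e])
  then show "bij_betw (transport S e g) (e ` S) (e ` S)"
    by (subst bij_betw_cong[of _ _ "e \<circ> g \<circ> the_inv_into S e"]) (auto simp: transport_def)
qed (simp add: transport_def)

lemma transport_transpose:
  assumes "inj_on e S" "a \<in> S" "b \<in> S"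
  shows "transport S e (g \<circ> transpose a b) = transport S e g \<circ> transpose (e a) (e b)"
proof
  fix i
  show "transport S e (g \<circ> transpose a b) i = (transport S e g \<circ> transpose (e a) (e b)) i"
  proof (cases "i \<in> e ` S")
    case True
    then obtain s where s: "s \<in> S" "i = e s" by blast
    have "transpose (e a) (e b) (e s) = e (transpose a b s)"
      using assms s by (auto simp: transpose_def inj_on_eq_iff)
    moreover have "transpose a b s \<in> S" using assms s by (auto simp: transpose_def)
    ultimately show ?thesis using s by (simp add: transport_apply[OF assms(1)])
  next
    case False
    then have "transpose (e a) (e b) i = i" using assms by (auto simp: transpose_def)
    then show ?thesis using False by (simp add: transport_def)
  qed
qed

definition letter_perm :: "('a \<Rightarrow> 'x \<Rightarrow> 'x) \<Rightarrow> 'a \<times> bool \<Rightarrow> 'x \<Rightarrow> 'x" where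
  "letter_perm \<pi> l = (if snd l then \<pi> (fst l) else inv' (\<pi> (fst l)))"

lemma letter_perm_transport:
  assumes "inj_on e S" "letter_action st A S" "\<And>z. z \<in> A \<Longrightarrow> \<pi> z = transport S e (st (z, True))"
    and "fst ` set w \<subseteq> A" "s \<in> S"
  shows "foldr (letter_perm \<pi>) w (e s) = e (foldr st w s)"
  using assms(4)
proof (induction w)
  case (Cons l w)
  let ?t = "foldr st w s"
  have l: "fst l \<in> A" and t: "?t \<in> S" and IH: "foldr (letter_perm \<pi>) w (e s) = e ?t"
    using Cons word_closed[OF assms(2) _ assms(5), of w] by auto
  have "letter_perm \<pi> l (e ?t) = e (st l ?t)"
  proof (cases "snd l")
    case True
    then show ?thesis using l t assms(1,3) by (cases l) (simp add: letter_perm_def transport_apply)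
  next
    case False
    let ?g = "st (fst l, True)"
    have act: "st l ?t \<in> S" "?g (st l ?t) = ?t"
      using letter_actionD(1,2)[OF assms(2) l t] False by (auto simp: linv_def)
    have "bij_betw ?g S S"
    proof (rule bij_betw_byWitness[of _ "st (fst l, False)"])
    qed (use letter_actionD[OF assms(2), of "(fst l, True)"] letter_actionD[OF assms(2), of "(fst l, False)"] l in auto)
    then have "bij (\<pi> (fst l))"
      using transport_permutes[OF assms(1)] assms(3)[OF l] permutes_bij by metis
    moreover have "\<pi> (fst l) (e (st l ?t)) = e ?t"
      using assms(3)[OF l] act transport_apply[OF assms(1)] by simp
    ultimately show ?thesis using False by (metis letter_perm_def bij_inv_eq_iff)
  qed
  then show ?case using IH by simp
qed simp

lemma (in bouquet) points_simps [simp]: "Hub \<in> points" "Orig a \<in> points \<longleftrightarrow> a \<in> Y"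
  by (auto simp: points_def)

context completed_bouquet
begin

lemma step_bij: "z \<in> A \<Longrightarrow> bij_betw (sub.step (z, True)) sub.space sub.space"
  by (rule bij_betw_byWitness[of _ "sub.step (z, False)"])
    (use letter_actionD[OF sub.step_action, of "(z, True)"] letter_actionD[OF sub.step_action, of "(z, False)"] in auto)

lemma transported_alternating:
  assumes e: "bij_betw e sub.space {1..m}" and G: "subgroup G (sym_group m)"
    and \<pi>: "\<And>z. z \<in> A \<Longrightarrow> \<pi> z = transport sub.space e (sub.step (z, True))" "\<pi> ` A \<subseteq> G"
  shows "carrier (alt_group m) \<subseteq> G"
proof -
  have inj: "inj_on e sub.space" and im: "e ` sub.space = {1..m}" using e by (auto simp: bij_betw_def)
  interpret G: perm_closed G by (rule subgroup_perm_closed[OF G])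
  let ?st = "\<lambda>z. sub.step (z, True)"
  have st_space: "(?st z ^^ k) s \<in> sub.space" if "z \<in> A" "s \<in> sub.space" for z k s
    by (induction k) (use that letter_actionD(1)[OF sub.step_action, of "(z, True)"] in auto)
  have pow: "(\<pi> z ^^ k) (e s) = e ((?st z ^^ k) s)" if "z \<in> A" "s \<in> sub.space" for z k s
    by (induction k) (use that st_space in \<open>auto simp: \<pi>(1) transport_apply[OF inj]\<close>)
  have perm: "\<pi> z permutes {1..m}" if "z \<in> A" for z
    using transport_permutes[OF inj step_bij[OF that]] \<pi>(1)[OF that] im by simp
  have hub: "Inl Hub \<in> sub.space" by simp
  have st_hub: "(?st z ^^ k) (Inl Hub) = Inl (arc z k)" if "z \<in> A" for z k
    using step_arc[OF that, of k 0] by (simp add: arc_0)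
  have e_eq: "e s = e t \<longleftrightarrow> s = t" if "s \<in> sub.space" "t \<in> sub.space" for s t
    using inj_on_eq_iff[OF inj that] .
  have arc_space: "Inl (arc z t) \<in> sub.space" if "z \<in> A" for z t using arc_points[OF that] by simp
  have moved: "\<exists>t. v = e (Inl (arc z t))" if "z \<in> A" "(\<pi> z ^^ N) v \<noteq> v" for z v
  proof -
    have "v \<in> {1..m}" using that permutes_funpow[OF perm[OF that(1)], of N] by (metis permutes_not_in)
    then obtain s where s: "s \<in> sub.space" "v = e s" using im by blast
    then have "(?st z ^^ N) s \<noteq> s" using that(2) pow[OF that(1) s(1), of N] by auto
    then have "s \<in> Inl ` range (arc z)" using step_fixed[OF that(1) s(1)] by blast
    then show ?thesis using s by blast
  qed
  have "G.full {1..m}"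
  proof (rule G.full_transitive[where v\<^sub>0 = "e (Inl Hub)" and N = N and A = A and \<pi> = \<pi> and a = x\<^sub>0 and b = y\<^sub>0])
    show "e (Inl Hub) \<in> {1..m}" using hub im by blast
    show "\<pi> z permutes {1..m}" if "z \<in> A" for z by (rule perm[OF that])
    show "\<pi> z \<in> G" if "z \<in> A" for z using that \<pi>(2) by blast
    show "(\<pi> z ^^ N) (e (Inl Hub)) \<noteq> e (Inl Hub)" if z: "z \<in> A" for z
    proof -
      have "\<not> q dvd N" using N(2) q_bounds(4) coprime_common_divisor[of N q q] by auto
      then have "arc z N \<noteq> Hub" by (auto simp: arc_def mod_eq_0_iff_dvd)
      then show ?thesis using pow[OF z hub] st_hub[OF z] e_eq[OF arc_space[OF z] hub] by simp
    qed
    show "v = e (Inl Hub)" if yz: "y \<in> A" "z \<in> A" "y \<noteq> z" "(\<pi> y ^^ N) v \<noteq> v" "(\<pi> z ^^ N) v \<noteq> v" for y z v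
    proof -
      obtain i j where ij: "v = e (Inl (arc y i))" "v = e (Inl (arc z j))"
        using moved[OF yz(1,4)] moved[OF yz(2,5)] by blast
      have "e (Inl (arc y i)) = e (Inl (arc z j))" using trans[OF ij(1)[symmetric] ij(2)] .
      then have "arc y i = arc z j" using e_eq[OF arc_space[OF yz(1)] arc_space[OF yz(2)]] by simp
      then have "arc y i = Hub" using yz(3) by (auto simp: arc_def split: if_splits)
      then show ?thesis using ij by simp
    qed
    show "\<exists>t. ((\<pi> z ^^ N) ^^ t) (e (Inl Hub)) = \<pi> z (e (Inl Hub))" if z: "z \<in> A" for z
    proof -
      \<comment> \<open>\<open>t\<close> inverts \<open>N\<close> modulo \<open>q\<close>, so the
        \<open>t\<close>-th power of \<open>\<pi> z ^^ N\<close> agrees with \<open>\<pi> z\<close>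
        at the hub.\<close>
      obtain t y where "N * t = q * y + gcd N q" using bezout_nat[of N q] N(1) by auto
      then have "N * t = 1 + q * y" using N(2) by simp
      then have "N * t mod q = 1 mod q" by (simp only: mod_mult_self2)
      then have "arc z (N * t) = arc z 1" using arc_mod[of z "N * t"] arc_mod[of z 1] by simp
      then have "((\<pi> z ^^ N) ^^ t) (e (Inl Hub)) = (\<pi> z ^^ 1) (e (Inl Hub))"
        by (simp only: funpow_mult pow[OF z hub] st_hub[OF z])
      then show ?thesis by auto
    qed
    show "D = {1..m}" if D: "D \<subseteq> {1..m}" "e (Inl Hub) \<in> D" "\<And>z. z \<in> A \<Longrightarrow> \<pi> z ` D \<subseteq> D" for D
    proof -
      let ?D = "{s \<in> sub.space. e s \<in> D}"
      have "?D = sub.space"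
      proof (rule transitive)
        show "Inl Hub \<in> ?D" using hub D(2) by simp
        fix z assume z: "z \<in> A"
        show "?st z ` ?D \<subseteq> ?D"
          using D(3)[OF z] st_space[OF z, of _ 1] \<pi>(1)[OF z] transport_apply[OF inj] by fastforce
      qed blast
      then have "e ` sub.space \<subseteq> D" by blast
      then show ?thesis using D(1) im by blast
    qed
  qed (use A N(1) in auto)
  then show ?thesis using alt_group_subset[OF G] by blast
qed

end

text \<open>Both points lie in \<open>junk z\<close> but carry no prescribed value, so the result is
  again a completion. They avoid the arc of \<open>z\<close>, so the swap commutes with
  \<open>rot z\<close>; and they are tails of virtual edges, as \<open>sub_fwd_transpose\<close>
  demands.\<close>

lemma (in bouquet) completion_flip:
  assumes "completion z \<kappa>"
  defines "c \<equiv> Arc (nx z) 1" and "c' \<equiv> Arc (nx z) 2"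
  shows "completion z (\<kappa> \<circ> transpose c c')" "c \<in> virtual z" "c' \<in> virtual z"
    "(\<kappa> \<circ> transpose c c') \<circ> rot z = (\<kappa> \<circ> rot z) \<circ> transpose c c'"
proof -
  have c: "c \<in> junk z" "c' \<in> junk z" by (auto simp: c_def c'_def junk_def)
  have "(\<kappa> \<circ> transpose c c') (Orig a) = \<kappa> (Orig a)" for a by (simp add: c_def c'_def transpose_def)
  then show "completion z (\<kappa> \<circ> transpose c c')"
    using assms(1) permutes_compose[OF permutes_swap_id[OF c]] unfolding completion_def by auto
  show "c \<in> virtual z" "c' \<in> virtual z"
    using nx[of z] q_bounds(2) by (auto simp: c_def c'_def virtual_def)
  have cr: "c \<notin> range (arc z)" "c' \<notin> range (arc z)" using c arc_not_junk[of z] by blast+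
  have "transpose c c' (rot z b) = rot z (transpose c c' b)" for b
  proof (cases "b \<in> range (arc z)")
    case True
    then have "rot z b \<in> range (arc z)" using permutes_in_image[OF rot_permutes] by blast
    then have "rot z b \<noteq> c" "rot z b \<noteq> c'" "b \<noteq> c" "b \<noteq> c'" using True cr by auto
    then show ?thesis by (simp add: transpose_def)
  next
    case False
    moreover have "transpose c c' b \<in> {b, c, c'}" by (simp add: transpose_def)
    ultimately have "transpose c c' b \<notin> range (arc z)" using cr by auto
    then show ?thesis using False rot_other[of b z] rot_other[of "transpose c c' b" z] by simp
  qed
  then show "(\<kappa> \<circ> transpose c c') \<circ> rot z = (\<kappa> \<circ> rot z) \<circ> transpose c c'" by (auto simp: fun_eq_iff)
qed

lemma finite_model:
  fixes A :: "'a set" and Y :: "'o set" and \<rho> :: "'a \<times> bool \<Rightarrow> 'o \<Rightarrow> 'o" and L :: nat and ev :: bool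
  assumes A: "finite A" "x\<^sub>0 \<in> A" "y\<^sub>0 \<in> A" "x\<^sub>0 \<noteq> y\<^sub>0"
    and \<rho>: "letter_action \<rho> A M" and Y: "finite Y" "Y \<subseteq> M"
    and no_closed: "\<forall>Z\<subseteq>Y. (\<forall>z\<in>A. \<rho> (z, True) ` Z \<subseteq> Z) \<longrightarrow> Z = {}"
  shows "\<exists>m \<pi> \<iota>. (\<forall>z\<in>A. \<pi> z \<in> carrier (sym_group m) \<and> (evenperm (\<pi> z) \<longleftrightarrow> ev)) \<and> \<iota> ` Y \<subseteq> {1..m} \<and>
    (\<forall>z\<in>A. \<forall>a\<in>Y. \<rho> (z, True) a \<in> Y \<longrightarrow> \<pi> z (\<iota> a) = \<iota> (\<rho> (z, True) a)) \<and>
    (\<forall>G. subgroup G (sym_group m) \<longrightarrow> \<pi> ` A \<subseteq> G \<longrightarrow> carrier (alt_group m) \<subseteq> G) \<and>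
    (\<forall>w. fst ` set w \<subseteq> A \<longrightarrow> w \<noteq> [] \<longrightarrow> length w \<le> L \<longrightarrow>
      (reduced_word w \<longrightarrow> (\<forall>a\<in>Y. foldr (letter_perm \<pi>) w (\<iota> a) = \<iota> a \<longrightarrow> foldr \<rho> w a = a)) \<and>
      (cyc_reduced w \<longrightarrow> (\<forall>v\<in>{1..m} - \<iota> ` Y. foldr (letter_perm \<pi>) w v \<noteq> v)))"
proof -
  define W where "W = {w :: ('a \<times> bool) list. fst ` set w \<subseteq> A \<and> reduced_word w \<and> w \<noteq> [] \<and> length w \<le> L}"
  have "W \<subseteq> {w. set w \<subseteq> A \<times> UNIV \<and> length w \<le> L}" by (auto simp: W_def)
  moreover have "finite {w :: ('a \<times> bool) list. set w \<subseteq> A \<times> UNIV \<and> length w \<le> L}"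
    using A(1) by (intro finite_lists_length_le) auto
  ultimately have W: "finite W" by (rule finite_subset)
  have Wp: "w \<in> W \<Longrightarrow> reduced_word w \<and> w \<noteq> [] \<and> fst ` set w \<subseteq> A" for w by (simp add: W_def)
  \<comment> \<open>The prime \<open>2\<close> is an arbitrary choice; \<open>U\<close> contributes
    its girth and its connectedness.\<close>
  obtain U :: "((nat \<Rightarrow> int) \<Rightarrow> nat \<Rightarrow> int) set" and \<mu> and n\<^sub>0 and e\<^sub>0 where "free_model A W (2 ^ Suc n\<^sub>0) U \<mu> e\<^sub>0"
    using residually_p_regular[OF order_refl W Wp] by auto
  note U = free_modelD[OF this]
  \<comment> \<open>Chosen after \<open>U\<close>, because the slots lengthen the cycles that
    \<open>N\<close> has to kill.\<close>
  obtain p where p: "Factorial_Ring.prime p" "(2 * card Y + 2) * (1 + card U) < p"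
    using bigger_prime by auto
  obtain Q :: "((nat \<Rightarrow> int) \<Rightarrow> nat \<Rightarrow> int) set" and \<nu> and r and e\<^sub>1 where "free_model A W (p ^ Suc r) Q \<nu> e\<^sub>1"
    using residually_p_regular[OF prime_ge_2_nat[OF p(1)] W Wp] by auto
  note Q = free_modelD[OF this]
  have exp: "(\<nu> (z, True) ^^ (p ^ Suc r)) e\<^sub>1 = e\<^sub>1" if "z \<in> A" for z
    using Q(4)[of "[(z, True)]" e\<^sub>1] Q(2) that by (simp del: power_Suc)
  interpret b: bouquet A Y \<rho> M L x\<^sub>0 y\<^sub>0 U \<mu> e\<^sub>0 Q \<nu> e\<^sub>1 p r
  proof
    show "foldr \<mu> w u \<noteq> u" if "fst ` set w \<subseteq> A" "reduced_word w" "w \<noteq> []" "length w \<le> L" "u \<in> U" for w u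
      using U(5) that by (simp add: W_def)
    show "foldr \<nu> w u \<noteq> u" if "fst ` set w \<subseteq> A" "reduced_word w" "w \<noteq> []" "length w \<le> L" "u \<in> Q" for w u
      using Q(5) that by (simp add: W_def)
    show "Z = {}" if "Z \<subseteq> Y" "\<And>z. z \<in> A \<Longrightarrow> \<rho> (z, True) ` Z \<subseteq> Z" for Z
    proof -
      have "\<forall>z\<in>A. \<rho> (z, True) ` Z \<subseteq> Z" using that(2) by (rule ballI)
      then show ?thesis using no_closed that(1) by simp
    qed
  qed (fact A \<rho> Y U Q exp p)+
  obtain \<kappa>0 where \<kappa>0: "\<And>z. z \<in> A \<Longrightarrow> b.completion z (\<kappa>0 z)" using bchoice[of A b.completion] b.completion_exists by blast
  interpret c0: completed_bouquet A Y \<rho> M L x\<^sub>0 y\<^sub>0 U \<mu> e\<^sub>0 Q \<nu> e\<^sub>1 p r \<kappa>0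
    by unfold_locales (rule \<kappa>0)
  \<comment> \<open>The point set depends on the virtual edges and on \<open>U\<close> but not on
    the completion, so one numbering \<open>e\<close> serves before and after the parity
    correction.\<close>
  define S where "S = c0.sub.space"
  define m where "m = card S"
  have "finite S" using c0.sub.finite_space by (simp add: S_def)
  then obtain e where e: "bij_betw e S {1..m}"
    using finite_same_card_bij[of S "{1..m}"] unfolding m_def by fastforce
  then have inj: "inj_on e S" and im: "e ` S = {1..m}" by (auto simp: bij_betw_def)
  define flip where "flip z = transpose (Arc (b.nx z) 1 :: ('o, 'a) base) (Arc (b.nx z) 2)" for z
  \<comment> \<open>Parity is measured on the initial completion and corrected separately for each
    letter, since changing the value at \<open>z\<close> leaves the other letters alone.\<close>
  define \<kappa> where "\<kappa> z = (if evenperm (transport S e (c0.sub.step (z, True))) = ev then \<kappa>0 z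
    else \<kappa>0 z \<circ> flip z)" for z
  interpret c: completed_bouquet A Y \<rho> M L x\<^sub>0 y\<^sub>0 U \<mu> e\<^sub>0 Q \<nu> e\<^sub>1 p r \<kappa>
    by unfold_locales (use \<kappa>0 b.completion_flip(1) in \<open>auto simp: \<kappa>_def flip_def\<close>)
  have S: "c.sub.space = S" by (simp add: S_def)
  define \<pi> where "\<pi> z = transport S e (c.sub.step (z, True))" for z
  define \<iota> where "\<iota> a = e (Inl (Orig a))" for a
  have perm: "\<pi> z permutes {1..m}" if "z \<in> A" for z
    using transport_permutes[OF inj] c.step_bij[OF that] by (simp add: S im \<pi>_def)
  have par: "evenperm (\<pi> z) \<longleftrightarrow> ev" if z: "z \<in> A" for z
  proof (cases "evenperm (transport S e (c0.sub.step (z, True))) = ev")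
    case True
    then show ?thesis by (simp add: \<pi>_def c0.sub.step_def c.sub.step_def c0.\<sigma>_def c.\<sigma>_def \<kappa>_def)
  next
    case False
    let ?c = "Arc (b.nx z) 1" and ?c' = "Arc (b.nx z) 2"
    note flip = b.completion_flip[OF \<kappa>0[OF z]]
    have "c.\<sigma> z = c0.\<sigma> z \<circ> transpose ?c ?c'"
      using flip(4) False by (simp add: c0.\<sigma>_def c.\<sigma>_def \<kappa>_def flip_def)
    then have "c.sub.step (z, True) = c0.sub.step (z, True) \<circ> transpose (Inr (?c, z, e\<^sub>0)) (Inr (?c', z, e\<^sub>0))"
      using sub_fwd_transpose[OF flip(2,3)] by (simp add: c0.sub.step_def c.sub.step_def)
    moreover have cS: "Inr (?c, z, e\<^sub>0) \<in> S" "Inr (?c', z, e\<^sub>0) \<in> S"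
      using flip(2,3) z U(2) by (auto simp: S_def)
    ultimately have "\<pi> z = transport S e (c0.sub.step (z, True)) \<circ> transpose (e (Inr (?c, z, e\<^sub>0))) (e (Inr (?c', z, e\<^sub>0)))"
      using transport_transpose[OF inj] by (simp add: \<pi>_def)
    moreover have "e (Inr (?c, z, e\<^sub>0)) \<noteq> e (Inr (?c', z, e\<^sub>0))"
      using inj_on_eq_iff[OF inj cS] by simp
    moreover have "permutation (transport S e (c0.sub.step (z, True)))"
      using transport_permutes[OF inj] c0.step_bij[OF z] im unfolding permutation_permutes S_def
      by (metis finite_atLeastAtMost)
    ultimately show ?thesis
      using False by (simp add: evenperm_comp permutation_swap_id evenperm_swap)
  qed
  have act: "letter_action c.sub.step A S" using c.sub.step_action by (simp add: S)
  have word: "foldr (letter_perm \<pi>) w (e s) = e (foldr c.sub.step w s)" if "fst ` set w \<subseteq> A" "s \<in> S" for w s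
    by (rule letter_perm_transport[OF inj act _ that]) (simp add: \<pi>_def)
  have OS: "Inl (Orig a) \<in> S" if "a \<in> Y" for a
    using that by (simp flip: S)
  show ?thesis
  proof (intro exI[of _ m] exI[of _ \<pi>] exI[of _ \<iota>] conjI ballI allI impI)
    show "\<pi> z \<in> carrier (sym_group m)" if "z \<in> A" for z using perm[OF that] by (simp add: sym_group_carrier)
    show "evenperm (\<pi> z) = ev" if "z \<in> A" for z by (rule par[OF that])
    show "\<iota> ` Y \<subseteq> {1..m}" using OS im by (auto simp: \<iota>_def)
    show "\<pi> z (\<iota> a) = \<iota> (\<rho> (z, True) a)" if "z \<in> A" "a \<in> Y" "\<rho> (z, True) a \<in> Y" for z a
    proof -
      have "Orig a \<notin> b.virtual z" using that by (auto simp: b.virtual_def)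
      then have "c.sub.step (z, True) (Inl (Orig a)) = Inl (Orig (\<rho> (z, True) a))"
        using that by (simp add: c.sub.step_Inl c.\<sigma>_Orig b.prescribed_def)
      then show ?thesis using transport_apply[OF inj OS[OF that(2)]] by (simp add: \<pi>_def \<iota>_def)
    qed
    show "carrier (alt_group m) \<subseteq> G" if "subgroup G (sym_group m)" "\<pi> ` A \<subseteq> G" for G
      by (rule c.transported_alternating[OF _ that(1) _ that(2)]) (use e in \<open>auto simp: S \<pi>_def\<close>)
    fix w :: "('a \<times> bool) list" assume w: "fst ` set w \<subseteq> A" "w \<noteq> []" "length w \<le> L"
    show "foldr \<rho> w a = a" if "reduced_word w" "a \<in> Y" "foldr (letter_perm \<pi>) w (\<iota> a) = \<iota> a" for a
    proof -
      have "foldr c.sub.step w (Inl (Orig a)) \<in> S" using word_closed[OF act w(1) OS[OF that(2)]] .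
      then have "foldr c.sub.step w (Inl (Orig a)) = Inl (Orig a)"
        using that(3) word[OF w(1) OS[OF that(2)]] inj_on_eq_iff[OF inj _ OS[OF that(2)]] by (simp add: \<iota>_def)
      then show ?thesis using c.return_words(1)[OF w that(1,2)] by simp
    qed
    show "foldr (letter_perm \<pi>) w v \<noteq> v" if v: "cyc_reduced w" "v \<in> {1..m} - \<iota> ` Y" for v
    proof -
      obtain s where s: "s \<in> S" "v = e s" using v(2) im by blast
      then have "s \<notin> Inl ` Orig ` Y" using v(2) by (auto simp: \<iota>_def)
      then have "foldr c.sub.step w s \<noteq> s" using c.return_words(2)[OF w v(1)] s(1) S by simp
      moreover have "foldr c.sub.step w s \<in> S" using word_closed[OF act w(1) s(1)] .
      ultimately show ?thesis using word[OF w(1) s(1)] s inj_on_eq_iff[OF inj] by simp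
    qed
  qed
qed

subsection \<open>Separating subgroups\<close>

lemma coprime_fixed:
  assumes "(f ^^ a) c = c" "(f ^^ b) c = c" "coprime a b" "a \<noteq> 0"
  shows "f c = c"
proof -
  have mult: "(f ^^ (n * t)) c = c" if "(f ^^ n) c = c" for n t
  proof (induction t)
    case (Suc t)
    then show ?case using that by (simp add: funpow_add)
  qed simp
  obtain x y where "a * x = b * y + gcd a b" using bezout_nat[OF assms(4)] by blast
  then have "a * x = 1 + b * y" using assms(3) by simp
  then have "(f ^^ (a * x)) c = f ((f ^^ (b * y)) c)" by simp
  then show ?thesis using mult[OF assms(1)] mult[OF assms(2)] by simp
qed

text \<open>If \<open>c\<close> has a period \<open>t\<close>, a prime above \<open>t\<close> is
  coprime to it, and Bezout would turn a fixed prime power into \<open>f c = c\<close>. All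
  exponents \<open>a\<close> are treated at once because the exponent is fixed only after the
  prime.\<close>

lemma prime_power_moves:
  assumes "f c \<noteq> c"
  shows "\<exists>N. \<forall>p>N. Factorial_Ring.prime p \<longrightarrow> (\<forall>a. (f ^^ (p ^ a)) c \<noteq> c)"
proof (cases "\<exists>t>0. (f ^^ t) c = c")
  case True
  then obtain t where t: "t > 0" "(f ^^ t) c = c" by blast
  have "(f ^^ (p ^ a)) c \<noteq> c" if p: "p > t" "Factorial_Ring.prime p" for p a
  proof
    assume "(f ^^ (p ^ a)) c = c"
    moreover have "\<not> p dvd t" using p(1) t(1) nat_dvd_not_less by blast
    then have "coprime p t" using prime_imp_coprime p(2) by blast
    then have "coprime t (p ^ a)" by (simp add: coprime_commute)
    ultimately show False using coprime_fixed[OF t(2)] t(1) assms by blast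
  qed
  then show ?thesis by blast
next
  case False
  have "(f ^^ (p ^ a)) c \<noteq> c" if "Factorial_Ring.prime p" for p a
  proof -
    have "p ^ a > 0" using prime_gt_0_nat[OF that] by simp
    then show ?thesis using False by blast
  qed
  then show ?thesis by blast
qed

definition coset_action :: "('a, 'b) monoid_scheme \<Rightarrow> 'a \<times> bool \<Rightarrow> 'a set \<Rightarrow> 'a set" where
  "coset_action G l c = letter_val G l <#\<^bsub>G\<^esub> c"

context group
begin

lemma coset_word:
  "fst ` set w \<subseteq> carrier G \<Longrightarrow> c \<subseteq> carrier G \<Longrightarrow> foldr (coset_action G) w c = word_val G w <# c"
proof (induction w)
  case Nil
  then show ?case by (simp add: word_val_simps lcos_mult_one)
next
  case (Cons l w)
  then show ?case
    by (simp add: word_val_simps coset_action_def lcos_m_assoc letter_val_closed word_val_closed)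
qed

lemma coset_letter_action: "letter_action (coset_action G) (carrier G) (Pow (carrier G))"
  unfolding letter_action_def
proof (intro allI impI ballI conjI)
  fix l :: "'a \<times> bool" and c assume l: "fst l \<in> carrier G" and c: "c \<in> Pow (carrier G)"
  show "coset_action G l c \<in> Pow (carrier G)"
    using l_coset_subset_G[of c "letter_val G l"] c letter_val_closed[OF l] by (simp add: coset_action_def)
  show "coset_action G (linv l) (coset_action G l c) = c"
    using c l letter_val_closed[OF l]
    by (simp add: coset_action_def lcos_m_assoc letter_val_linv lcos_mult_one)
qed

lemma lcoset_eqD:
  assumes "subgroup K G" "x \<in> carrier G" "h \<in> carrier G" "h <# (x <# K) = x <# K"
  shows "\<exists>k\<in>K. h \<otimes> x = x \<otimes> k"
proof -
  have K: "K \<subseteq> carrier G" "\<one> \<in> K" using assms(1) by (auto simp: subgroup.subset subgroup.one_closed)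
  have "h \<otimes> x \<otimes> \<one> \<in> (h \<otimes> x) <# K" using K(2) unfolding l_coset_def by blast
  then have "h \<otimes> x \<in> x <# K" using assms K by (simp add: lcos_m_assoc)
  then show ?thesis unfolding l_coset_def by blast
qed

end

text \<open>Finite orbits of cosets would force finite index; when \<open>A\<close> is a proper subset of the basis, the spare
  letter \<open>y\<close>, no power of which is conjugate into \<open>K\<close>, already has infinite orbits.\<close>
lemma no_finite_coset_orbit:
  assumes fb: "free_basis F B" and A: "A' \<subseteq> A" "A \<subseteq> B" "A = B \<or> (\<exists>y. y \<in> A \<and> y \<notin> A')"
    and K: "subgroup K F" "K \<subseteq> generate F A'" "infinite (rcosets\<^bsub>F\<^esub> K)"
    and Z: "finite Z" "\<And>c. c \<in> Z \<Longrightarrow> \<exists>x\<in>carrier F. c = x <#\<^bsub>F\<^esub> K"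
      "\<And>z c. z \<in> A \<Longrightarrow> c \<in> Z \<Longrightarrow> coset_action F (z, True) c \<in> Z"
  shows "Z = {}"
proof (rule ccontr)
  assume "Z \<noteq> {}"
  note fbD = free_basisD[OF fb]
  interpret group F by (rule fbD)
  have Kc: "K \<subseteq> carrier F" using K(1) by (rule subgroup.subset)
  have Zc: "Z \<subseteq> Pow (carrier F)" using Z(2) l_coset_subset_G[OF Kc] by blast
  have Ac: "A \<subseteq> carrier F" using A fbD(2) by blast
  note act = letter_action_mono[OF coset_letter_action Ac]
  have actZ: "letter_action (coset_action F) A Z"
    unfolding letter_action_def
  proof (intro allI impI ballI conjI)
    fix l :: "'a \<times> bool" and c assume l: "fst l \<in> A" and c: "c \<in> Z"
    show "coset_action F (linv l) (coset_action F l c) = c" using letter_actionD(2)[OF act l] c Zc by blast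
    \<comment> \<open>For inverse letters: an injection of the finite set \<open>Z\<close> into
      itself is onto, so \<open>c\<close> has a preimage in \<open>Z\<close>.\<close>
    let ?t = "coset_action F (fst l, True)"
    have inj: "inj_on ?t Z"
      by (rule inj_on_inverseI[of _ "coset_action F (fst l, False)"])
        (use letter_actionD(2)[OF act, of "(fst l, True)"] l Zc in auto)
    have "?t ` Z \<subseteq> Z" using Z(3)[OF l] by blast
    then have surj: "?t ` Z = Z" using Z(1) inj by (intro endo_inj_surj)
    show "coset_action F l c \<in> Z"
    proof (cases "snd l")
      case True
      then show ?thesis using Z(3)[OF l c] by (cases l) auto
    next
      case False
      have "c \<in> ?t ` Z" using c surj by simp
      then obtain d where d: "c = ?t d" "d \<in> Z" by blast
      then have "coset_action F (fst l, False) c = d"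
        using letter_actionD(2)[OF act, of "(fst l, True)" d] l Zc by auto
      then show ?thesis using d(2) False by (cases l) auto
    qed
  qed
  obtain c x where c: "c \<in> Z" "x \<in> carrier F" "c = x <#\<^bsub>F\<^esub> K" using \<open>Z \<noteq> {}\<close> Z(2) by blast
  have cc: "c \<subseteq> carrier F" using c(1) Zc by blast
  show False
  proof (cases "A = B")
    case True
    have all: "g <#\<^bsub>F\<^esub> K \<in> Z" if g: "g \<in> carrier F" for g
    proof -
      have "g \<otimes>\<^bsub>F\<^esub> inv\<^bsub>F\<^esub> x \<in> carrier F" using g c(2) by simp
      then obtain w where w: "fst ` set w \<subseteq> B" "word_val F w = g \<otimes>\<^bsub>F\<^esub> inv\<^bsub>F\<^esub> x" using fbD(3) by blast
      have "foldr (coset_action F) w c \<in> Z" using word_closed[OF actZ _ c(1)] w(1) True by simp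
      moreover have "foldr (coset_action F) w c = word_val F w <#\<^bsub>F\<^esub> c"
        using w(1) fbD(2) cc by (intro coset_word) blast+
      moreover have "word_val F w <#\<^bsub>F\<^esub> c = g <#\<^bsub>F\<^esub> K"
        using g c Kc w(2) by (simp add: lcos_m_assoc m_assoc)
      ultimately show ?thesis by simp
    qed
    \<comment> \<open>The index counts right cosets while the action is on left ones; inversion
      exchanges them.\<close>
    have "rcosets\<^bsub>F\<^esub> K \<subseteq> (\<lambda>c. m_inv F ` c) ` Z"
    proof
      fix d assume "d \<in> rcosets\<^bsub>F\<^esub> K"
      then obtain a where a: "a \<in> carrier F" "d = K #>\<^bsub>F\<^esub> a" unfolding RCOSETS_def by blast
      have "d = m_inv F ` (inv\<^bsub>F\<^esub> a <#\<^bsub>F\<^esub> K)"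
      proof -
        have "m_inv F ` (inv\<^bsub>F\<^esub> a <#\<^bsub>F\<^esub> K) = (\<lambda>h. inv\<^bsub>F\<^esub> (inv\<^bsub>F\<^esub> a \<otimes>\<^bsub>F\<^esub> h)) ` K"
          unfolding l_coset_def by auto
        also have "\<dots> = (\<lambda>h. inv\<^bsub>F\<^esub> h \<otimes>\<^bsub>F\<^esub> a) ` K"
          using a(1) Kc by (intro image_cong) (auto simp: inv_mult_group)
        also have "\<dots> = (\<lambda>h. h \<otimes>\<^bsub>F\<^esub> a) ` (m_inv F ` K)" by (simp add: image_image)
        also have "m_inv F ` K = K"
        proof
          show "m_inv F ` K \<subseteq> K" using subgroup.m_inv_closed[OF K(1)] by blast
          show "K \<subseteq> m_inv F ` K"
          proof
            fix y assume y: "y \<in> K"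
            then have "y = inv\<^bsub>F\<^esub> (inv\<^bsub>F\<^esub> y)" using Kc by auto
            then show "y \<in> m_inv F ` K" using subgroup.m_inv_closed[OF K(1) y] by (rule image_eqI)
          qed
        qed
        finally show ?thesis using a(2) unfolding r_coset_def by auto
      qed
      then show "d \<in> (\<lambda>c. m_inv F ` c) ` Z" using all[of "inv\<^bsub>F\<^esub> a"] a(1) by blast
    qed
    then show False using K(3) Z(1) finite_surj by blast
  next
    case False
    then obtain y where y: "y \<in> A" "y \<notin> A'" using A(3) by blast
    obtain t where t: "t > 0" "(foldr (coset_action F) [(y, True)] ^^ t) c = c"
      using word_periodic[OF actZ Z(1) _ c(1), of "[(y, True)]"] y(1) by auto
    let ?w = "wpow [(y, True)] t"
    have wB: "fst ` set ?w \<subseteq> {y}" using set_wpow[of "[(y, True)]" t] by auto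
    then have wc: "fst ` set ?w \<subseteq> carrier F" using y(1) Ac by blast
    have "word_val F ?w <#\<^bsub>F\<^esub> (x <#\<^bsub>F\<^esub> K) = x <#\<^bsub>F\<^esub> K"
      using t(2) coset_word[OF wc cc] c(3) by (simp add: word_wpow)
    then obtain h where h: "h \<in> K" "word_val F ?w \<otimes>\<^bsub>F\<^esub> x = x \<otimes>\<^bsub>F\<^esub> h"
      using lcoset_eqD[OF K(1) c(2) word_val_closed[OF wc]] by blast
    have "A' \<subseteq> carrier F" using A(1) Ac by blast
    then obtain v where v: "fst ` set v \<subseteq> A'" "word_val F v = h"
      using generate_word[of h A'] K(2) h(1) by blast
    obtain u where u: "fst ` set u \<subseteq> B" "word_val F u = x" using fbD(3)[OF c(2)] by blast
    have vB: "fst ` set v \<subseteq> B" using v(1) A by blast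
    have cu: "fst ` set u \<subseteq> carrier F" "fst ` set v \<subseteq> carrier F" using u(1) vB fbD(2) by blast+
    \<comment> \<open>The exponent sum of \<open>y\<close> as an action on the integers: it
      distinguishes \<open>?w @ u\<close> from \<open>u @ v\<close>, because \<open>?w\<close>
      contributes \<open>t\<close> and \<open>y\<close> does not occur in \<open>v\<close>.\<close>
    define \<epsilon> :: "'a \<times> bool \<Rightarrow> int \<Rightarrow> int" where
      "\<epsilon> l n = (if fst l = y then if snd l then n + 1 else n - 1 else n)" for l n
    have \<epsilon>: "letter_action \<epsilon> B UNIV" by (auto simp: letter_action_def \<epsilon>_def linv_def)
    have val: "word_val F (?w @ u) = word_val F (u @ v)"
      using h(2) u(2) v(2) cu wc by (simp add: word_val_append)
    have "fst ` set (?w @ u) \<subseteq> B" "fst ` set (u @ v) \<subseteq> B"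
      using wB y(1) A(2) u(1) vB by (auto simp: image_Un)
    then have "foldr \<epsilon> (?w @ u) 0 = foldr \<epsilon> (u @ v) 0"
      using free_word_eq[OF fb \<epsilon> UNIV_I _ _ val] by blast
    moreover have "foldr \<epsilon> v 0 = 0" using v(1) y(2) by (induction v) (auto simp: \<epsilon>_def)
    moreover have "foldr \<epsilon> (wpow [(y, True)] s) n = n + int s" for s n
      by (induction s) (auto simp: \<epsilon>_def)
    ultimately show False using t(1) by simp
  qed
qed

text \<open>A finite part of the coset graph containing the closed paths at \<open>K\<close> along
  which the words of \<open>W\<close> are read; suffixes appear because the last letter acts
  first.\<close>

definition path_cosets :: "('a, 'b) monoid_scheme \<Rightarrow> 'a set \<Rightarrow> ('a \<times> bool) list set \<Rightarrow> 'a set set" where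
  "path_cosets G K W = insert K (\<Union>w\<in>W. (\<lambda>n. foldr (coset_action G) (drop n w) K) ` {..length w})"

lemma (in group) path_cosets_lcoset:
  assumes K: "K \<subseteq> carrier G" and W: "\<And>w. w \<in> W \<Longrightarrow> fst ` set w \<subseteq> carrier G" and "c \<in> path_cosets G K W"
  shows "\<exists>x\<in>carrier G. c = x <# K"
proof -
  from assms(3) consider "c = K" | w m where "w \<in> W" "c = foldr (coset_action G) (drop m w) K"
    by (auto simp: path_cosets_def)
  then show ?thesis
  proof cases
    case 1
    then show ?thesis using lcos_mult_one[OF K] by auto
  next
    case 2
    then have c: "fst ` set (drop m w) \<subseteq> carrier G" using W set_drop_subset[of m w] by blast
    then show ?thesis using coset_word[OF c K] word_val_closed[OF c] 2 by auto
  qed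
qed

section \<open>The separating homomorphism\<close>

text \<open>The word \<open>h i j c\<close> represents an element of the conjugate \<open>g\<^sup>-\<^sup>1 H\<^sub>i g\<close> moving the coset \<open>c\<close> of \<open>H\<^sub>j\<close>,
  and \<open>u i\<close> a cyclically reduced one. In the model built below, a point \<open>v\<close> with \<open>x ^ (P j ^ Suc (n j))\<close>
  fixing \<open>v\<close> for all \<open>x\<close> exists for the image of \<open>H\<^sub>j\<close>, but not for the image of \<open>H\<^sub>i\<close>.\<close>
locale separation =
  fixes F :: "('a, 'b) monoid_scheme" and B A :: "'a set" and x\<^sub>0 y\<^sub>0 :: 'a and k :: nat and H :: "nat \<Rightarrow> 'a set"
    and W :: "nat \<Rightarrow> ('a \<times> bool) list set" and g u :: "nat \<Rightarrow> ('a \<times> bool) list"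
    and h :: "nat \<Rightarrow> nat \<Rightarrow> 'a set \<Rightarrow> ('a \<times> bool) list"
    and P n :: "nat \<Rightarrow> nat" and Q :: "nat \<Rightarrow> 'q set" and \<mu> :: "nat \<Rightarrow> 'a \<times> bool \<Rightarrow> 'q \<Rightarrow> 'q" and e :: "nat \<Rightarrow> 'q"
  assumes fb: "free_basis F B" and A: "A \<subseteq> B" "finite A" "x\<^sub>0 \<in> A" "y\<^sub>0 \<in> A" "x\<^sub>0 \<noteq> y\<^sub>0"
    and H: "\<And>j. j < k \<Longrightarrow> subgroup (H j) F"
    and W: "\<And>j. j < k \<Longrightarrow> finite (W j)" "\<And>j w. j < k \<Longrightarrow> w \<in> W j \<Longrightarrow> fst ` set w \<subseteq> A"
      "\<And>j. j < k \<Longrightarrow> H j = generate F (word_val F ` W j)"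
    and orbit: "\<And>j Z. j < k \<Longrightarrow> finite Z \<Longrightarrow> (\<And>c. c \<in> Z \<Longrightarrow> \<exists>x\<in>carrier F. c = x <#\<^bsub>F\<^esub> H j) \<Longrightarrow>
      (\<And>z c. z \<in> A \<Longrightarrow> c \<in> Z \<Longrightarrow> coset_action F (z, True) c \<in> Z) \<Longrightarrow> Z = {}"
    and gu: "\<And>i. i < k \<Longrightarrow> H i \<noteq> {\<one>\<^bsub>F\<^esub>} \<Longrightarrow> fst ` set (g i) \<subseteq> A \<and> fst ` set (u i) \<subseteq> A \<and> u i \<noteq> [] \<and>
      cyc_reduced (u i) \<and> word_val F (g i @ u i @ winv (g i)) \<in> H i"
    and h: "\<And>i j c. i < k \<Longrightarrow> j < k \<Longrightarrow> \<not> conj_into F (H i) (H j) \<Longrightarrow> c \<in> path_cosets F (H j) (W j) \<Longrightarrow>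
      fst ` set (h i j c) \<subseteq> A \<and> word_val F (g i @ h i j c @ winv (g i)) \<in> H i \<and>
      (\<forall>a. (foldr (coset_action F) (h i j c) ^^ (P j ^ a)) c \<noteq> c)"
    and P: "\<And>j. j < k \<Longrightarrow> Factorial_Ring.prime (P j)" "inj_on P {..<k}"
    and model: "\<And>j. j < k \<Longrightarrow> free_model A {u i | i. i < k \<and> H i \<noteq> {\<one>\<^bsub>F\<^esub>}} (P j ^ Suc (n j)) (Q j) (\<mu> j) (e j)"
begin

interpretation group F by (rule free_basisD(1)[OF fb])

definition q :: "nat \<Rightarrow> nat" where "q j = P j ^ Suc (n j)"

definition cosets :: "nat \<Rightarrow> 'a set set" where "cosets j = path_cosets F (H j) (W j)"

definition \<rho> :: "'a \<times> bool \<Rightarrow> nat \<times> 'a set \<times> 'q \<Rightarrow> nat \<times> 'a set \<times> 'q" where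
  "\<rho> l = (\<lambda>(j, c, s). (j, coset_action F l c, \<mu> j l s))"

definition Y :: "(nat \<times> 'a set \<times> 'q) set" where
  "Y = {(j, c, s). j < k \<and> c \<in> cosets j \<and> s \<in> Q j}"

lemma A_carrier: "A \<subseteq> carrier F"
  using A(1) free_basisD(2)[OF fb] by blast

lemma H_carrier: "j < k \<Longrightarrow> H j \<subseteq> carrier F"
  using H by (rule subgroup.subset)

lemma coset_act: "letter_action (coset_action F) A (Pow (carrier F))"
  using letter_action_mono[OF coset_letter_action A_carrier] .

lemma \<mu>: "j < k \<Longrightarrow> letter_action (\<mu> j) A (Q j)"
  using free_modelD(3)[OF model] .

lemma q_gt0: "j < k \<Longrightarrow> 0 < q j"
  using prime_gt_0_nat[OF P(1)] by (simp add: q_def)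

lemma \<rho>_action: "letter_action \<rho> A {(j, c, s). j < k \<and> c \<subseteq> carrier F \<and> s \<in> Q j}"
  unfolding letter_action_def
  using letter_actionD(1,2)[OF coset_act] letter_actionD(1,2)[OF \<mu>] by (auto simp: \<rho>_def)

lemma \<rho>_word: "foldr \<rho> w (j, c, s) = (j, foldr (coset_action F) w c, foldr (\<mu> j) w s)"
  by (induction w) (auto simp: \<rho>_def)

lemma cosets_lcoset:
  assumes "j < k" "c \<in> cosets j"
  shows "\<exists>x\<in>carrier F. c = x <#\<^bsub>F\<^esub> H j"
  using path_cosets_lcoset[OF H_carrier[OF assms(1)] _ assms(2)[unfolded cosets_def]] W(2)[OF assms(1)] A_carrier
  by blast

lemma cosets_carrier: "j < k \<Longrightarrow> c \<in> cosets j \<Longrightarrow> c \<subseteq> carrier F"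
  using cosets_lcoset[of j c] l_coset_subset_G[OF H_carrier] by blast

lemma finite_Y: "finite Y"
proof -
  have "finite (cosets j)" if "j < k" for j using W(1)[OF that] by (simp add: cosets_def path_cosets_def)
  then have "finite (\<Union>j<k. {j} \<times> cosets j \<times> Q j)" using free_modelD(1)[OF model] by blast
  moreover have "Y \<subseteq> (\<Union>j<k. {j} \<times> cosets j \<times> Q j)" by (auto simp: Y_def)
  ultimately show ?thesis by (rule finite_subset[rotated])
qed

lemma no_closed:
  assumes Z: "Z \<subseteq> Y" "\<And>z. z \<in> A \<Longrightarrow> \<rho> (z, True) ` Z \<subseteq> Z"
  shows "Z = {}"
proof (rule ccontr)
  assume "Z \<noteq> {}"
  then obtain j c s where jcs: "(j, c, s) \<in> Z" by (metis ex_in_conv prod_cases3)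
  then have j: "j < k" using Z(1) by (auto simp: Y_def)
  let ?Z = "{c. \<exists>s. (j, c, s) \<in> Z}"
  have "?Z = {}"
  proof (rule orbit[OF j])
    have "?Z \<subseteq> (fst \<circ> snd) ` Z" by force
    then show "finite ?Z" by (rule finite_subset[OF _ finite_imageI[OF finite_subset[OF Z(1) finite_Y]]])
    show "\<exists>x\<in>carrier F. c = x <#\<^bsub>F\<^esub> H j" if "c \<in> ?Z" for c
      using that Z(1) cosets_lcoset[OF j] by (auto simp: Y_def)
    show "coset_action F (z, True) c \<in> ?Z" if zc: "z \<in> A" "c \<in> ?Z" for z c
    proof -
      obtain s where "(j, c, s) \<in> Z" using zc(2) by blast
      then have "\<rho> (z, True) (j, c, s) \<in> Z" using Z(2)[OF zc(1)] by blast
      then show ?thesis by (auto simp: \<rho>_def)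
    qed
  qed
  then show False using jcs by blast
qed

text \<open>This yields the \<open>L\<close> of the model. Powers of the cyclically reduced
  \<open>u i\<close> are reduced as they stand, those of \<open>h i j c\<close> only after
  \<open>nf\<close>.\<close>

lemma word_bound:
  "\<exists>L. (\<forall>i<k. \<forall>j<k. length (wpow (u i) (q j)) \<le> L \<and> (\<forall>c\<in>cosets j. length (nf (wpow (h i j c) (q j))) \<le> L))"
proof -
  have fin: "finite (cosets j)" if "j < k" for j using W(1)[OF that] by (simp add: cosets_def path_cosets_def)
  let ?S = "(\<Union>i<k. \<Union>j<k. insert (length (wpow (u i) (q j)))
    ((\<lambda>c. length (nf (wpow (h i j c) (q j)))) ` cosets j))"
  have "finite ?S" using fin by auto
  then obtain L where L: "\<forall>s\<in>?S. s \<le> L" using finite_nat_set_iff_bounded_le by blast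
  show ?thesis by (rule exI[of _ L]) (use L in blast)
qed

lemma separated:
  fixes ev :: bool
  shows "\<exists>m f. f \<in> hom F (sym_group m) \<and> carrier (alt_group m) \<subseteq> f ` carrier F \<and>
    (if ev then f ` carrier F \<subseteq> carrier (alt_group m) else f ` carrier F = carrier (sym_group m)) \<and>
    (\<forall>i<k. \<forall>j<k. \<not> conj_into F (H i) (H j) \<longrightarrow> \<not> conj_into (sym_group m) (f ` H i) (f ` H j))"
proof -
  obtain L where L: "\<And>i j. i < k \<Longrightarrow> j < k \<Longrightarrow> length (wpow (u i) (q j)) \<le> L"
    "\<And>i j c. i < k \<Longrightarrow> j < k \<Longrightarrow> c \<in> cosets j \<Longrightarrow> length (nf (wpow (h i j c) (q j))) \<le> L"
    using word_bound by blast
  have YM: "Y \<subseteq> {(j, c, s). j < k \<and> c \<subseteq> carrier F \<and> s \<in> Q j}" using cosets_carrier by (auto simp: Y_def)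
  have nc: "\<forall>Z\<subseteq>Y. (\<forall>z\<in>A. \<rho> (z, True) ` Z \<subseteq> Z) \<longrightarrow> Z = {}"
    by (intro allI impI no_closed) simp_all
  obtain m \<pi> \<iota> where M: "\<forall>z\<in>A. \<pi> z \<in> carrier (sym_group m) \<and> (evenperm (\<pi> z) \<longleftrightarrow> ev)" "\<iota> ` Y \<subseteq> {1..m}"
    "\<forall>z\<in>A. \<forall>a\<in>Y. \<rho> (z, True) a \<in> Y \<longrightarrow> \<pi> z (\<iota> a) = \<iota> (\<rho> (z, True) a)"
    "\<forall>G. subgroup G (sym_group m) \<longrightarrow> \<pi> ` A \<subseteq> G \<longrightarrow> carrier (alt_group m) \<subseteq> G"
    and words: "\<forall>w. fst ` set w \<subseteq> A \<longrightarrow> w \<noteq> [] \<longrightarrow> length w \<le> L \<longrightarrow>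
      (reduced_word w \<longrightarrow> (\<forall>a\<in>Y. foldr (letter_perm \<pi>) w (\<iota> a) = \<iota> a \<longrightarrow> foldr \<rho> w a = a)) \<and>
      (cyc_reduced w \<longrightarrow> (\<forall>v\<in>{1..m} - \<iota> ` Y. foldr (letter_perm \<pi>) w v \<noteq> v))"
    using finite_model[OF A(2-5) \<rho>_action finite_Y YM nc, of ev L] by (elim exE conjE) (rule that; assumption)
  have \<pi>: "\<pi> z permutes {1..m}" "evenperm (\<pi> z) \<longleftrightarrow> ev" if "z \<in> A" for z
    using M(1) that by (auto simp: sym_group_carrier)
  let ?S = "sym_group m" and ?p = "letter_perm \<pi>"
  interpret S: group ?S by (rule sym_group_is_group)
  \<comment> \<open>Basis letters outside \<open>A\<close> go to the identity, which is even, so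
    they cannot spoil the inclusion in the alternating group.\<close>
  define \<phi> where "\<phi> b = (if b \<in> A then \<pi> b else id)" for b
  have \<phi>B: "\<phi> ` B \<subseteq> carrier ?S" using \<pi>(1) permutes_id by (auto simp: \<phi>_def sym_group_carrier)
  obtain f where f: "f \<in> hom F ?S" "\<And>w. fst ` set w \<subseteq> B \<Longrightarrow> f (word_val F w) = word_val ?S (map (apfst \<phi>) w)"
    using free_universal[OF fb sym_group_is_group \<phi>B] by blast
  interpret f: group_hom F ?S f using f(1) by unfold_locales
  have fw: "f (word_val F w) = foldr ?p w" if "fst ` set w \<subseteq> A" for w
  proof -
    have "word_val ?S (map (apfst \<phi>) w) = foldr ?p w"
      using that
    proof (induction w)
      case (Cons l w)
      have "letter_val ?S (apfst \<phi> l) = ?p l"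
      proof -
        have l: "fst l \<in> A" using Cons.prems by simp
        then have "\<pi> (fst l) \<in> carrier ?S" using M(1) by blast
        then have "inv\<^bsub>?S\<^esub> (\<pi> (fst l)) = inv' (\<pi> (fst l))" by (rule sym_group_inv_equality)
        then show ?thesis using l by (simp add: letter_val_def letter_perm_def \<phi>_def)
      qed
      then show ?case using Cons by (simp add: word_val_simps sym_group_mult)
    qed (simp add: word_val_simps sym_group_one)
    moreover have "fst ` set w \<subseteq> B" using that A(1) by (rule subset_trans)
    ultimately show ?thesis using f(2) by simp
  qed
  have p_act: "letter_action ?p A {1..m}"
    unfolding letter_action_def
  proof (intro allI impI ballI conjI)
    fix l :: "'a \<times> bool" and v assume l: "fst l \<in> A" and v: "v \<in> {1..m}"
    note pm = \<pi>(1)[OF l]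
    show "?p l v \<in> {1..m}"
      using v permutes_in_image[OF pm] permutes_in_image[OF permutes_inv[OF pm]] by (simp add: letter_perm_def)
    show "?p (linv l) (?p l v) = v" using permutes_inverses[OF pm] by (simp add: letter_perm_def linv_def)
  qed
  have f_perm: "f x permutes {1..m}" if "x \<in> carrier F" for x
    using f.hom_closed[OF that] by (simp add: sym_group_carrier)

  have letter: "?p l (\<iota> a) = \<iota> (\<rho> l a)" if l: "fst l \<in> A" and a: "a \<in> Y" "\<rho> l a \<in> Y" for l a
  proof (cases "snd l")
    case True
    then show ?thesis using M(3) l a by (cases l) (auto simp: letter_perm_def)
  next
    case False
    then have "\<rho> (fst l, True) (\<rho> l a) = a"
      using letter_actionD(2)[OF \<rho>_action l] a(1) YM by (auto simp: linv_def)
    then have "\<pi> (fst l) (\<iota> (\<rho> l a)) = \<iota> a" using M(3) l a by metis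
    then show ?thesis using False permutes_inverses(2)[OF \<pi>(1)[OF l]] by (metis letter_perm_def)
  qed
  \<comment> \<open>By the choice of \<open>path_cosets\<close> every intermediate point lies in
    \<open>Y\<close>, so the model follows the path; a generator returns to the coset
    \<open>H j\<close> and moves only the \<open>Q j\<close> coordinate.\<close>
  have loop: "foldr ?p w (\<iota> (j, H j, s)) = \<iota> (j, H j, foldr (\<mu> j) w s)"
    if j: "j < k" and w: "w \<in> W j" and s: "s \<in> Q j" for j w s
  proof -
    have wA: "fst ` set w \<subseteq> A" by (rule W(2)[OF j w])
    have inY: "foldr \<rho> (drop t w) (j, H j, s) \<in> Y" for t
    proof -
      have "fst ` set (drop t w) \<subseteq> A" using wA set_drop_subset[of t w] by blast
      then have "foldr (\<mu> j) (drop t w) s \<in> Q j" using word_closed[OF \<mu>[OF j]] s by blast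
      moreover have "foldr (coset_action F) (drop t w) (H j) \<in> cosets j"
      proof (cases "t \<le> length w")
        case True
        then show ?thesis using w by (auto simp: cosets_def path_cosets_def)
      qed (simp add: cosets_def path_cosets_def)
      ultimately show ?thesis using j by (simp add: \<rho>_word Y_def)
    qed
    have "foldr ?p v (\<iota> (j, H j, s)) = \<iota> (foldr \<rho> v (j, H j, s))" if "w = v' @ v" for v v'
      using that
    proof (induction v arbitrary: v')
      case (Cons l v)
      have "foldr \<rho> v (j, H j, s) \<in> Y" "foldr \<rho> (l # v) (j, H j, s) \<in> Y"
        using inY[of "length (v' @ [l])"] inY[of "length v'"] Cons.prems by simp_all
      moreover have "fst l \<in> A" using wA Cons.prems by auto
      ultimately show ?case using letter[of l "foldr \<rho> v (j, H j, s)"] Cons.IH[of "v' @ [l]"] Cons.prems by simp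
    qed simp
    from this[of "[]" w] have "foldr ?p w (\<iota> (j, H j, s)) = \<iota> (foldr \<rho> w (j, H j, s))" by simp
    moreover have "foldr (coset_action F) w (H j) = H j"
    proof -
      have wc: "fst ` set w \<subseteq> carrier F" using wA A_carrier by blast
      have "word_val F w \<in> H j" using w W(3)[OF j] generate.incl[of "word_val F w"] by blast
      then show ?thesis
        using coset_word[OF wc H_carrier[OF j]] coset_join3[OF word_val_closed[OF wc] H[OF j]] by simp
    qed
    ultimately show ?thesis by (simp add: \<rho>_word)
  qed
  have base: "\<iota> (j, H j, s) \<in> {1..m}" if "j < k" "s \<in> Q j" for j s
  proof -
    have "(j, H j, s) \<in> Y" using that by (simp add: Y_def cosets_def path_cosets_def)
    then show ?thesis using M(2) by blast
  qed
  \<comment> \<open>One suitable word for each element is enough: other words for it may leave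
    \<open>Y\<close> on their way, but the value of \<open>f\<close> does not depend on the
    word.\<close>
  have good: "\<exists>w. fst ` set w \<subseteq> A \<and> word_val F w = x \<and>
      (\<forall>s\<in>Q j. foldr ?p w (\<iota> (j, H j, s)) = \<iota> (j, H j, foldr (\<mu> j) w s))"
    if j: "j < k" and x: "x \<in> generate F (word_val F ` W j)" for j x
    using x
  proof (induction rule: generate.induct)
    case one
    show ?case by (rule exI[of _ "[]"]) (auto simp: word_val_simps)
  next
    case (incl x)
    then obtain w where w: "w \<in> W j" "x = word_val F w" by blast
    then show ?case using loop[OF j w(1)] W(2)[OF j w(1)] by (intro exI[of _ w]) simp
  next
    case (inv x)
    then obtain w where w: "w \<in> W j" "x = word_val F w" by blast
    have wA: "fst ` set w \<subseteq> A" by (rule W(2)[OF j w(1)])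
    show ?case
    proof (intro exI[of _ "winv w"] conjI ballI)
      show "fst ` set (winv w) \<subseteq> A" using wA by simp
      show "word_val F (winv w) = inv\<^bsub>F\<^esub> x" using w(2) wA A_carrier by (simp add: word_val_winv subset_trans)
      fix s assume s: "s \<in> Q j"
      let ?s = "foldr (\<mu> j) (winv w) s"
      have sQ: "?s \<in> Q j" using word_closed[OF \<mu>[OF j] _ s, of "winv w"] wA by simp
      have "foldr (\<mu> j) w ?s = s" using word_winv[OF \<mu>[OF j] _ s, of "winv w"] wA by simp
      then have "foldr ?p w (\<iota> (j, H j, ?s)) = \<iota> (j, H j, s)" using loop[OF j w(1) sQ] by simp
      then show "foldr ?p (winv w) (\<iota> (j, H j, s)) = \<iota> (j, H j, ?s)"
        using word_winv[OF p_act wA base[OF j sQ]] by simp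
    qed
  next
    case (eng x y)
    then obtain v w where v: "fst ` set v \<subseteq> A" "word_val F v = x"
        "\<forall>s\<in>Q j. foldr ?p v (\<iota> (j, H j, s)) = \<iota> (j, H j, foldr (\<mu> j) v s)"
      and w: "fst ` set w \<subseteq> A" "word_val F w = y"
        "\<forall>s\<in>Q j. foldr ?p w (\<iota> (j, H j, s)) = \<iota> (j, H j, foldr (\<mu> j) w s)" by blast
    have "\<forall>s\<in>Q j. foldr (\<mu> j) w s \<in> Q j" using word_closed[OF \<mu>[OF j] w(1)] by blast
    then show ?case
      using v w A_carrier by (intro exI[of _ "v @ w"]) (auto simp: word_val_append image_Un subset_trans)
  qed
  have fixes_j: "(f x ^^ q j) (\<iota> (j, H j, e j)) = \<iota> (j, H j, e j)" if j: "j < k" and x: "x \<in> H j" for j x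
  proof -
    obtain w where w: "fst ` set w \<subseteq> A" "word_val F w = x"
      "\<forall>s\<in>Q j. foldr ?p w (\<iota> (j, H j, s)) = \<iota> (j, H j, foldr (\<mu> j) w s)" using good[OF j x[unfolded W(3)[OF j]]] by blast
    note eQ = free_modelD(2)[OF model[OF j]]
    have "(f x ^^ t) (\<iota> (j, H j, e j)) = \<iota> (j, H j, (foldr (\<mu> j) w ^^ t) (e j)) \<and> (foldr (\<mu> j) w ^^ t) (e j) \<in> Q j" for t
    proof (induction t)
      case (Suc t)
      then show ?case using fw[OF w(1)] w(2,3) word_closed[OF \<mu>[OF j] w(1)] by simp
    qed (simp add: eQ)
    moreover have "(foldr (\<mu> j) w ^^ q j) (e j) = e j"
      unfolding q_def by (rule free_modelD(4)[OF model[OF j] w(1) eQ])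
    ultimately show ?thesis by simp
  qed
  have moves: "\<exists>x\<in>H i. (f x ^^ q j) v \<noteq> v"
    if i: "i < k" and j: "j < k" and nc: "\<not> conj_into F (H i) (H j)" and v: "v \<in> {1..m}" for i j v
  proof (rule ccontr)
    assume "\<not> (\<exists>x\<in>H i. (f x ^^ q j) v \<noteq> v)"
    then have fix_v: "(f x ^^ q j) v = v" if "x \<in> H i" for x using that by blast
    have nt: "H i \<noteq> {\<one>\<^bsub>F\<^esub>}"
    proof
      assume "H i = {\<one>\<^bsub>F\<^esub>}"
      then have "conj_into F (H i) (H j)"
        unfolding conj_into_def using subgroup.one_closed[OF H[OF j]] by (intro bexI[of _ "\<one>\<^bsub>F\<^esub>"]) auto
      then show False using nc by blast
    qed
    note guD = gu[OF i nt]
    define v' where "v' = foldr ?p (winv (g i)) v"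
    have gA: "fst ` set (winv (g i)) \<subseteq> A" using guD by simp
    have v': "v' \<in> {1..m}" unfolding v'_def by (rule word_closed[OF p_act gA v])
    have gv: "foldr ?p (g i) v' = v" using word_winv[OF p_act gA v] by (simp add: v'_def)
    \<comment> \<open>Passing from \<open>v\<close> to \<open>v'\<close> replaces \<open>H i\<close>
      by its conjugate under \<open>g i\<close>, to which \<open>u i\<close> and the words
      \<open>h i j c\<close> belong.\<close>
    have conj_fix: "foldr ?p (wpow w (q j)) v' = v'"
      if w: "fst ` set w \<subseteq> A" "word_val F (g i @ w @ winv (g i)) \<in> H i" for w
    proof -
      let ?c = "g i @ w @ winv (g i)"
      have cA: "fst ` set ?c \<subseteq> A" using w(1) guD by (simp add: image_Un)
      have pow: "(foldr ?p ?c ^^ t) v = foldr ?p (g i) ((foldr ?p w ^^ t) v') \<and> (foldr ?p w ^^ t) v' \<in> {1..m}" for t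
      proof (induction t)
        case 0
        then show ?case using gv v' by simp
      next
        case (Suc t)
        let ?z = "(foldr ?p w ^^ t) v'"
        have "foldr ?p ?c (foldr ?p (g i) ?z) = foldr ?p (g i) (foldr ?p w ?z)"
          using word_winv[OF p_act _ conjunct2[OF Suc], of "g i"] guD by simp
        then show ?case using Suc word_closed[OF p_act w(1)] by simp
      qed
      have "(foldr ?p ?c ^^ q j) v = v" using fix_v[OF w(2)] fw[OF cA] by simp
      then have "foldr ?p (g i) ((foldr ?p w ^^ q j) v') = foldr ?p (g i) v'" using pow[of "q j"] gv by simp
      then have "(foldr ?p w ^^ q j) v' = v'"
        using word_inj[OF p_act _ conjunct2[OF pow[of "q j"]] v'] guD by blast
      then show ?thesis by (simp add: word_wpow)
    qed
    let ?w = "wpow (u i) (q j)"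
    have "fst ` set ?w \<subseteq> A" using guD set_wpow[of "u i" "q j"] by blast
    moreover have "?w \<noteq> []" "cyc_reduced ?w" "reduced_word ?w"
      using guD q_gt0[OF j] cyc_reduced_wpow reduced_wpow by auto
    ultimately have w: "fst ` set ?w \<subseteq> A" "?w \<noteq> []" "cyc_reduced ?w" "reduced_word ?w" by blast+
    have w_fix: "foldr ?p ?w v' = v'" using conj_fix guD by blast
    have "v' \<in> \<iota> ` Y" using words w L(1)[OF i j] w_fix v' by blast
    then obtain l c s where a: "v' = \<iota> (l, c, s)" "(l, c, s) \<in> Y" by auto
    then have l: "l < k" "c \<in> cosets l" "s \<in> Q l" by (auto simp: Y_def)
    show False
    proof (cases "l = j")
      case False
      have "foldr \<rho> ?w (l, c, s) = (l, c, s)" using words w L(1)[OF i j] w_fix a by blast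
      then have "foldr (\<mu> l) ?w s = s" by (simp add: \<rho>_word)
      \<comment> \<open>In a foreign piece \<open>u i\<close> also has \<open>P l\<close>-power
        order on \<open>Q l\<close>; as \<open>q j\<close> is coprime to it, \<open>u i\<close>
        itself would fix \<open>s\<close>, against its freeness.\<close>
      then have "(foldr (\<mu> l) (u i) ^^ q j) s = s" by (simp only: word_wpow)
      moreover have "(foldr (\<mu> l) (u i) ^^ q l) s = s"
        unfolding q_def using free_modelD(4)[OF model[OF l(1)] _ l(3)] guD by blast
      moreover have "coprime (q j) (q l)"
      proof -
        have "P j \<noteq> P l" using P(2) j l(1) False by (auto simp: inj_on_def)
        then have "coprime (P j) (P l)" using primes_coprime P(1) j l(1) by blast
        then show ?thesis by (simp add: q_def)
      qed
      ultimately have "foldr (\<mu> l) (u i) s = s"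
        by (rule coprime_fixed) (use q_gt0[OF j] in simp)
      then show False using free_modelD(5)[OF model[OF l(1)], of "u i" s] l(3) i nt by blast
    next
      case True
      \<comment> \<open>In the piece of \<open>H j\<close> the word \<open>h i j c\<close> moves the
        coset \<open>c\<close> under all powers of \<open>P j\<close>. Returning paths are
        controlled for nonempty reduced words, hence the passage to \<open>nf\<close>; if
        \<open>nf ?h\<close> is empty, the coset is fixed at once.\<close>
      note hD = h[OF i j nc l(2)[unfolded cosets_def True]]
      let ?h = "wpow (h i j c) (q j)"
      have hA: "fst ` set ?h \<subseteq> A" using hD set_wpow[of "h i j c" "q j"] by blast
      have cc: "c \<in> Pow (carrier F)" using cosets_carrier[OF l(1,2)] by simp
      have "foldr ?p (nf ?h) v' = v'" using conj_fix[of "h i j c"] hD word_nf[OF p_act hA v'] by simp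
      then have "nf ?h \<noteq> [] \<Longrightarrow> foldr \<rho> (nf ?h) (l, c, s) = (l, c, s)"
        using words fst_nf[OF hA] reduced_nf L(2)[OF i j, of c] l(2) True a by blast
      then have "foldr (coset_action F) (nf ?h) c = c" by (cases "nf ?h = []") (auto simp: \<rho>_word)
      then have "foldr (coset_action F) ?h c = c" using word_nf[OF coset_act hA cc] by simp
      then show False using hD unfolding word_wpow q_def by blast
    qed
  qed
  have not_conj: "\<not> conj_into ?S (f ` H i) (f ` H j)"
    if i: "i < k" and j: "j < k" and nc: "\<not> conj_into F (H i) (H j)" for i j
  proof
    assume "conj_into ?S (f ` H i) (f ` H j)"
    then obtain x where x: "x permutes {1..m}"
      and sub: "\<And>y. y \<in> H i \<Longrightarrow> x \<circ> f y \<circ> inv' x \<in> f ` H j"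
      unfolding conj_into_def by (auto simp: sym_group_carrier sym_group_mult image_subset_iff)
    let ?v = "\<iota> (j, H j, e j)"
    have v: "?v \<in> {1..m}" by (rule base[OF j free_modelD(2)[OF model[OF j]]])
    have "inv' x ?v \<in> {1..m}" using v permutes_in_image[OF permutes_inv[OF x]] by blast
    then obtain y where y: "y \<in> H i" "(f y ^^ q j) (inv' x ?v) \<noteq> inv' x ?v" using moves[OF i j nc] by blast
    have "((x \<circ> f y \<circ> inv' x) ^^ t) ?v = x ((f y ^^ t) (inv' x ?v))" for t
      by (induction t) (simp_all add: permutes_inverses[OF x])
    moreover obtain z where "z \<in> H j" "x \<circ> f y \<circ> inv' x = f z" using sub[OF y(1)] by blast
    ultimately have "x ((f y ^^ q j) (inv' x ?v)) = ?v" using fixes_j[OF j] by metis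
    then show False using y(2) permutes_inverses(2)[OF x] by metis
  qed
  have img: "subgroup (f ` carrier F) ?S" by (rule f.img_is_subgroup)
  have \<pi>_img: "\<pi> z \<in> f ` carrier F" if z: "z \<in> A" for z
  proof -
    have "f (word_val F [(z, True)]) = \<pi> z" using fw[of "[(z, True)]"] z by (simp add: letter_perm_def)
    moreover have "word_val F [(z, True)] \<in> carrier F" using z A_carrier by (intro word_val_closed) auto
    ultimately show ?thesis by (metis image_eqI)
  qed
  have alt: "carrier (alt_group m) \<subseteq> f ` carrier F" using M(4) img \<pi>_img by blast
  have "if ev then f ` carrier F \<subseteq> carrier (alt_group m) else f ` carrier F = carrier ?S"
  proof (cases ev)
    case True
    have fb_img: "f b = \<phi> b" if b: "b \<in> B" for b
    proof -
      have "b \<in> carrier F" "\<phi> b \<in> carrier ?S" using b free_basisD(2)[OF fb] \<phi>B by auto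
      then show ?thesis using f(2)[of "[(b, True)]"] b by (simp add: word_val_simps letter_val_def)
    qed
    have "f ` B \<subseteq> carrier (alt_group m)"
      using fb_img \<pi> True permutes_id by (auto simp: \<phi>_def alt_group_carrier evenperm_id)
    then have "generate ?S (f ` B) \<subseteq> carrier (alt_group m)"
      by (rule S.generate_subgroup_incl[OF _ alt_group_is_subgroup])
    moreover have "generate ?S (f ` B) = f ` carrier F"
      using f.generate_img[OF free_basisD(2)[OF fb]] fb by (simp add: free_basis_def)
    ultimately show ?thesis using True by simp
  next
    case False
    \<comment> \<open>One odd permutation in the image is enough beyond the alternating group: an
      odd \<open>x\<close> becomes even after composition with it.\<close>
    let ?a = "\<pi> x\<^sub>0"
    have a: "?a permutes {1..m}" "\<not> evenperm ?a" "?a \<in> f ` carrier F" using \<pi> \<pi>_img A(3) False by auto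
    have "x \<in> f ` carrier F" if x: "x \<in> carrier ?S" for x
    proof (cases "evenperm x")
      case True
      then show ?thesis using alt x by (auto simp: alt_group_carrier sym_group_carrier)
    next
      case odd: False
      have "evenperm (x \<circ> ?a)"
        using odd a x evenperm_comp[of x ?a] permutation_permutes[of x] permutation_permutes[of ?a]
        by (auto simp: sym_group_carrier)
      then have "x \<circ> ?a \<in> f ` carrier F"
        using alt x a(1) permutes_compose[OF a(1)] by (auto simp: alt_group_carrier sym_group_carrier)
      moreover have "inv' ?a \<in> f ` carrier F"
        using subgroup.m_inv_closed[OF img a(3)] sym_group_inv_equality[of ?a m] a(1) by (simp add: sym_group_carrier)
      ultimately have "(x \<circ> ?a) \<circ> inv' ?a \<in> f ` carrier F"
        using subgroup.m_closed[OF img] by (metis sym_group_mult)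
      moreover have "(x \<circ> ?a) \<circ> inv' ?a = x" using permutes_inv_o(1)[OF a(1)] by (simp add: comp_assoc)
      ultimately show ?thesis by simp
    qed
    then show ?thesis using False subgroup.subset[OF img] by auto
  qed
  then show ?thesis using f(1) alt not_conj by (intro exI[of _ m] exI[of _ f]) blast
qed

end

section \<open>Choice of letters, test words, primes and quotients\<close>

lemma noncommutative_basis:
  assumes fb: "free_basis F B" and nc: "\<not> comm_group F"
  shows "\<exists>x y. x \<in> B \<and> y \<in> B \<and> x \<noteq> y"
proof (rule ccontr)
  assume neg: "\<not> ?thesis"
  interpret group F by (rule free_basisD(1)[OF fb])
  note B = free_basisD(2)[OF fb]
  obtain b where b: "b \<in> carrier F" "B \<subseteq> {b}"
  proof (cases "B = {}")
    case True
    then show ?thesis using that[of "\<one>\<^bsub>F\<^esub>"] by simp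
  next
    case False
    then obtain b where "b \<in> B" by blast
    then show ?thesis using that[of b] neg B by blast
  qed
  have pow: "\<exists>n::int. x = b [^]\<^bsub>F\<^esub> n" if "x \<in> carrier F" for x
  proof -
    have "x \<in> generate F {b}" using that mono_generate[OF b(2)] fb by (auto simp: free_basis_def)
    then show ?thesis using generate_pow[OF b(1)] by auto
  qed
  have "comm_group F"
  proof (rule group_comm_groupI)
    fix x y assume "x \<in> carrier F" "y \<in> carrier F"
    then obtain m n :: int where "x = b [^]\<^bsub>F\<^esub> m" "y = b [^]\<^bsub>F\<^esub> n" using pow by blast
    then show "x \<otimes>\<^bsub>F\<^esub> y = y \<otimes>\<^bsub>F\<^esub> x" using b(1) by (simp add: int_pow_mult[symmetric] add.commute)
  qed
  then show False using nc by blast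
qed

text \<open>The dependencies are not circular: \<open>g\<close>, \<open>u\<close> and the
  coset-moving words \<open>h\<close> come from the subgroups alone, the primes have to exceed
  bounds given by \<open>h\<close>, and the quotients depend on the primes and on
  \<open>u\<close>.\<close>

lemma separation_exists:
  fixes F :: "('a, 'b) monoid_scheme" and H :: "nat \<Rightarrow> 'a set" and k :: nat
  assumes fb: "free_basis F B" and nc: "\<not> comm_group F"
    and fg: "\<forall>i<k. fin_gen_subgroup F (H i)"
    and "\<forall>i<k. infinite (rcosets\<^bsub>F\<^esub> (H i))"
  shows "\<exists>A x\<^sub>0 y\<^sub>0 W g u h P n (Q :: nat \<Rightarrow> ((nat \<Rightarrow> int) \<Rightarrow> nat \<Rightarrow> int) set) \<mu> e.
    separation F B A x\<^sub>0 y\<^sub>0 k H W g u h P n Q \<mu> e"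
proof -
  note fbD = free_basisD[OF fb]
  interpret group F by (rule fbD)
  have inf: "infinite (rcosets\<^bsub>F\<^esub> (H i))" if "i < k" for i using assms(4) that by simp
  obtain x\<^sub>0 y\<^sub>0 where xy: "x\<^sub>0 \<in> B" "y\<^sub>0 \<in> B" "x\<^sub>0 \<noteq> y\<^sub>0" using noncommutative_basis[OF fb nc] by blast
  have H: "subgroup (H j) F" if "j < k" for j using fg that by (simp add: fin_gen_subgroup_def)
  have Hc: "H j \<subseteq> carrier F" if "j < k" for j using subgroup.subset[OF H[OF that]] .
  have "\<forall>j\<in>{..<k}. \<exists>W. finite W \<and> (\<forall>w\<in>W. fst ` set w \<subseteq> B) \<and> H j = generate F (word_val F ` W)"
  proof
    fix j assume "j \<in> {..<k}"
    then have "j < k" by simp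
    obtain S where S: "finite S" "S \<subseteq> carrier F" "generate F S = H j"
      using fg \<open>j < k\<close> by (auto simp: fin_gen_subgroup_def)
    have "\<forall>s\<in>S. \<exists>w. fst ` set w \<subseteq> B \<and> word_val F w = s" using fbD(3) S(2) by blast
    from bchoice[OF this] obtain wd where wd: "\<forall>s\<in>S. fst ` set (wd s) \<subseteq> B \<and> word_val F (wd s) = s" by (rule exE)
    then have "word_val F ` wd ` S = S" unfolding image_image by simp
    then have gen: "H j = generate F (word_val F ` wd ` S)" using S(3) by (simp only:)
    have "finite (wd ` S)" "\<forall>w\<in>wd ` S. fst ` set w \<subseteq> B" using S(1) wd by simp_all
    then show "\<exists>W. finite W \<and> (\<forall>w\<in>W. fst ` set w \<subseteq> B) \<and> H j = generate F (word_val F ` W)"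
      by (intro exI[of _ "wd ` S"] conjI gen)
  qed
  from bchoice[OF this]
  obtain W where "\<forall>j\<in>{..<k}. finite (W j) \<and> (\<forall>w\<in>W j. fst ` set w \<subseteq> B) \<and> H j = generate F (word_val F ` W j)"
    by (rule exE)
  then have W: "finite (W j)" "\<And>w. w \<in> W j \<Longrightarrow> fst ` set w \<subseteq> B" "H j = generate F (word_val F ` W j)" if "j < k" for j
    using that by simp_all
  define A' where "A' = (\<Union>j<k. \<Union>w\<in>W j. fst ` set w)"
  have A': "finite A'" "A' \<subseteq> B"
    unfolding A'_def by (simp add: W(1), intro UN_least W(2)) simp_all
  have WA': "fst ` set w \<subseteq> A'" if "j < k" "w \<in> W j" for j w using that by (auto simp: A'_def)
  have HA': "H j \<subseteq> generate F A'" if j: "j < k" for j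
  proof -
    have "word_val F ` W j \<subseteq> generate F A'" using word_generate[OF WA'[OF j]] by blast
    then show ?thesis
      unfolding W(3)[OF j] using A'(2) fbD(2) by (intro generate_subgroup_incl generate_is_subgroup) auto
  qed
  \<comment> \<open>\<open>B\<close> may be infinite while the model admits finitely many letters.
    In that case a letter absent from the generator words is added, so that finite coset orbits
    remain impossible for the letters of \<open>A\<close> alone.\<close>
  obtain A where A: "finite A" "A' \<subseteq> A" "A \<subseteq> B" "x\<^sub>0 \<in> A" "y\<^sub>0 \<in> A" "A = B \<or> (\<exists>y. y \<in> A \<and> y \<notin> A')"
  proof (cases "finite B")
    case True
    show ?thesis by (rule that[of B]) (use True A' xy in simp_all)
  next
    case False
    then have "infinite (B - A')" using A'(1) by simp
    then have "B - A' \<noteq> {}" by (rule infinite_imp_nonempty)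
    then obtain y where y: "y \<in> B" "y \<notin> A'" by blast
    show ?thesis by (rule that[of "insert y (insert x\<^sub>0 (insert y\<^sub>0 A'))"]) (use y A' xy in auto)
  qed
  have Ac: "A \<subseteq> carrier F" using A(3) fbD(2) by blast
  have WA: "fst ` set w \<subseteq> A" if "j < k" "w \<in> W j" for j w using WA'[OF that] A(2) by blast
  have H_word: "\<exists>w. fst ` set w \<subseteq> A \<and> word_val F w = x" if j: "j < k" and x: "x \<in> H j" for j x
  proof -
    have "x \<in> generate F A" using x HA'[OF j] mono_generate[OF A(2)] by blast
    then show ?thesis using generate_word[OF _ Ac] by blast
  qed
  have gu_ex: "\<exists>g u. fst ` set g \<subseteq> A \<and> (H i \<noteq> {\<one>\<^bsub>F\<^esub>} \<longrightarrow>
    fst ` set u \<subseteq> A \<and> u \<noteq> [] \<and> cyc_reduced u \<and> word_val F (g @ u @ winv g) \<in> H i)" if i: "i < k" for i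
  proof (cases "H i = {\<one>\<^bsub>F\<^esub>}")
    case False
    then obtain x where x: "x \<in> H i" "x \<noteq> \<one>\<^bsub>F\<^esub>" using subgroup.one_closed[OF H[OF i]] by blast
    obtain w where w: "fst ` set w \<subseteq> A" "word_val F w = x" using H_word[OF i x(1)] by blast
    have val: "word_val F (nf w) = x" using word_val_nf[of w] w Ac by blast
    then have "nf w \<noteq> []" using x(2) by (auto simp: word_val_simps)
    then obtain g u where gu: "nf w = g @ u @ winv g" "u \<noteq> []" "cyc_reduced u"
      using cyclic_reduction[OF reduced_nf] by blast
    then show ?thesis using fst_nf[OF w(1)] val x(1)
      by (intro exI[of _ g] exI[of _ u]) (simp add: image_Un)
  qed (auto intro: exI[of _ "[]"])
  define gu where "gu i = (SOME gu. fst ` set (fst gu) \<subseteq> A \<and> (H i \<noteq> {\<one>\<^bsub>F\<^esub>} \<longrightarrow>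
    fst ` set (snd gu) \<subseteq> A \<and> snd gu \<noteq> [] \<and> cyc_reduced (snd gu) \<and>
    word_val F (fst gu @ snd gu @ winv (fst gu)) \<in> H i))" for i
  define g where "g i = fst (gu i)" for i
  define u where "u i = snd (gu i)" for i
  have gu: "fst ` set (g i) \<subseteq> A \<and> (H i \<noteq> {\<one>\<^bsub>F\<^esub>} \<longrightarrow>
    fst ` set (u i) \<subseteq> A \<and> u i \<noteq> [] \<and> cyc_reduced (u i) \<and> word_val F (g i @ u i @ winv (g i)) \<in> H i)"
    if i: "i < k" for i
    unfolding g_def u_def gu_def by (rule someI_ex) (use gu_ex[OF i] in simp)
  define C where "C j = path_cosets F (H j) (W j)" for j
  have finC: "finite (C j)" if "j < k" for j using W(1)[OF that] by (simp add: C_def path_cosets_def)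
  have h_ex: "\<exists>v. fst ` set v \<subseteq> A \<and> word_val F (g i @ v @ winv (g i)) \<in> H i \<and> foldr (coset_action F) v c \<noteq> c"
    if i: "i < k" and j: "j < k" and nci: "\<not> conj_into F (H i) (H j)" and c: "c \<in> C j" for i j c
  proof (rule ccontr)
    assume neg: "\<not> ?thesis"
    have "fst ` set w \<subseteq> carrier F" if "w \<in> W j" for w using WA[OF j that] Ac by blast
    then obtain x where x: "x \<in> carrier F" "c = x <#\<^bsub>F\<^esub> H j"
      using path_cosets_lcoset[OF Hc[OF j]] c unfolding C_def by blast
    have gA: "fst ` set (g i) \<subseteq> A" using gu[OF i] by blast
    then have gc: "fst ` set (g i) \<subseteq> carrier F" using Ac by blast
    let ?g = "word_val F (g i)"
    have g: "?g \<in> carrier F" by (rule word_val_closed[OF gc])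
    \<comment> \<open>If every element of the conjugate of \<open>H i\<close> by
      \<open>inv ?g\<close> fixes the coset of \<open>x\<close>, this one element conjugates all of
      \<open>H i\<close> into \<open>H j\<close>.\<close>
    let ?t = "inv\<^bsub>F\<^esub> x \<otimes>\<^bsub>F\<^esub> inv\<^bsub>F\<^esub> ?g"
    have "?t \<otimes>\<^bsub>F\<^esub> y \<otimes>\<^bsub>F\<^esub> inv\<^bsub>F\<^esub> ?t \<in> H j" if y: "y \<in> H i" for y
    proof -
      obtain w where w: "fst ` set w \<subseteq> A" "word_val F w = y" using H_word[OF i y] by blast
      have wc: "fst ` set w \<subseteq> carrier F" using w(1) Ac by blast
      have yc: "y \<in> carrier F" using y Hc[OF i] by blast
      let ?v = "winv (g i) @ w @ g i"
      have vA: "fst ` set ?v \<subseteq> A" using gA w(1) by (simp add: image_Un)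
      have vc: "fst ` set ?v \<subseteq> carrier F" using vA Ac by blast
      have val: "word_val F ?v = inv\<^bsub>F\<^esub> ?g \<otimes>\<^bsub>F\<^esub> y \<otimes>\<^bsub>F\<^esub> ?g"
        using gc wc g w(2) yc by (simp add: word_val_append word_val_winv image_Un m_assoc)
      have "word_val F (g i @ ?v @ winv (g i)) = ?g \<otimes>\<^bsub>F\<^esub> (word_val F ?v \<otimes>\<^bsub>F\<^esub> inv\<^bsub>F\<^esub> ?g)"
      proof -
        have "fst ` set (?v @ winv (g i)) \<subseteq> carrier F" using vc gc by (simp add: image_Un)
        then show ?thesis
          using word_val_append[OF gc, of "?v @ winv (g i)"] word_val_append[OF vc, of "winv (g i)"] gc
          by (simp add: word_val_winv)
      qed
      also have "\<dots> = y"
      proof -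
        have "inv\<^bsub>F\<^esub> ?g \<otimes>\<^bsub>F\<^esub> y \<otimes>\<^bsub>F\<^esub> ?g \<otimes>\<^bsub>F\<^esub> inv\<^bsub>F\<^esub> ?g = inv\<^bsub>F\<^esub> ?g \<otimes>\<^bsub>F\<^esub> y"
          using g yc by (simp add: m_assoc)
        then show ?thesis using g yc by (simp add: val m_assoc[symmetric])
      qed
      finally have "foldr (coset_action F) ?v c = c" using neg vA y by (metis (no_types, lifting))
      then have "word_val F ?v <#\<^bsub>F\<^esub> (x <#\<^bsub>F\<^esub> H j) = x <#\<^bsub>F\<^esub> H j"
        using coset_word[OF vc l_coset_subset_G[OF Hc[OF j] x(1)]] x(2) by simp
      then obtain k' where k': "k' \<in> H j" "word_val F ?v \<otimes>\<^bsub>F\<^esub> x = x \<otimes>\<^bsub>F\<^esub> k'"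
        using lcoset_eqD[OF H[OF j] x(1) word_val_closed[OF vc]] by blast
      have k'c: "k' \<in> carrier F" using k'(1) Hc[OF j] by blast
      have "?t \<otimes>\<^bsub>F\<^esub> y \<otimes>\<^bsub>F\<^esub> inv\<^bsub>F\<^esub> ?t = inv\<^bsub>F\<^esub> x \<otimes>\<^bsub>F\<^esub> (word_val F ?v \<otimes>\<^bsub>F\<^esub> x)"
        using g x(1) yc by (simp add: val inv_mult_group m_assoc)
      also have "\<dots> = k'" using k'(2) k'c x(1) by (simp add: m_assoc[symmetric])
      finally show ?thesis using k'(1) by simp
    qed
    then have "conj_into F (H i) (H j)"
      unfolding conj_into_def using g x(1) by (intro bexI[of _ ?t]) auto
    then show False using nci by blast
  qed
  define h where "h i j c = (SOME v. fst ` set v \<subseteq> A \<and> word_val F (g i @ v @ winv (g i)) \<in> H i \<and>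
    foldr (coset_action F) v c \<noteq> c)" for i j :: nat and c
  have h: "fst ` set (h i j c) \<subseteq> A \<and> word_val F (g i @ h i j c @ winv (g i)) \<in> H i \<and>
    foldr (coset_action F) (h i j c) c \<noteq> c"
    if "i < k" "j < k" "\<not> conj_into F (H i) (H j)" "c \<in> C j" for i j c
    unfolding h_def by (rule someI_ex) (rule h_ex[OF that])
  \<comment> \<open>Finitely many triples impose a condition on the primes, so a single bound
    \<open>M\<close> serves them all.\<close>
  define T where "T = {(i, j, c). i < k \<and> j < k \<and> \<not> conj_into F (H i) (H j) \<and> c \<in> C j}"
  have "T \<subseteq> (\<Union>j<k. {..<k} \<times> {j} \<times> C j)" by (auto simp: T_def)
  moreover have "finite (\<Union>j<k. {..<k} \<times> {j} \<times> C j)" using finC by blast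
  ultimately have finT: "finite T" by (rule finite_subset)
  have "\<forall>t\<in>T. \<exists>N. \<forall>p>N. Factorial_Ring.prime p \<longrightarrow>
    (case t of (i, j, c) \<Rightarrow> \<forall>a. (foldr (coset_action F) (h i j c) ^^ (p ^ a)) c \<noteq> c)"
  proof
    fix t assume "t \<in> T"
    then obtain i j c where t: "t = (i, j, c)" "i < k" "j < k" "\<not> conj_into F (H i) (H j)" "c \<in> C j"
      by (auto simp: T_def)
    show "\<exists>N. \<forall>p>N. Factorial_Ring.prime p \<longrightarrow>
      (case t of (i, j, c) \<Rightarrow> \<forall>a. (foldr (coset_action F) (h i j c) ^^ (p ^ a)) c \<noteq> c)"
      using prime_power_moves[of "foldr (coset_action F) (h i j c)" c] h[OF t(2-5)] by (simp add: t(1))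
  qed
  from bchoice[OF this] obtain N where N: "\<forall>t\<in>T. \<forall>p>N t. Factorial_Ring.prime p \<longrightarrow>
    (case t of (i, j, c) \<Rightarrow> \<forall>a. (foldr (coset_action F) (h i j c) ^^ (p ^ a)) c \<noteq> c)"
    by (rule exE)
  obtain M where M: "\<forall>s\<in>N ` T. s \<le> M" using finT finite_nat_set_iff_bounded_le by blast
  have "infinite {p :: nat. Factorial_Ring.prime p \<and> p > M}"
  proof
    assume "finite {p :: nat. Factorial_Ring.prime p \<and> p > M}"
    then have "finite ({p :: nat. Factorial_Ring.prime p \<and> p > M} \<union> {..M})" by simp
    moreover have "{p :: nat. Factorial_Ring.prime p} \<subseteq> {p :: nat. Factorial_Ring.prime p \<and> p > M} \<union> {..M}" by auto
    ultimately show False using primes_infinite finite_subset by blast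
  qed
  then obtain P :: "nat \<Rightarrow> nat" where P: "inj P" "range P \<subseteq> {p. Factorial_Ring.prime p \<and> p > M}"
    using infinite_countable_subset by blast
  then have Pp: "Factorial_Ring.prime (P j)" "P j > M" for j by auto
  let ?U = "{u i | i. i < k \<and> H i \<noteq> {\<one>\<^bsub>F\<^esub>}}"
  have "?U \<subseteq> u ` {..<k}" by auto
  then have finU: "finite ?U" using finite_subset by blast
  have U: "w \<in> ?U \<Longrightarrow> reduced_word w \<and> w \<noteq> [] \<and> fst ` set w \<subseteq> A" for w
    using gu by (auto simp: cyc_reduced_def reduced_word_append)
  have "\<forall>j. \<exists>t. case t of (Q :: ((nat \<Rightarrow> int) \<Rightarrow> nat \<Rightarrow> int) set, \<mu>, n, e) \<Rightarrow> free_model A ?U (P j ^ Suc n) Q \<mu> e"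
    using residually_p_regular[OF prime_ge_2_nat[OF Pp(1)] finU U] by (simp del: power_Suc)
  from choice[OF this] obtain t where t: "\<forall>j. case t j of (Q :: ((nat \<Rightarrow> int) \<Rightarrow> nat \<Rightarrow> int) set, \<mu>, n, e) \<Rightarrow>
      free_model A ?U (P j ^ Suc n) Q \<mu> e"
    by (rule exE)
  define Q where "Q j = fst (t j)" for j
  define \<mu> where "\<mu> j = fst (snd (t j))" for j
  define n where "n j = fst (snd (snd (t j)))" for j
  define e where "e j = snd (snd (snd (t j)))" for j
  have model: "free_model A ?U (P j ^ Suc (n j)) (Q j) (\<mu> j) (e j)" for j
    using t by (simp add: Q_def \<mu>_def n_def e_def case_prod_beta del: power_Suc)
  have "separation F B A x\<^sub>0 y\<^sub>0 k H W g u h P n Q \<mu> e"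
  proof (rule separation.intro)
    fix j Z assume "j < k" "finite Z" "\<And>c. c \<in> Z \<Longrightarrow> \<exists>x\<in>carrier F. c = x <#\<^bsub>F\<^esub> H j"
      "\<And>z c. z \<in> A \<Longrightarrow> c \<in> Z \<Longrightarrow> coset_action F (z, True) c \<in> Z"
    then show "Z = {}"
      using no_finite_coset_orbit[OF fb A(2,3,6) H HA' inf, of j Z] by blast
  next
    fix i j c assume ij: "i < k" "j < k" "\<not> conj_into F (H i) (H j)" "c \<in> path_cosets F (H j) (W j)"
    then have "(i, j, c) \<in> T" by (simp add: T_def C_def)
    then have "P j > N (i, j, c)" using M Pp(2)[of j] by (meson image_eqI le_less_trans)
    then have "\<forall>a. (foldr (coset_action F) (h i j c) ^^ (P j ^ a)) c \<noteq> c"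
      using N \<open>(i, j, c) \<in> T\<close> Pp(1)[of j] by fastforce
    then show "fst ` set (h i j c) \<subseteq> A \<and> word_val F (g i @ h i j c @ winv (g i)) \<in> H i \<and>
      (\<forall>a. (foldr (coset_action F) (h i j c) ^^ (P j ^ a)) c \<noteq> c)"
      using h ij by (simp add: C_def)
  next
    show "inj_on P {..<k}" using P(1) inj_on_subset by blast
  next
    fix i assume "i < k" "H i \<noteq> {\<one>\<^bsub>F\<^esub>}"
    then show "fst ` set (g i) \<subseteq> A \<and> fst ` set (u i) \<subseteq> A \<and> u i \<noteq> [] \<and> cyc_reduced (u i) \<and>
        word_val F (g i @ u i @ winv (g i)) \<in> H i"
      using gu[of i] by simp
  next
    fix j
    show "Factorial_Ring.prime (P j)" by (rule Pp(1))
    show "free_model A ?U (P j ^ Suc (n j)) (Q j) (\<mu> j) (e j)" by (rule model)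
  qed ((rule fb A(1,3-5) xy(3)) | (rule H W(1) W(3), assumption) | (rule WA, assumption, assumption))+
  then show ?thesis by blast
qed

theorem theoremA:
  fixes F :: "'a monoid" and H :: "nat \<Rightarrow> 'a set" and k :: nat
  assumes "free_group F"
    and "\<not> comm_group F"
    and "\<And>i. i < k \<Longrightarrow> fin_gen_subgroup F (H i)"
    and "\<And>i. i < k \<Longrightarrow> infinite (rcosets\<^bsub>F\<^esub> (H i))"
  shows "(\<exists>m f. f \<in> hom F (alt_group m) \<and> f ` carrier F = carrier (alt_group m) \<and>
            (\<forall>i<k. \<forall>j<k. \<not> conj_into F (H i) (H j) \<longrightarrow>
                 \<not> conj_into (alt_group m) (f ` H i) (f ` H j)))
       \<and> (\<exists>m' f'. f' \<in> hom F (sym_group m') \<and> f' ` carrier F = carrier (sym_group m') \<and>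
            (\<forall>i<k. \<forall>j<k. \<not> conj_into F (H i) (H j) \<longrightarrow>
                 \<not> conj_into (sym_group m') (f' ` H i) (f' ` H j)))"
proof -
  obtain B where fb: "free_basis F B" using assms(1) by (auto simp: free_group_def)
  have "\<forall>i<k. fin_gen_subgroup F (H i)" "\<forall>i<k. infinite (rcosets\<^bsub>F\<^esub> (H i))"
    using assms(3,4) by blast+
  from separation_exists[OF fb assms(2) this]
  obtain A x\<^sub>0 y\<^sub>0 W g u h P n and Q :: "nat \<Rightarrow> ((nat \<Rightarrow> int) \<Rightarrow> nat \<Rightarrow> int) set" and \<mu> e
    where "separation F B A x\<^sub>0 y\<^sub>0 k H W g u h P n Q \<mu> e" by (elim exE) blast
  then interpret separation F B A x\<^sub>0 y\<^sub>0 k H W g u h P n Q \<mu> e .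
  show ?thesis
  proof
    obtain m f where f: "f \<in> hom F (sym_group m)" "carrier (alt_group m) \<subseteq> f ` carrier F"
      "f ` carrier F \<subseteq> carrier (alt_group m)"
      and sep: "\<forall>i<k. \<forall>j<k. \<not> conj_into F (H i) (H j) \<longrightarrow> \<not> conj_into (sym_group m) (f ` H i) (f ` H j)"
      using separated[of True] by auto
    have "f \<in> hom F (alt_group m)"
      using f(1,3) by (auto simp: hom_def alt_group_mult sym_group_mult)
    \<comment> \<open>A conjugating element of the alternating group also lies in the symmetric
      group, so non-conjugacy there is the stronger property.\<close>
    moreover have "conj_into (sym_group m) K K'" if "conj_into (alt_group m) K K'" for K K'
      using that unfolding conj_into_def
      by (fastforce simp: alt_group_mult sym_group_mult alt_group_inv_equality alt_group_carrier sym_group_carrier)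
    ultimately show "\<exists>m f. f \<in> hom F (alt_group m) \<and> f ` carrier F = carrier (alt_group m) \<and>
        (\<forall>i<k. \<forall>j<k. \<not> conj_into F (H i) (H j) \<longrightarrow> \<not> conj_into (alt_group m) (f ` H i) (f ` H j))"
      using f sep by (intro exI[of _ m] exI[of _ f]) blast
  next
    show "\<exists>m' f'. f' \<in> hom F (sym_group m') \<and> f' ` carrier F = carrier (sym_group m') \<and>
        (\<forall>i<k. \<forall>j<k. \<not> conj_into F (H i) (H j) \<longrightarrow> \<not> conj_into (sym_group m') (f' ` H i) (f' ` H j))"
      using separated[of False] by auto
  qed
qed

end
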